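(* Let $d \geq 2$ and let $A$ be a family of $W^{d}$ $\delta$-atoms in $[0,1]^d$, with $1<W<\delta^{-1}$, such that every $W^{-1}\times \dots\times W^{-1}$ cube contains $O(1)$ $\delta$-atoms from $A$. Let $k \geq 2$. Then for every $\epsilon > 0$ there exist constants $C_1(\epsilon,d)$ and $C_2(\epsilon,d)$ such that if \[ k\geq C_1(\epsilon, d)\delta^{-\epsilon}\cdot \delta^{d-1}|A|, \] then \[ |T_k(A)| \leq C_2(\epsilon,d) \delta^{-\epsilon} \cdot \frac{|A|^2}{k^3}. \]
   Context: A $\delta$-atom is a closed ball in $[0,1]^d$ of diameter $\delta$. A $\delta$-tube is the set of all points in $[0,1]^d$ within distance $\delta/2$ of some fixed line. Two $\delta$-atoms are distinct if they do not intersect; two $\delta$-tubes are distinct if either they do not intersect or the angle between them is $>\delta$. An atom and a tube are incident if they have non-empty intersection. A tube is $k$-rich if it is incident to (passes through) $k$ atoms of $A$, and $T_k(A)$ denotes the set of all (distinct) $k$-rich $\delta$-tubes induced by the set of atoms $A$. Equalities/inequalities are understood up to absolute constants (the shape of atoms, ball or cube, does not matter).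
   Formalization: k is required to exceed the O(1) bound M on atoms per cube (nearly touching atoms refute the claim for 2 ≤ k ≤ M), and the line defining a tube must meet [0,1]^d (otherwise T_k(A) can be infinite for d ≥ 3); constants also depend on the implicit O(1) constants. *)

theory Defs
  imports "HOL-Analysis.Analysis"
begin

definition unit_cube :: "(real ^ 'n) set" where
  "unit_cube = cbox 0 (vec 1)"

definition small_cube :: "real \<Rightarrow> (real ^ 'n) \<Rightarrow> (real ^ 'n) set" where
  "small_cube s a = cbox a (a + vec s)"

definition is_atom :: "real \<Rightarrow> (real ^ 'n) set \<Rightarrow> bool" where
  "is_atom \<delta> B \<longleftrightarrow> (\<exists>c. B = cball c (\<delta> / 2)) \<and> B \<subseteq> unit_cube"

(* W is a real parameter. K and M are the absolute constants implicit in "|A| = W^d" (equalities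
   being understood up to constants) and in "every cube of side 1/W contains O(1) atoms". Cubes
   are axis-parallel and closed. Richness has to be taken above M: two almost touching atoms in one
   cube are met by about delta^(1-d) distinct tubes, which may be far more than |A|^2. *)
definition well_spaced :: "real \<Rightarrow> nat \<Rightarrow> real \<Rightarrow> real \<Rightarrow> (real ^ 'n) set set \<Rightarrow> bool" where
  "well_spaced K M \<delta> W A \<longleftrightarrow>
     finite A \<and> (\<forall>B\<in>A. is_atom \<delta> B) \<and> pairwise disjnt A \<and>
     W ^ CARD('n) / K \<le> real (card A) \<and> real (card A) \<le> K * W ^ CARD('n) \<and>
     (\<forall>a. card {B \<in> A. B \<subseteq> small_cube (1 / W) a} \<le> M)"

definition line_through :: "(real ^ 'n) \<Rightarrow> (real ^ 'n) \<Rightarrow> (real ^ 'n) set" where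
  "line_through p u = range (\<lambda>t. p + t *\<^sub>R u)"

(* A tube does not determine its axis (it is cut off by the unit cube), but the angle between two
   tubes is the angle between their axes, so tubes are represented by their axes. The axis has to
   meet the unit cube: for d >= 3, lines that only pass near a face of the cube can cut out
   infinitely many pairwise disjoint slivers, all meeting the same atoms tangent to that face. *)
definition tube_axis :: "(real ^ 'n) set \<Rightarrow> bool" where
  "tube_axis L \<longleftrightarrow> (\<exists>p u. norm u = 1 \<and> L = line_through p u) \<and> L \<inter> unit_cube \<noteq> {}"

definition tube :: "real \<Rightarrow> (real ^ 'n) set \<Rightarrow> (real ^ 'n) set" where
  "tube \<delta> L = {x \<in> unit_cube. infdist x L \<le> \<delta> / 2}"

definition direction :: "(real ^ 'n) set \<Rightarrow> real ^ 'n" where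
  "direction L = (SOME u. norm u = 1 \<and> (\<exists>p. L = line_through p u))"

(* The direction is unique only up to sign; the absolute value gives the unoriented angle in
   [0, pi/2]. *)
definition line_angle :: "(real ^ 'n) set \<Rightarrow> (real ^ 'n) set \<Rightarrow> real" where
  "line_angle L L' = arccos \<bar>direction L \<bullet> direction L'\<bar>"

lemma line_through_direction_unique:
  assumes "norm u = 1" "norm v = 1" "line_through p u = line_through q v"
  shows "v = u \<or> v = - u"
proof -
  have "q + 0 *\<^sub>R v \<in> line_through p u" "q + 1 *\<^sub>R v \<in> line_through p u"
    unfolding assms(3) unfolding line_through_def by blast+
  then obtain s t where "q + 0 *\<^sub>R v = p + s *\<^sub>R u" "q + 1 *\<^sub>R v = p + t *\<^sub>R u"
    unfolding line_through_def by blast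
  then have v: "v = (t - s) *\<^sub>R u"
    by (simp add: algebra_simps)
  then have "\<bar>t - s\<bar> = 1"
    using assms by simp
  then have "t - s = 1 \<or> t - s = -1" by linarith
  then show ?thesis using v by auto
qed

lemma line_angle_line_through:
  assumes "norm u = 1" "norm v = 1"
  shows "line_angle (line_through p u) (line_through q v) = arccos \<bar>u \<bullet> v\<bar>"
proof -
  have "direction (line_through r w) = w \<or> direction (line_through r w) = - w"
    if "norm w = 1" for r w :: "real ^ 'a"
  proof -
    let ?P = "\<lambda>u'. norm u' = 1 \<and> (\<exists>p'. line_through r w = line_through p' u')"
    have "?P (direction (line_through r w))"
      unfolding direction_def by (rule someI[of ?P w]) (use that in auto)
    then show ?thesis using line_through_direction_unique[OF that] by blast
  qed
  from this[OF assms(1), of p] this[OF assms(2), of q] show ?thesis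
    by (auto simp: line_angle_def)
qed

definition distinct_tubes :: "real \<Rightarrow> (real ^ 'n) set \<Rightarrow> (real ^ 'n) set \<Rightarrow> bool" where
  "distinct_tubes \<delta> L L' \<longleftrightarrow> tube \<delta> L \<inter> tube \<delta> L' = {} \<or> line_angle L L' > \<delta>"

definition incident :: "(real ^ 'n) set \<Rightarrow> (real ^ 'n) set \<Rightarrow> bool" where
  "incident B T \<longleftrightarrow> B \<inter> T \<noteq> {}"

definition rich :: "real \<Rightarrow> nat \<Rightarrow> (real ^ 'n) set set \<Rightarrow> (real ^ 'n) set \<Rightarrow> bool" where
  "rich \<delta> k A L \<longleftrightarrow> k \<le> card {B \<in> A. incident B (tube \<delta> L)}"

(* The possible values of T_k(A): there is a continuum of k-rich tubes, so "the set of distinct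
   k-rich tubes" stands for an arbitrary family of pairwise distinct ones. *)
definition distinct_rich_tubes ::
    "real \<Rightarrow> nat \<Rightarrow> (real ^ 'n) set set \<Rightarrow> (real ^ 'n) set set \<Rightarrow> bool" where
  "distinct_rich_tubes \<delta> k A T \<longleftrightarrow>
     (\<forall>L\<in>T. tube_axis L \<and> rich \<delta> k A L) \<and> pairwise (distinct_tubes \<delta>) T"

end

theory Submission
  imports Defs
begin

text \<open>
  The proof is a second-moment argument on the space of lines. Thicken the tubes to the width \<open>\<delta>'\<close> at which a
  random tube meets about \<open>k\<close> of the atoms, and compare the number of centres near a line at scale \<open>\<delta>'\<close> with the
  normalized number at scale \<open>\<rho> \<sim> 1 / W\<close>. The latter is always small compared with \<open>k\<close>. In the second moment of
  the difference, two points contribute the mean over the lines of an expression whose main terms cancel, which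
  leaves an error of order \<open>\<rho> / t\<close> relative to the main term for points at distance \<open>t\<close>; since the points are
  well spaced, the sum over all pairs exceeds the diagonal by a logarithm only. Hence the thick tubes that contain
  \<open>n \<ge> k\<close> centres satisfy \<open>\<Sum> n\<^sup>2 \<lesssim> |A| * \<delta>' ^ (1 - d) \<sim> |A|\<^sup>2 / k\<close>. Inside a thick tube with \<open>n\<close> centres, double counting
  pairs of centres gives at most about \<open>n\<^sup>2 / k\<^sup>2\<close> distinct \<open>k\<close>-rich thin tubes, and \<open>|A|\<^sup>2 / k\<^sup>3\<close> results. All
  logarithms are absorbed by \<open>\<delta> powr (- \<epsilon>)\<close>.
\<close>

section \<open>Well-spaced points\<close>

text \<open>Subtracting the coarse term acts like the removal of low frequencies in the high-low
  method, and the second moment is useless without it. For thickness \<open>\<alpha>\<close>, the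
  lines near two points at distance \<open>t\<close> have measure about
  \<open>\<alpha> ^ (2 * (d - 1)) / t ^ (d - 1)\<close>, and up to
  \<open>t ^ (d - 1) / \<rho> ^ d\<close> points per unit of \<open>t\<close> lie at distance
  \<open>t\<close> from a given one. So all distances contribute alike, and the pairs at one point
  may add up to \<open>\<alpha> ^ (2 * (d - 1)) / \<rho> ^ d\<close>, while the diagonal gives
  \<open>\<alpha> ^ (d - 1)\<close>. The quotient \<open>\<alpha> ^ (d - 1) / \<rho> ^ d\<close> is
  the number of points expected in a tube of thickness \<open>\<alpha>\<close>, which is about
  \<open>k\<close> at the chosen scale; this whole factor would be lost. The saving
  \<open>\<rho> / t\<close> turns the integral over \<open>t\<close> into a logarithm, and the
  remaining \<open>\<alpha> ^ (2 * (d - 1)) / \<rho> ^ (d - 1)\<close> is at most the diagonal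
  because \<open>\<alpha> \<le> \<rho>\<close>.\<close>

lemma card_le_fibers:
  assumes "finite Q" "finite Z" "g ` Q \<subseteq> Z" "\<And>z. z \<in> Z \<Longrightarrow> card {x \<in> Q. g x = z} \<le> M"
  shows "card Q \<le> M * card Z"
proof -
  have "card Q = (\<Sum>x\<in>Q. 1)" by simp
  also have "\<dots> = (\<Sum>z\<in>Z. \<Sum>x\<in>{x \<in> Q. g x = z}. 1)"
    by (rule sum.group [symmetric]) (use assms in auto)
  also have "\<dots> = (\<Sum>z\<in>Z. card {x \<in> Q. g x = z})" by simp
  also have "\<dots> \<le> (\<Sum>z\<in>Z. M)" by (rule sum_mono) (use assms in auto)
  finally show ?thesis by (simp add: mult.commute)
qed

text \<open>The counting condition of \<open>well_spaced\<close> for points instead of balls. Later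
  \<open>P\<close> consists of the centres of the atoms and \<open>\<rho>\<close> is
  \<open>1 / (8 * d * W)\<close>. The corner \<open>a\<close> is a plain function, so that corners
  can be written as lambda terms.\<close>

definition spaced :: "nat \<Rightarrow> real \<Rightarrow> (real ^ 'n) set \<Rightarrow> bool" where
  "spaced M \<rho> P \<longleftrightarrow> finite P \<and> (\<forall>a. card {x \<in> P. \<forall>j. a j \<le> x $ j \<and> x $ j \<le> a j + \<rho>} \<le> M)"

lemma spaced_subset:
  assumes "spaced M \<rho> P" "Q \<subseteq> P"
  shows "spaced M \<rho> Q"
proof -
  have fin: "finite P" using assms by (simp add: spaced_def)
  have "card {x \<in> Q. \<forall>j. a j \<le> x $ j \<and> x $ j \<le> a j + \<rho>} \<le> M" for a
  proof -
    have "card {x \<in> Q. \<forall>j. a j \<le> x $ j \<and> x $ j \<le> a j + \<rho>}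
        \<le> card {x \<in> P. \<forall>j. a j \<le> x $ j \<and> x $ j \<le> a j + \<rho>}"
      by (rule card_mono) (use fin assms in auto)
    then show ?thesis using assms(1) unfolding spaced_def by (meson le_trans)
  qed
  then show ?thesis using fin assms finite_subset unfolding spaced_def by blast
qed

text \<open>Slabs are moved down to height 0 with this before their lines are sorted into
  cells.\<close>

lemma spaced_translate:
  assumes "spaced M \<rho> P"
  shows "spaced M \<rho> ((\<lambda>x. x - v) ` P)"
proof -
  have inj: "inj_on (\<lambda>x. x - v) S" for S by (auto simp: inj_on_def)
  have "card {x \<in> (\<lambda>x. x - v) ` P. \<forall>j. a j \<le> x $ j \<and> x $ j \<le> a j + \<rho>} \<le> M" for a
  proof -
    have "{x \<in> (\<lambda>x. x - v) ` P. \<forall>j. a j \<le> x $ j \<and> x $ j \<le> a j + \<rho>}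
      = (\<lambda>x. x - v) ` {x \<in> P. \<forall>j. a j + v $ j \<le> x $ j \<and> x $ j \<le> (a j + v $ j) + \<rho>}" (is "_ = _ ` ?R")
    proof -
      have "(\<forall>j. a j \<le> (y - v) $ j \<and> (y - v) $ j \<le> a j + \<rho>) \<longleftrightarrow>
          (\<forall>j. a j + v $ j \<le> y $ j \<and> y $ j \<le> (a j + v $ j) + \<rho>)" for y
        by (simp only: vector_minus_component le_diff_eq diff_le_eq add_ac)
      then show ?thesis by blast
    qed
    moreover have "card ?R \<le> M"
      using assms unfolding spaced_def by (elim conjE allE[where x = "\<lambda>j. a j + v $ j"])
    ultimately show ?thesis by (simp only: card_image[OF inj])
  qed
  then show ?thesis using assms unfolding spaced_def by auto
qed

text \<open>Cubes of side \<open>\<rho>\<close> tile the box. It is open above, so that the index of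
  a cube, a floor, stays below \<open>N j\<close>.\<close>

lemma card_box:
  fixes P :: "(real ^ 'n) set"
  assumes sp: "spaced M \<rho> P" and "\<rho> > 0" and QP: "Q \<subseteq> P"
    and box: "\<And>x j. x \<in> Q \<Longrightarrow> l j \<le> x $ j \<and> x $ j < l j + real (N j) * \<rho>"
  shows "card Q \<le> M * (\<Prod>j\<in>UNIV. N j)"
proof -
  define g where "g = (\<lambda>(x :: real ^ 'n) j. nat \<lfloor>(x $ j - l j) / \<rho>\<rfloor>)"
  have fin: "finite Q" using sp QP finite_subset unfolding spaced_def by blast
  have "card Q \<le> M * card (PiE UNIV (\<lambda>j. {..<N j}))"
  proof (rule card_le_fibers[where g = g])
    show "g ` Q \<subseteq> PiE UNIV (\<lambda>j. {..<N j})"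
    proof (intro image_subsetI PiE_I)
      fix x j assume x: "x \<in> Q"
      have "(x $ j - l j) / \<rho> < real (N j)" "0 \<le> (x $ j - l j) / \<rho>"
        using box[OF x, of j] \<open>\<rho> > 0\<close> by (auto simp: field_simps)
      then show "g x j \<in> {..<N j}" unfolding g_def by auto linarith
    qed simp
    fix z
    have "{x \<in> Q. g x = z} \<subseteq> {x \<in> P. \<forall>j. l j + real (z j) * \<rho> \<le> x $ j \<and> x $ j \<le> l j + real (z j) * \<rho> + \<rho>}"
    proof (intro subsetI CollectI conjI allI)
      fix x assume "x \<in> {x \<in> Q. g x = z}"
      then have x: "x \<in> Q" "z = g x" by auto
      then show "x \<in> P" using QP by auto
      fix j
      have "0 \<le> (x $ j - l j) / \<rho>" using box[OF x(1), of j] \<open>\<rho> > 0\<close> by auto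
      then have "real (g x j) \<le> (x $ j - l j) / \<rho>" "(x $ j - l j) / \<rho> \<le> real (g x j) + 1"
        unfolding g_def by linarith+
      then show "l j + real (z j) * \<rho> \<le> x $ j" "x $ j \<le> l j + real (z j) * \<rho> + \<rho>"
        using x \<open>\<rho> > 0\<close> by (auto simp: field_simps)
    qed
    then have "card {x \<in> Q. g x = z} \<le> card {x \<in> P. \<forall>j. (l j + real (z j) * \<rho>) \<le> x $ j \<and> x $ j \<le> (l j + real (z j) * \<rho>) + \<rho>}"
      by (rule card_mono[rotated]) (use sp in \<open>auto simp: spaced_def\<close>)
    also have "\<dots> \<le> M"
      using sp unfolding spaced_def by (elim conjE allE[where x = "\<lambda>j. l j + real (z j) * \<rho>"])
    finally show "card {x \<in> Q. g x = z} \<le> M" .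
  qed (use fin in \<open>auto intro!: finite_PiE\<close>)
  then show ?thesis by (simp add: card_PiE)
qed

lemma prod_one_direction:
  fixes i :: "'n::finite" and c e :: "'a::comm_monoid_mult"
  shows "(\<Prod>j\<in>UNIV. if j = i then e else c) = e * c ^ (CARD('n) - 1)"
proof -
  have "(\<Prod>j\<in>UNIV. if j = i then e else c) = e * (\<Prod>j\<in>UNIV - {i}. if j = i then e else c)"
    by (subst prod.remove[of _ i]) auto
  also have "(\<Prod>j\<in>UNIV - {i}. if j = i then e else c) = (\<Prod>j\<in>UNIV - {i}. c)"
    by (rule prod.cong) auto
  finally show ?thesis by (simp add: card_Diff_singleton)
qed

text \<open>The range of \<open>x $ i\<close> is cut into at most \<open>3 / \<rho>\<close> layers
  of height \<open>\<rho>\<close>. Across one layer a line of slope at most 3 drifts by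
  \<open>3 * \<rho>\<close>, so the points lie within \<open>(\<Lambda> + 3) * \<rho>\<close> of a
  fixed position; \<open>2 * \<Lambda> + 6\<close> cubes, and one more for the half-open box, cover
  each coordinate. With \<open>\<Lambda> = 1\<close> this bounds the coarse term, with a larger
  \<open>\<Lambda>\<close> the richness \<open>k\<close> itself.\<close>

lemma card_near_line:
  fixes P :: "(real ^ 'n) set"
  assumes sp: "spaced M \<rho> P" and \<rho>: "0 < \<rho>" "\<rho> \<le> 1" and QP: "Q \<subseteq> P"
    and range: "\<And>x. x \<in> Q \<Longrightarrow> 0 \<le> x $ i \<and> x $ i \<le> 2"
    and near: "\<And>x j. x \<in> Q \<Longrightarrow> j \<noteq> i \<Longrightarrow> \<bar>a j + x $ i * b j - x $ j\<bar> \<le> real \<Lambda> * \<rho>"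
    and b: "\<And>j. j \<noteq> i \<Longrightarrow> \<bar>b j\<bar> \<le> 3"
  shows "real (card Q) \<le> 3 * real M * (2 * real \<Lambda> + 7) ^ (CARD('n) - 1) / \<rho>"
proof -
  define g where "g = (\<lambda>x :: real ^ 'n. nat \<lfloor>x $ i / \<rho>\<rfloor>)"
  define N where "N = nat \<lfloor>2 / \<rho>\<rfloor>"
  have fin: "finite Q" using sp QP finite_subset unfolding spaced_def by blast
  have "card Q \<le> (M * (2 * \<Lambda> + 7) ^ (CARD('n) - 1)) * card {..N}"
  proof (rule card_le_fibers[where g = g])
    show "g ` Q \<subseteq> {..N}"
    proof clarsimp
      fix x assume "x \<in> Q"
      then have "x $ i / \<rho> \<le> 2 / \<rho>" using range[of x] \<rho> by (auto simp: divide_right_mono)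
      then show "g x \<le> N" unfolding g_def N_def by (intro nat_mono floor_mono)
    qed
    fix m
    have "card {x \<in> Q. g x = m} \<le> M * (\<Prod>j\<in>UNIV. if j = i then 1 else 2 * \<Lambda> + 7)"
    proof (rule card_box[OF sp \<rho>(1), where l = "\<lambda>j. if j = i then real m * \<rho> else a j + real m * \<rho> * b j - (real \<Lambda> + 3) * \<rho>"])
      fix x j assume "x \<in> {x \<in> Q. g x = m}"
      then have x: "x \<in> Q" "g x = m" by auto
      have "0 \<le> x $ i / \<rho>" using range[OF x(1)] \<rho> by auto
      then have "real m \<le> x $ i / \<rho>" "x $ i / \<rho> < real m + 1"
        using x(2) unfolding g_def by linarith+
      then have m: "real m * \<rho> \<le> x $ i" "x $ i < real m * \<rho> + \<rho>" using \<rho> by (auto simp: field_simps)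
      show "(if j = i then real m * \<rho> else a j + real m * \<rho> * b j - (real \<Lambda> + 3) * \<rho>) \<le> x $ j \<and>
         x $ j < (if j = i then real m * \<rho> else a j + real m * \<rho> * b j - (real \<Lambda> + 3) * \<rho>)
            + real (if j = i then 1 else 2 * \<Lambda> + 7) * \<rho>"
      proof (cases "j = i")
        case True then show ?thesis using m by auto
      next
        case False
        have "\<bar>(x $ i - real m * \<rho>) * b j\<bar> \<le> \<rho> * 3"
          unfolding abs_mult by (rule mult_mono) (use m b[OF False] \<rho> in auto)
        then have "\<bar>(a j + real m * \<rho> * b j) - x $ j\<bar> \<le> (real \<Lambda> + 3) * \<rho>"
          using near[OF x(1) False] by (simp add: algebra_simps)
        then show ?thesis using False \<rho> by (auto simp: algebra_simps)
      qed
    qed (use QP in auto)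
    then show "card {x \<in> Q. g x = m} \<le> M * (2 * \<Lambda> + 7) ^ (CARD('n) - 1)"
      by (simp add: prod_one_direction)
  qed (use fin in auto)
  then have "real (card Q) \<le> real ((M * (2 * \<Lambda> + 7) ^ (CARD('n) - 1)) * (N + 1))"
    by (simp only: of_nat_le_iff card_atMost) simp
  also have "\<dots> = real M * (2 * real \<Lambda> + 7) ^ (CARD('n) - 1) * (real N + 1)" by (simp add: distrib_left)
  also have "\<dots> \<le> real M * (2 * real \<Lambda> + 7) ^ (CARD('n) - 1) * (3 / \<rho>)"
  proof (rule mult_left_mono)
    have "real N \<le> 2 / \<rho>" unfolding N_def using \<rho> by simp
    moreover have "1 \<le> 1 / \<rho>" using \<rho> by simp
    ultimately show "real N + 1 \<le> 3 / \<rho>" by (simp add: field_simps)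
  qed simp
  finally show ?thesis by (simp add: mult_ac)
qed

section \<open>Overlaps of planar strips\<close>

lemma integrable_lborel_bounded_support:
  fixes f :: "'a::euclidean_space \<Rightarrow> real"
  assumes "f \<in> borel_measurable borel" "\<And>x. \<bar>f x\<bar> \<le> B" "\<And>x. f x \<noteq> 0 \<Longrightarrow> norm x \<le> R"
  shows "integrable lborel f"
proof (rule integrableI_bounded_set[where A = "cball 0 R" and B = B])
  show "emeasure lborel (cball (0::'a) R) < \<infinity>" by (rule emeasure_lborel_cball_finite)
qed (use assms in \<open>auto intro!: AE_I2\<close>)

text \<open>Equal to 1 on \<open>[-2, 2]\<close>, which contains the slopes of all cells used later,
  and 0 outside \<open>[-3, 3]\<close>. It is Lipschitz because with a sharp cutoff the error bound
  in \<open>overlap_approx\<close> would fail for joining slopes near the edge.\<close>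

definition cutoff :: "real \<Rightarrow> real" where
  "cutoff b = max 0 (min 1 (3 - \<bar>b\<bar>))"

lemma cutoff_bounds: "0 \<le> cutoff b" "cutoff b \<le> 1" "\<bar>b\<bar> \<le> 2 \<Longrightarrow> cutoff b = 1" "cutoff b \<noteq> 0 \<Longrightarrow> \<bar>b\<bar> \<le> 3"
  by (auto simp: cutoff_def)

lemma cutoff_lipschitz: "\<bar>cutoff b - cutoff b'\<bar> \<le> \<bar>b - b'\<bar>"
  by (auto simp: cutoff_def max_def min_def abs_if)

lemma cutoff_measurable [measurable]: "cutoff \<in> borel_measurable borel"
  unfolding cutoff_def[abs_def] by measurable

text \<open>In two dimensions \<open>(a, b)\<close> is the line \<open>y = a + s * b\<close> in the \<open>(s, y)\<close> plane, and \<open>strip \<alpha> s y\<close> is the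
  indicator of the lines that pass within vertical distance \<open>\<alpha>\<close> of \<open>(s, y)\<close>.\<close>

definition strip :: "real \<Rightarrow> real \<Rightarrow> real \<Rightarrow> real \<times> real \<Rightarrow> real" where
  "strip \<alpha> s y c = (if \<bar>fst c + s * snd c - y\<bar> \<le> \<alpha> then 1 else 0)"

lemma strip_measurable [measurable]: "strip \<alpha> s y \<in> borel_measurable borel"
proof -
  have "strip \<alpha> s y = indicator {c. \<bar>fst c + s * snd c - y\<bar> \<le> \<alpha>}"
    by (auto simp: strip_def indicator_def)
  moreover have "closed {c :: real \<times> real. \<bar>fst c + s * snd c - y\<bar> \<le> \<alpha>}"
    by (intro closed_Collect_le continuous_intros)
  ultimately show ?thesis by (auto intro!: borel_measurable_indicator)
qed

definition strips :: "real \<Rightarrow> real \<Rightarrow> real \<Rightarrow> real \<Rightarrow> real \<Rightarrow> real \<Rightarrow> real \<times> real \<Rightarrow> real" where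
  "strips \<alpha> s y \<beta> s' y' c = strip \<alpha> s y c * strip \<beta> s' y' c * cutoff (snd c)"

lemma snd_measurable_borel [measurable]: "(snd :: real \<times> real \<Rightarrow> real) \<in> borel_measurable borel"
  by (intro borel_measurable_continuous_onI continuous_intros)

lemma strips_measurable [measurable]: "strips \<alpha> s y \<beta> s' y' \<in> borel_measurable borel"
  unfolding strips_def[abs_def] by measurable

lemma strips_nonneg: "0 \<le> strips \<alpha> s y \<beta> s' y' c"
  by (simp add: strips_def strip_def cutoff_bounds)

lemma strips_commute: "strips \<alpha> s y \<beta> s' y' = strips \<beta> s' y' \<alpha> s y"
  by (auto simp: strips_def)

lemma integrable_strips: "integrable lborel (strips \<alpha> s y \<beta> s' y')"
proof (rule integrable_lborel_bounded_support[where B = 1 and R = "\<alpha> + \<bar>y\<bar> + \<bar>s\<bar> * 3 + 3"])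
  fix c
  show "\<bar>strips \<alpha> s y \<beta> s' y' c\<bar> \<le> 1"
    by (simp add: strips_def strip_def cutoff_bounds)
  assume "strips \<alpha> s y \<beta> s' y' c \<noteq> 0"
  then have 1: "\<bar>fst c + s * snd c - y\<bar> \<le> \<alpha>" and 2: "\<bar>snd c\<bar> \<le> 3"
    by (auto simp: strips_def strip_def cutoff_bounds split: if_splits)
  have "\<bar>s * snd c\<bar> \<le> \<bar>s\<bar> * 3" unfolding abs_mult by (rule mult_left_mono) (use 2 in auto)
  then have "\<bar>fst c\<bar> \<le> \<alpha> + \<bar>y\<bar> + \<bar>s\<bar> * 3" using 1 by linarith
  then show "norm c \<le> \<alpha> + \<bar>y\<bar> + \<bar>s\<bar> * 3 + 3"
    using norm_Pair_le[of "fst c" "snd c"] 2 by simp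
qed measurable

definition overlap :: "real \<Rightarrow> real \<Rightarrow> real \<Rightarrow> real \<Rightarrow> real \<Rightarrow> real \<Rightarrow> real" where
  "overlap \<alpha> s y \<beta> s' y' = (\<integral>c. strips \<alpha> s y \<beta> s' y' c \<partial>lborel)"

lemma overlap_nonneg: "0 \<le> overlap \<alpha> s y \<beta> s' y'"
  unfolding overlap_def by (rule integral_nonneg_AE) (simp add: strips_nonneg)

lemma integral_abs_le:
  assumes "0 \<le> \<alpha>"
  shows "(\<integral>a. (if \<bar>a - x\<bar> \<le> \<alpha> then 1 else 0 :: real) \<partial>lborel) = 2 * \<alpha>"
proof -
  have "(\<lambda>a. if \<bar>a - x\<bar> \<le> \<alpha> then 1 else 0 :: real) = indicator {x - \<alpha>..x + \<alpha>}"
    by (auto simp: indicator_def fun_eq_iff)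
  then show ?thesis using assms by simp
qed

lemma overlap_fubini:
  "overlap \<alpha> s y \<beta> s' y' = (\<integral>b. \<integral>a. strips \<alpha> s y \<beta> s' y' (a, b) \<partial>lborel \<partial>lborel)"
proof -
  have "integrable (lborel \<Otimes>\<^sub>M lborel) (\<lambda>(a, b). strips \<alpha> s y \<beta> s' y' (a, b))"
    using integrable_strips[of \<alpha> s y \<beta> s' y'] by (simp add: lborel_prod)
  from lborel_pair.integral_snd[OF this] show ?thesis
    by (simp add: overlap_def lborel_prod)
qed

text \<open>The second strip is dropped and the cutoff replaced by the indicator of
  \<open>[-3, 3]\<close>: each slope leaves an interval of intercepts of length
  \<open>2 * \<alpha>\<close>. This serves for the diagonal and for close pairs, where
  \<open>overlap_approx\<close> is useless.\<close>

lemma overlap_le: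
  assumes "0 \<le> \<alpha>"
  shows "overlap \<alpha> s y \<beta> s' y' \<le> 12 * \<alpha>"
proof -
  define f where "f = (\<lambda>c. strip \<alpha> s y c * (if \<bar>snd c\<bar> \<le> 3 then 1 else 0 :: real))"
  have [measurable]: "f \<in> borel_measurable borel"
    unfolding f_def by measurable
  have int: "integrable lborel f"
  proof (rule integrable_lborel_bounded_support[where B = 1 and R = "\<alpha> + \<bar>y\<bar> + \<bar>s\<bar> * 3 + 3"])
    fix c
    show "\<bar>f c\<bar> \<le> 1" by (simp add: f_def strip_def)
    assume "f c \<noteq> 0"
    then have 1: "\<bar>fst c + s * snd c - y\<bar> \<le> \<alpha>" and 2: "\<bar>snd c\<bar> \<le> 3"
      by (auto simp: f_def strip_def split: if_splits)
    have "\<bar>s * snd c\<bar> \<le> \<bar>s\<bar> * 3" unfolding abs_mult by (rule mult_left_mono) (use 2 in auto)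
    then have "\<bar>fst c\<bar> \<le> \<alpha> + \<bar>y\<bar> + \<bar>s\<bar> * 3" using 1 by linarith
    then show "norm c \<le> \<alpha> + \<bar>y\<bar> + \<bar>s\<bar> * 3 + 3"
      using norm_Pair_le[of "fst c" "snd c"] 2 by simp
  qed measurable
  have "overlap \<alpha> s y \<beta> s' y' \<le> (\<integral>c. f c \<partial>lborel)"
    unfolding overlap_def
    by (rule integral_mono[OF integrable_strips int])
       (use cutoff_bounds(2,4) in \<open>force simp: strips_def f_def strip_def\<close>)
  also have "\<dots> = (\<integral>b. \<integral>a. f (a, b) \<partial>lborel \<partial>lborel)"
  proof -
    have "integrable (lborel \<Otimes>\<^sub>M lborel) (\<lambda>(a, b). f (a, b))"
      using int by (simp add: lborel_prod)
    from lborel_pair.integral_snd[OF this] show ?thesis by (simp add: lborel_prod)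
  qed
  also have "\<dots> = (\<integral>b. 2 * \<alpha> * indicator {- 3..3 :: real} b \<partial>lborel)"
  proof (rule Bochner_Integration.integral_cong)
    fix b :: real
    have "(\<integral>a. f (a, b) \<partial>lborel)
      = (\<integral>a. (if \<bar>a - (y - s * b)\<bar> \<le> \<alpha> then 1 else 0) * indicator {- 3..3 :: real} b \<partial>lborel)"
      by (rule Bochner_Integration.integral_cong)
         (auto simp: f_def strip_def indicator_def algebra_simps)
    also have "\<dots> = 2 * \<alpha> * indicator {- 3..3 :: real} b"
      using integral_abs_le[OF assms, of "y - s * b"] by simp
    finally show "(\<integral>a. f (a, b) \<partial>lborel) = 2 * \<alpha> * indicator {- 3..3 :: real} b" .
  qed simp
  also have "\<dots> = 12 * \<alpha>" by simp
  finally show ?thesis .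
qed

lemma overlap_commute: "overlap \<alpha> s y \<beta> s' y' = overlap \<beta> s' y' \<alpha> s y"
  unfolding overlap_def by (subst strips_commute) simp

lemma overlap_eq_0:
  assumes "\<bar>y - y'\<bar> > 3 * \<bar>s - s'\<bar> + \<alpha> + \<beta>"
  shows "overlap \<alpha> s y \<beta> s' y' = 0"
proof -
  have "strips \<alpha> s y \<beta> s' y' c = 0" for c
  proof (rule ccontr)
    assume "strips \<alpha> s y \<beta> s' y' c \<noteq> 0"
    then have 1: "\<bar>fst c + s * snd c - y\<bar> \<le> \<alpha>" "\<bar>fst c + s' * snd c - y'\<bar> \<le> \<beta>" and 2: "\<bar>snd c\<bar> \<le> 3"
      by (auto simp: strips_def strip_def cutoff_bounds split: if_splits)
    have "\<bar>(s - s') * snd c\<bar> \<le> \<bar>s - s'\<bar> * 3"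
      unfolding abs_mult by (rule mult_left_mono) (use 2 in auto)
    then have "\<bar>s * snd c - s' * snd c\<bar> \<le> \<bar>s - s'\<bar> * 3" by (simp add: algebra_simps)
    then show False using 1 assms by linarith
  qed
  then show ?thesis by (simp add: overlap_def)
qed

text \<open>The correlation of the indicators of \<open>[-\<alpha>, \<alpha>]\<close> and
  \<open>[-\<beta>, \<beta>]\<close> as a function of the shift. Its sign, its support and its total
  mass, the product of the two lengths, are all that is used.\<close>

definition corr :: "real \<Rightarrow> real \<Rightarrow> real \<Rightarrow> real" where
  "corr \<alpha> \<beta> t = (\<integral>a. (if \<bar>a\<bar> \<le> \<alpha> then 1 else 0) * (if \<bar>a - t\<bar> \<le> \<beta> then 1 else 0) \<partial>lborel)"

lemma corr_nonneg: "0 \<le> corr \<alpha> \<beta> t"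
  unfolding corr_def by (rule integral_nonneg_AE) simp

lemma corr_support: "\<bar>t\<bar> > \<alpha> + \<beta> \<Longrightarrow> corr \<alpha> \<beta> t = 0"
proof -
  assume *: "\<bar>t\<bar> > \<alpha> + \<beta>"
  have "(\<lambda>a. (if \<bar>a\<bar> \<le> \<alpha> then 1 else 0) * (if \<bar>a - t\<bar> \<le> \<beta> then 1 else 0)) = (\<lambda>a. 0 :: real)"
    using * by (intro ext) (auto split: if_splits)
  then show ?thesis by (simp add: corr_def)
qed

lemma corr_integral:
  assumes "0 \<le> \<alpha>" "0 \<le> \<beta>"
  shows "integrable lborel (corr \<alpha> \<beta>)" "(\<integral>t. corr \<alpha> \<beta> t \<partial>lborel) = 4 * \<alpha> * \<beta>"
proof -
  define f where "f = (\<lambda>(a :: real, t). (if \<bar>a\<bar> \<le> \<alpha> then 1 else 0) * (if \<bar>a - t\<bar> \<le> \<beta> then 1 else 0) :: real)"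
  have f: "f = indicator {c. \<bar>fst c\<bar> \<le> \<alpha> \<and> \<bar>fst c - snd c\<bar> \<le> \<beta>}"
    by (auto simp: f_def indicator_def fun_eq_iff)
  have "closed {c :: real \<times> real. \<bar>fst c\<bar> \<le> \<alpha> \<and> \<bar>fst c - snd c\<bar> \<le> \<beta>}"
    by (intro closed_Collect_conj closed_Collect_le continuous_intros)
  then have [measurable]: "f \<in> borel_measurable borel"
    unfolding f by (auto intro!: borel_measurable_indicator)
  have "integrable lborel f"
  proof (rule integrable_lborel_bounded_support[where B = 1 and R = "2 * \<alpha> + \<beta>"])
    fix c
    show "\<bar>f c\<bar> \<le> 1" by (simp add: f_def split: prod.splits)
    assume "f c \<noteq> 0"
    then show "norm c \<le> 2 * \<alpha> + \<beta>"
      using norm_Pair_le[of "fst c" "snd c"] by (auto simp: f indicator_def split: if_splits)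
  qed measurable
  then have int: "integrable (lborel \<Otimes>\<^sub>M lborel) (case_prod (\<lambda>a t. f (a, t)))"
    by (simp add: lborel_prod)
  from lborel_pair.integrable_snd[OF this] show "integrable lborel (corr \<alpha> \<beta>)"
    by (simp add: f_def corr_def[abs_def])
  have "(\<integral>t. corr \<alpha> \<beta> t \<partial>lborel) = (\<integral>t. \<integral>a. f (a, t) \<partial>lborel \<partial>lborel)"
    by (simp add: corr_def f_def)
  also have "\<dots> = (\<integral>a. \<integral>t. f (a, t) \<partial>lborel \<partial>lborel)"
    by (rule lborel_pair.Fubini_integral[OF int])
  also have "\<dots> = (\<integral>a. (if \<bar>a - 0\<bar> \<le> \<alpha> then 1 else 0) * (2 * \<beta>) \<partial>lborel)"
  proof (rule Bochner_Integration.integral_cong)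
    fix a :: real
    have "(\<integral>t. f (a, t) \<partial>lborel) = (\<integral>t. (if \<bar>a\<bar> \<le> \<alpha> then 1 else 0) * (if \<bar>t - a\<bar> \<le> \<beta> then 1 else 0) \<partial>lborel)"
      by (rule Bochner_Integration.integral_cong) (auto simp: f_def abs_minus_commute)
    then show "(\<integral>t. f (a, t) \<partial>lborel) = (if \<bar>a - 0\<bar> \<le> \<alpha> then 1 else 0) * (2 * \<beta>)"
      by (simp add: integral_abs_le assms del: mult_eq_if)
  qed simp
  also have "\<dots> = 4 * \<alpha> * \<beta>"
    using integral_abs_le[OF assms(1), of 0] by simp
  finally show "(\<integral>t. corr \<alpha> \<beta> t \<partial>lborel) = 4 * \<alpha> * \<beta>" .
qed

text \<open>For a fixed slope the admissible intercepts form the intersection of two shifted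
  intervals. The change of variable from the slope to the shift produces the factor
  \<open>1 / \<bar>s - s'\<bar>\<close>.\<close>

lemma overlap_corr:
  assumes "s \<noteq> s'"
  shows "overlap \<alpha> s y \<beta> s' y'
    = (\<integral>t. cutoff ((y - y') / (s - s') + t / (s - s')) * corr \<alpha> \<beta> t \<partial>lborel) / \<bar>s - s'\<bar>"
proof -
  have "(\<integral>a. strips \<alpha> s y \<beta> s' y' (a, b) \<partial>lborel) = cutoff b * corr \<alpha> \<beta> ((s - s') * b - (y - y'))" for b
  proof -
    have "(\<integral>a. strips \<alpha> s y \<beta> s' y' (a, b) \<partial>lborel)
        = \<bar>1\<bar> *\<^sub>R (\<integral>a. strips \<alpha> s y \<beta> s' y' ((y - s * b) + 1 * a, b) \<partial>lborel)"
      by (rule lborel_integral_real_affine) simp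
    also have "\<dots> = (\<integral>a. cutoff b * ((if \<bar>a\<bar> \<le> \<alpha> then 1 else 0) * (if \<bar>a - ((s - s') * b - (y - y'))\<bar> \<le> \<beta> then 1 else 0)) \<partial>lborel)"
      unfolding abs_one scaleR_one mult_1
      by (rule Bochner_Integration.integral_cong) (auto simp: strips_def strip_def algebra_simps)
    finally show ?thesis by (simp add: corr_def)
  qed
  then have "overlap \<alpha> s y \<beta> s' y' = (\<integral>b. cutoff b * corr \<alpha> \<beta> ((s - s') * b - (y - y')) \<partial>lborel)"
    by (simp add: overlap_fubini)
  also have "\<dots> = \<bar>1 / (s - s')\<bar> *\<^sub>R (\<integral>t. cutoff ((y - y') / (s - s') + (1 / (s - s')) * t)
      * corr \<alpha> \<beta> ((s - s') * ((y - y') / (s - s') + (1 / (s - s')) * t) - (y - y')) \<partial>lborel)"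
    by (rule lborel_integral_real_affine) (use assms in simp)
  also have "\<dots> = (\<integral>t. cutoff ((y - y') / (s - s') + t / (s - s')) * corr \<alpha> \<beta> t \<partial>lborel) / \<bar>s - s'\<bar>"
  proof -
    have "(s - s') * ((y - y') / (s - s') + (1 / (s - s')) * t) - (y - y') = t" for t
      using assms by (simp add: distrib_left)
    then show ?thesis by (simp only: real_scaleR_def abs_divide abs_one times_divide_eq_left mult_1)
  qed
  finally show ?thesis .
qed

text \<open>\<open>corr\<close> lives on shifts up to \<open>\<alpha> + \<beta>\<close>, where the
  argument of \<open>cutoff\<close> differs from the slope of the joining line by at most
  \<open>(\<alpha> + \<beta>) / \<bar>s - s'\<bar>\<close>. The main term depends on the widths only
  through the factor \<open>\<alpha> * \<beta>\<close>; this lets different widths cancel each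
  other.\<close>

lemma overlap_approx:
  assumes "s \<noteq> s'" and pos: "0 \<le> \<alpha>" "0 \<le> \<beta>"
  shows "\<bar>overlap \<alpha> s y \<beta> s' y' - 4 * \<alpha> * \<beta> * (cutoff ((y - y') / (s - s')) / \<bar>s - s'\<bar>)\<bar>
     \<le> 4 * \<alpha> * \<beta> * ((\<alpha> + \<beta>) / \<bar>s - s'\<bar>\<^sup>2)"
proof -
  define v where "v = cutoff ((y - y') / (s - s'))"
  define u where "u = (\<lambda>t. cutoff ((y - y') / (s - s') + t / (s - s')))"
  have [measurable]: "u \<in> borel_measurable borel" "corr \<alpha> \<beta> \<in> borel_measurable borel"
    using borel_measurable_integrable[OF corr_integral(1)[OF pos]] by (simp_all add: u_def)
  have int_u: "integrable lborel (\<lambda>t. u t * corr \<alpha> \<beta> t)"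
    by (rule Bochner_Integration.integrable_bound[OF corr_integral(1)[OF pos]])
       (auto intro!: AE_I2 mult_left_le_one_le simp: abs_mult u_def cutoff_bounds)
  have diff: "\<bar>u t - v\<bar> * corr \<alpha> \<beta> t \<le> (\<alpha> + \<beta>) / \<bar>s - s'\<bar> * corr \<alpha> \<beta> t" for t
  proof (cases "\<bar>t\<bar> > \<alpha> + \<beta>")
    case True then show ?thesis by (simp add: corr_support)
  next
    case False
    have "\<bar>u t - v\<bar> \<le> \<bar>t / (s - s')\<bar>"
      using cutoff_lipschitz[of "(y - y') / (s - s') + t / (s - s')" "(y - y') / (s - s')"]
      by (simp add: u_def v_def)
    also have "\<dots> \<le> (\<alpha> + \<beta>) / \<bar>s - s'\<bar>" using False by (simp add: abs_divide divide_right_mono)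
    finally show ?thesis by (rule mult_right_mono[OF _ corr_nonneg])
  qed
  have "\<bar>(\<integral>t. u t * corr \<alpha> \<beta> t \<partial>lborel) - v * (4 * \<alpha> * \<beta>)\<bar> = \<bar>\<integral>t. (u t - v) * corr \<alpha> \<beta> t \<partial>lborel\<bar>"
    using int_u corr_integral[OF pos] by (simp add: left_diff_distrib)
  also have "\<dots> \<le> (\<integral>t. \<bar>(u t - v) * corr \<alpha> \<beta> t\<bar> \<partial>lborel)" by (rule integral_abs_bound)
  also have "\<dots> \<le> (\<integral>t. (\<alpha> + \<beta>) / \<bar>s - s'\<bar> * corr \<alpha> \<beta> t \<partial>lborel)"
  proof (rule integral_mono)
    show "integrable lborel (\<lambda>t. \<bar>(u t - v) * corr \<alpha> \<beta> t\<bar>)"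
      using int_u corr_integral(1)[OF pos] by (simp add: left_diff_distrib)
    show "integrable lborel (\<lambda>t. (\<alpha> + \<beta>) / \<bar>s - s'\<bar> * corr \<alpha> \<beta> t)"
      using corr_integral(1)[OF pos] by simp
    show "\<bar>(u t - v) * corr \<alpha> \<beta> t\<bar> \<le> (\<alpha> + \<beta>) / \<bar>s - s'\<bar> * corr \<alpha> \<beta> t" for t
      using diff[of t] corr_nonneg[of \<alpha> \<beta> t] by (simp add: abs_mult)
  qed
  also have "\<dots> = (\<alpha> + \<beta>) / \<bar>s - s'\<bar> * (4 * \<alpha> * \<beta>)" using corr_integral(2)[OF pos] by simp
  finally have *: "\<bar>(\<integral>t. u t * corr \<alpha> \<beta> t \<partial>lborel) - v * (4 * \<alpha> * \<beta>)\<bar> \<le> (\<alpha> + \<beta>) / \<bar>s - s'\<bar> * (4 * \<alpha> * \<beta>)" .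
  have "overlap \<alpha> s y \<beta> s' y' - 4 * \<alpha> * \<beta> * (v / \<bar>s - s'\<bar>)
      = ((\<integral>t. u t * corr \<alpha> \<beta> t \<partial>lborel) - v * (4 * \<alpha> * \<beta>)) / \<bar>s - s'\<bar>"
    unfolding overlap_corr[OF assms(1)] u_def by (simp add: diff_divide_distrib mult_ac)
  then have "\<bar>overlap \<alpha> s y \<beta> s' y' - 4 * \<alpha> * \<beta> * (v / \<bar>s - s'\<bar>)\<bar>
      = \<bar>(\<integral>t. u t * corr \<alpha> \<beta> t \<partial>lborel) - v * (4 * \<alpha> * \<beta>)\<bar> / \<bar>s - s'\<bar>"
    by (simp add: abs_divide)
  also have "\<dots> \<le> ((\<alpha> + \<beta>) / \<bar>s - s'\<bar> * (4 * \<alpha> * \<beta>)) / \<bar>s - s'\<bar>"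
    by (rule divide_right_mono[OF *]) simp
  also have "\<dots> = 4 * \<alpha> * \<beta> * ((\<alpha> + \<beta>) / \<bar>s - s'\<bar>\<^sup>2)" by (simp add: power2_eq_square)
  finally show ?thesis unfolding v_def .
qed

section \<open>Second moment over the space of lines\<close>

text \<open>A point \<open>c\<close> of \<open>line_space i\<close> stands for the line \<open>x\<^sub>j = fst (c j) + x\<^sub>i * snd (c j)\<close>, \<open>j \<noteq> i\<close>.
  All integrands are products over \<open>j\<close>, so every integral factorizes into planar ones.\<close>

definition line_space :: "'n::finite \<Rightarrow> ('n \<Rightarrow> real \<times> real) measure" where
  "line_space i = PiM (UNIV - {i}) (\<lambda>_. lborel)"

definition near :: "'n::finite \<Rightarrow> real \<Rightarrow> real ^ 'n \<Rightarrow> ('n \<Rightarrow> real \<times> real) \<Rightarrow> real" where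
  "near i \<alpha> x c = (\<Prod>j\<in>UNIV - {i}. strip \<alpha> (x $ i) (x $ j) (c j))"

definition weight :: "'n::finite \<Rightarrow> ('n \<Rightarrow> real \<times> real) \<Rightarrow> real" where
  "weight i c = (\<Prod>j\<in>UNIV - {i}. cutoff (snd (c j)))"

definition overlaps :: "'n::finite \<Rightarrow> real \<Rightarrow> real \<Rightarrow> real ^ 'n \<Rightarrow> real ^ 'n \<Rightarrow> real" where
  "overlaps i \<alpha> \<beta> x x' = (\<Prod>j\<in>UNIV - {i}. overlap \<alpha> (x $ i) (x $ j) \<beta> (x' $ i) (x' $ j))"

lemma integral_near_near:
  fixes i :: "'n::finite"
  shows "integrable (line_space i) (\<lambda>c. near i \<alpha> x c * near i \<beta> x' c * weight i c)"
    and "(\<integral>c. near i \<alpha> x c * near i \<beta> x' c * weight i c \<partial>line_space i) = overlaps i \<alpha> \<beta> x x'"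
proof -
  interpret L: product_sigma_finite "\<lambda>_ :: 'n. lborel :: (real \<times> real) measure" by standard
  have eq: "near i \<alpha> x c * near i \<beta> x' c * weight i c
      = (\<Prod>j\<in>UNIV - {i}. strips \<alpha> (x $ i) (x $ j) \<beta> (x' $ i) (x' $ j) (c j))" for c
    by (simp add: near_def weight_def strips_def prod.distrib)
  show "integrable (line_space i) (\<lambda>c. near i \<alpha> x c * near i \<beta> x' c * weight i c)"
    unfolding eq line_space_def by (rule L.product_integrable_prod) (auto intro: integrable_strips)
  show "(\<integral>c. near i \<alpha> x c * near i \<beta> x' c * weight i c \<partial>line_space i) = overlaps i \<alpha> \<beta> x x'"
    unfolding eq line_space_def overlaps_def overlap_def
    by (rule L.product_integral_prod) (auto intro: integrable_strips)
qed

text \<open>The thick term is normalized so that both terms have the same integral over the lines of any fixed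
  slopes. This is what makes the four main terms of \<open>gram\<close> cancel when \<open>x\<close> and \<open>x'\<close> are far apart.\<close>

definition balanced :: "'n::finite \<Rightarrow> real \<Rightarrow> real \<Rightarrow> real ^ 'n \<Rightarrow> ('n \<Rightarrow> real \<times> real) \<Rightarrow> real" where
  "balanced i \<alpha> \<rho> x c = near i \<alpha> x c - (\<alpha> / \<rho>) ^ (CARD('n) - 1) * near i \<rho> x c"

text \<open>Gram matrix of the functions \<open>balanced i \<alpha> \<rho> x\<close> in the weighted
  L2 space of lines; the second moment is the sum of its entries.\<close>

definition gram :: "'n::finite \<Rightarrow> real \<Rightarrow> real \<Rightarrow> real ^ 'n \<Rightarrow> real ^ 'n \<Rightarrow> real" where
  "gram i \<alpha> \<rho> x x' = (let q = (\<alpha> / \<rho>) ^ (CARD('n) - 1) in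
     overlaps i \<alpha> \<alpha> x x' - q * overlaps i \<alpha> \<rho> x x' - q * overlaps i \<rho> \<alpha> x x' + q * q * overlaps i \<rho> \<rho> x x')"

lemma integral_balanced:
  fixes i :: "'n::finite"
  shows "integrable (line_space i) (\<lambda>c. balanced i \<alpha> \<rho> x c * balanced i \<alpha> \<rho> x' c * weight i c)"
    and "(\<integral>c. balanced i \<alpha> \<rho> x c * balanced i \<alpha> \<rho> x' c * weight i c \<partial>line_space i) = gram i \<alpha> \<rho> x x'"
proof -
  define q where "q = (\<alpha> / \<rho>) ^ (CARD('n) - 1)"
  define g where "g = (\<lambda>\<alpha> \<beta> c. near i \<alpha> x c * near i \<beta> x' c * weight i c)"
  have eq: "(\<lambda>c. balanced i \<alpha> \<rho> x c * balanced i \<alpha> \<rho> x' c * weight i c)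
      = (\<lambda>c. g \<alpha> \<alpha> c - q * g \<alpha> \<rho> c - q * g \<rho> \<alpha> c + q * q * g \<rho> \<rho> c)"
    unfolding balanced_def g_def q_def[symmetric] by (rule ext) (simp add: algebra_simps)
  have int: "integrable (line_space i) (g \<beta> \<gamma>)" for \<beta> \<gamma>
    unfolding g_def by (rule integral_near_near(1))
  show "integrable (line_space i) (\<lambda>c. balanced i \<alpha> \<rho> x c * balanced i \<alpha> \<rho> x' c * weight i c)"
    unfolding eq by (intro Bochner_Integration.integrable_add Bochner_Integration.integrable_diff
        integrable_mult_right int)
  have "(\<integral>c. g \<alpha> \<alpha> c - q * g \<alpha> \<rho> c - q * g \<rho> \<alpha> c + q * q * g \<rho> \<rho> c \<partial>line_space i)
      = (\<integral>c. g \<alpha> \<alpha> c \<partial>line_space i) - q * (\<integral>c. g \<alpha> \<rho> c \<partial>line_space i)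
        - q * (\<integral>c. g \<rho> \<alpha> c \<partial>line_space i) + q * q * (\<integral>c. g \<rho> \<rho> c \<partial>line_space i)"
    using int by (simp del: mult.assoc)
  then show "(\<integral>c. balanced i \<alpha> \<rho> x c * balanced i \<alpha> \<rho> x' c * weight i c \<partial>line_space i) = gram i \<alpha> \<rho> x x'"
    unfolding eq by (simp add: g_def integral_near_near(2) gram_def q_def Let_def)
qed

lemma integral_balanced_square:
  fixes i :: "'n::finite"
  assumes "finite P"
  shows "integrable (line_space i) (\<lambda>c. (\<Sum>x\<in>P. balanced i \<alpha> \<rho> x c)\<^sup>2 * weight i c)"
    and "(\<integral>c. (\<Sum>x\<in>P. balanced i \<alpha> \<rho> x c)\<^sup>2 * weight i c \<partial>line_space i)
       = (\<Sum>x\<in>P. \<Sum>x'\<in>P. gram i \<alpha> \<rho> x x')"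
proof -
  have eq: "(\<Sum>x\<in>P. balanced i \<alpha> \<rho> x c)\<^sup>2 * weight i c
     = (\<Sum>x\<in>P. \<Sum>x'\<in>P. balanced i \<alpha> \<rho> x c * balanced i \<alpha> \<rho> x' c * weight i c)" for c
    by (simp only: power2_eq_square sum_product) (simp only: sum_distrib_right)
  show "integrable (line_space i) (\<lambda>c. (\<Sum>x\<in>P. balanced i \<alpha> \<rho> x c)\<^sup>2 * weight i c)"
    unfolding eq by (intro Bochner_Integration.integrable_sum integral_balanced(1))
  show "(\<integral>c. (\<Sum>x\<in>P. balanced i \<alpha> \<rho> x c)\<^sup>2 * weight i c \<partial>line_space i)
       = (\<Sum>x\<in>P. \<Sum>x'\<in>P. gram i \<alpha> \<rho> x x')"
    unfolding eq
    by (simp add: Bochner_Integration.integral_sum integral_balanced Bochner_Integration.integrable_sum)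
qed

section \<open>Bounds for the entries of the Gram matrix\<close>

lemma overlaps_nonneg: "0 \<le> overlaps i \<alpha> \<beta> x x'"
  unfolding overlaps_def by (intro prod_nonneg) (simp add: overlap_nonneg)

lemma overlaps_le:
  fixes i :: "'n::finite"
  assumes "0 \<le> \<alpha>" "0 \<le> \<beta>"
  shows "overlaps i \<alpha> \<beta> x x' \<le> (12 * \<alpha>) ^ (CARD('n) - 1)" "overlaps i \<alpha> \<beta> x x' \<le> (12 * \<beta>) ^ (CARD('n) - 1)"
proof -
  have "overlaps i \<alpha> \<beta> x x' \<le> (\<Prod>j\<in>UNIV - {i}. 12 * \<alpha>)"
    unfolding overlaps_def by (rule prod_mono) (use assms overlap_nonneg overlap_le in auto)
  then show "overlaps i \<alpha> \<beta> x x' \<le> (12 * \<alpha>) ^ (CARD('n) - 1)" by (simp add: card_Diff_singleton)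
  have "overlaps i \<alpha> \<beta> x x' \<le> (\<Prod>j\<in>UNIV - {i}. 12 * \<beta>)"
    unfolding overlaps_def
    by (rule prod_mono) (use assms overlap_nonneg in \<open>auto simp: overlap_commute[of \<alpha>] intro!: overlap_le\<close>)
  then show "overlaps i \<alpha> \<beta> x x' \<le> (12 * \<beta>) ^ (CARD('n) - 1)" by (simp add: card_Diff_singleton)
qed

text \<open>No cancellation is used: each of the four terms is at most
  \<open>(12 * \<alpha>) ^ (d - 1)\<close>. In the mixed terms the narrower strip bounds the
  overlap; in the coarse one a single factor \<open>q\<close> turns \<open>12 * \<rho>\<close> into
  \<open>12 * \<alpha>\<close>, and the other factor is at most 1.\<close>

lemma gram_near:
  fixes i :: "'n::finite"
  assumes "0 < \<alpha>" "\<alpha> \<le> \<rho>"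
  shows "\<bar>gram i \<alpha> \<rho> x x'\<bar> \<le> 4 * (12 * \<alpha>) ^ (CARD('n) - 1)"
proof -
  define q where "q = (\<alpha> / \<rho>) ^ (CARD('n) - 1)"
  define B where "B = (12 * \<alpha>) ^ (CARD('n) - 1)"
  have q: "0 \<le> q" "q \<le> 1" using assms by (auto simp: q_def intro!: power_le_one)
  have B: "0 \<le> B" using assms by (simp add: B_def)
  have 1: "0 \<le> overlaps i \<alpha> \<alpha> x x'" "overlaps i \<alpha> \<alpha> x x' \<le> B"
    using overlaps_nonneg overlaps_le(1)[of \<alpha> \<alpha> i x x'] assms by (auto simp: B_def)
  have shrink: "0 \<le> q * u \<and> q * u \<le> B" if "0 \<le> u" "u \<le> B" for u
    using mult_left_le_one_le[of u q] q that by auto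
  have 2: "0 \<le> q * overlaps i \<alpha> \<rho> x x' \<and> q * overlaps i \<alpha> \<rho> x x' \<le> B"
    by (rule shrink[OF overlaps_nonneg]) (use overlaps_le(1)[of \<alpha> \<rho> i x x'] assms in \<open>simp add: B_def\<close>)
  have 3: "0 \<le> q * overlaps i \<rho> \<alpha> x x' \<and> q * overlaps i \<rho> \<alpha> x x' \<le> B"
    by (rule shrink[OF overlaps_nonneg]) (use overlaps_le(2)[of \<rho> \<alpha> i x x'] assms in \<open>simp add: B_def\<close>)
  have "q * overlaps i \<rho> \<rho> x x' \<le> q * (12 * \<rho>) ^ (CARD('n) - 1)"
    by (rule mult_left_mono) (use overlaps_le(1)[of \<rho> \<rho> i x x'] assms q in auto)
  also have "\<dots> = ((\<alpha> / \<rho>) * (12 * \<rho>)) ^ (CARD('n) - 1)"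
    by (simp only: q_def power_mult_distrib)
  also have "(\<alpha> / \<rho>) * (12 * \<rho>) = 12 * \<alpha>" using assms by simp
  finally have "q * overlaps i \<rho> \<rho> x x' \<le> B" unfolding B_def .
  from shrink[OF mult_nonneg_nonneg[OF q(1) overlaps_nonneg] this]
  have 4: "0 \<le> q * (q * overlaps i \<rho> \<rho> x x') \<and> q * (q * overlaps i \<rho> \<rho> x x') \<le> B" .
  show ?thesis
    using 1 2 3 4 B unfolding gram_def Let_def q_def[symmetric] B_def[symmetric] mult.assoc by linarith
qed

lemma gram_eq_0:
  assumes "0 < \<alpha>" "\<alpha> \<le> \<rho>" "j \<noteq> i" "\<bar>x $ j - x' $ j\<bar> > 3 * \<bar>x $ i - x' $ i\<bar> + 2 * \<rho>"
  shows "gram i \<alpha> \<rho> x x' = 0"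
proof -
  have "overlaps i \<beta> \<gamma> x x' = 0" if "\<beta> \<le> \<rho>" "\<gamma> \<le> \<rho>" for \<beta> \<gamma>
    unfolding overlaps_def using assms that by (intro prod_zero bexI[of _ j] overlap_eq_0) auto
  then show ?thesis using assms(2) by (simp add: gram_def)
qed

text \<open>The product over \<open>j\<close> on the left does not depend on \<open>\<alpha>\<close> and \<open>\<beta>\<close>; hence it cancels in \<open>gram\<close>.\<close>

lemma overlaps_approx:
  fixes i :: "'n::finite"
  assumes \<alpha>: "0 < \<alpha>" "\<alpha> \<le> \<rho>" and \<beta>: "0 < \<beta>" "\<beta> \<le> \<rho>" and t: "t = \<bar>x $ i - x' $ i\<bar>" "\<rho> \<le> t"
  shows "\<bar>overlaps i \<alpha> \<beta> x x' - (4 * \<alpha> * \<beta>) ^ (CARD('n) - 1)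
         * (\<Prod>j\<in>UNIV - {i}. cutoff ((x $ j - x' $ j) / (x $ i - x' $ i)) / t)\<bar>
       \<le> (4 * \<alpha> * \<beta>) ^ (CARD('n) - 1) * ((3 / t) ^ (CARD('n) - 1) * (real (CARD('n) - 1) * (\<rho> / t)))"
proof -
  define ov where "ov = (\<lambda>j. overlap \<alpha> (x $ i) (x $ j) \<beta> (x' $ i) (x' $ j))"
  define v where "v = (\<lambda>j. cutoff ((x $ j - x' $ j) / (x $ i - x' $ i)) / t)"
  have t0: "t > 0" using t \<alpha> by linarith
  have ab: "4 * \<alpha> * \<beta> > 0" using \<alpha> \<beta> by simp
  \<comment> \<open>A common majorant of the overlaps and of their main terms: the main term
    accounts for \<open>1 / t\<close> and the error for \<open>2 / t\<close>, as
    \<open>\<alpha> + \<beta> \<le> 2 * t\<close>. Divided by \<open>k\<close>, all factors have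
    norm at most 1 and \<open>norm_prod_diff\<close> compares the products.\<close>
  define k where "k = 4 * \<alpha> * \<beta> * (3 / t)"
  have k: "k > 0" using ab t0 by (simp add: k_def)
  have diff: "\<bar>ov j - 4 * \<alpha> * \<beta> * v j\<bar> \<le> k * (\<rho> / t)" for j
  proof -
    have "x $ i \<noteq> x' $ i" using t0 t by auto
    then have "\<bar>ov j - 4 * \<alpha> * \<beta> * v j\<bar> \<le> 4 * \<alpha> * \<beta> * ((\<alpha> + \<beta>) / t\<^sup>2)"
      using overlap_approx[of "x $ i" "x' $ i" \<alpha> \<beta> "x $ j" "x' $ j"] \<alpha> \<beta>
      unfolding ov_def v_def t(1) by simp
    also have "\<dots> \<le> 4 * \<alpha> * \<beta> * ((3 * \<rho>) / t\<^sup>2)"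
      using \<alpha> \<beta> by (intro mult_left_mono divide_right_mono) auto
    also have "\<dots> = k * (\<rho> / t)" by (simp add: k_def power2_eq_square)
    finally show ?thesis .
  qed
  have v1: "0 \<le> v j" "v j \<le> 1 / t" for j
    using t0 cutoff_bounds by (auto simp: v_def divide_right_mono)
  have z: "norm (ov j / k) \<le> 1" for j
  proof -
    have "\<bar>ov j - 4 * \<alpha> * \<beta> * v j\<bar> \<le> 4 * \<alpha> * \<beta> * ((\<alpha> + \<beta>) / t\<^sup>2)"
    proof -
      have "x $ i \<noteq> x' $ i" using t0 t by auto
      then show ?thesis
        using overlap_approx[of "x $ i" "x' $ i" \<alpha> \<beta> "x $ j" "x' $ j"] \<alpha> \<beta>
        unfolding ov_def v_def t(1) by simp
    qed
    also have "\<dots> \<le> 4 * \<alpha> * \<beta> * ((2 * t) / t\<^sup>2)"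
      using \<alpha> \<beta> t by (intro mult_left_mono divide_right_mono) auto
    also have "\<dots> = 4 * \<alpha> * \<beta> * (2 / t)" by (simp add: power2_eq_square)
    finally have "ov j \<le> 4 * \<alpha> * \<beta> * v j + 4 * \<alpha> * \<beta> * (2 / t)" by linarith
    also have "\<dots> \<le> 4 * \<alpha> * \<beta> * (1 / t) + 4 * \<alpha> * \<beta> * (2 / t)"
      using v1(2)[of j] ab by (intro add_right_mono mult_left_mono) auto
    also have "\<dots> = k" by (simp add: k_def field_simps)
    finally have "ov j \<le> k" .
    then show ?thesis using k overlap_nonneg by (simp add: ov_def)
  qed
  have w: "norm (4 * \<alpha> * \<beta> * v j / k) \<le> 1" for j
  proof -
    have "4 * \<alpha> * \<beta> * v j \<le> 4 * \<alpha> * \<beta> * (3 / t)"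
      using v1(2)[of j] ab t0 by (intro mult_left_mono) (auto simp: field_simps)
    then have "4 * \<alpha> * \<beta> * v j \<le> k" by (simp only: k_def)
    then show ?thesis using k v1(1)[of j] \<alpha> \<beta> by simp
  qed
  let ?I = "UNIV - {i}"
  have "norm ((\<Prod>j\<in>?I. ov j / k) - (\<Prod>j\<in>?I. 4 * \<alpha> * \<beta> * v j / k)) \<le> (\<Sum>j\<in>?I. norm (ov j / k - 4 * \<alpha> * \<beta> * v j / k))"
    by (rule norm_prod_diff) (use z w in auto)
  also have "\<dots> \<le> (\<Sum>j\<in>?I. \<rho> / t)"
  proof (rule sum_mono)
    fix j
    have "norm (ov j / k - 4 * \<alpha> * \<beta> * v j / k) = \<bar>ov j - 4 * \<alpha> * \<beta> * v j\<bar> / k"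
      using k by (simp add: abs_divide flip: diff_divide_distrib)
    also have "\<dots> \<le> k * (\<rho> / t) / k" using diff[of j] k by (intro divide_right_mono) auto
    finally show "norm (ov j / k - 4 * \<alpha> * \<beta> * v j / k) \<le> \<rho> / t" using k by simp
  qed
  also have "\<dots> = real (CARD('n) - 1) * (\<rho> / t)" by (simp add: card_Diff_singleton)
  finally have main: "\<bar>(\<Prod>j\<in>?I. ov j / k) - (\<Prod>j\<in>?I. 4 * \<alpha> * \<beta> * v j / k)\<bar> \<le> real (CARD('n) - 1) * (\<rho> / t)"
    by simp
  have e1: "(\<Prod>j\<in>?I. ov j / k) = overlaps i \<alpha> \<beta> x x' / k ^ (CARD('n) - 1)"
    by (simp add: prod_dividef ov_def overlaps_def card_Diff_singleton)
  have e2: "(\<Prod>j\<in>?I. 4 * \<alpha> * \<beta> * v j / k) = (4 * \<alpha> * \<beta>) ^ (CARD('n) - 1) * (\<Prod>j\<in>?I. v j) / k ^ (CARD('n) - 1)"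
    by (simp add: prod_dividef prod.distrib card_Diff_singleton power_mult_distrib)
  have "\<bar>overlaps i \<alpha> \<beta> x x' - (4 * \<alpha> * \<beta>) ^ (CARD('n) - 1) * (\<Prod>j\<in>?I. v j)\<bar>
      \<le> k ^ (CARD('n) - 1) * (real (CARD('n) - 1) * (\<rho> / t))"
    using main k unfolding e1 e2 by (simp add: abs_divide pos_divide_le_eq mult.commute flip: diff_divide_distrib)
  then show ?thesis unfolding v_def k_def power_mult_distrib by (simp add: mult.assoc)
qed

text \<open>The factors \<open>1\<close>, \<open>q\<close>, \<open>q\<close> and
  \<open>q * q\<close> change the prefactors of the four overlaps into the same \<open>p\<close>, so
  \<open>p * V\<close> enters with the signs \<open>+\<close>, \<open>-\<close>, \<open>-\<close>,
  \<open>+\<close>. Four error terms remain.\<close>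

lemma gram_far:
  fixes i :: "'n::finite"
  assumes \<alpha>: "0 < \<alpha>" "\<alpha> \<le> \<rho>" and t: "t = \<bar>x $ i - x' $ i\<bar>" "\<rho> \<le> t"
  shows "\<bar>gram i \<alpha> \<rho> x x'\<bar>
       \<le> 4 * ((4 * \<alpha> * \<alpha>) ^ (CARD('n) - 1) * ((3 / t) ^ (CARD('n) - 1) * (real (CARD('n) - 1) * (\<rho> / t))))"
proof -
  define q where "q = (\<alpha> / \<rho>) ^ (CARD('n) - 1)"
  define E where "E = (3 / t) ^ (CARD('n) - 1) * (real (CARD('n) - 1) * (\<rho> / t))"
  define V where "V = (\<Prod>j\<in>UNIV - {i}. cutoff ((x $ j - x' $ j) / (x $ i - x' $ i)) / t)"
  define p where "p = (4 * \<alpha> * \<alpha>) ^ (CARD('n) - 1)"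
  have q0: "0 \<le> q" using \<alpha> by (simp add: q_def)
  have r0: "0 < \<rho>" using \<alpha> by linarith
  have qp: "q * (4 * \<alpha> * \<rho>) ^ (CARD('n) - 1) = p" "q * (4 * \<rho> * \<alpha>) ^ (CARD('n) - 1) = p"
     "q * q * (4 * \<rho> * \<rho>) ^ (CARD('n) - 1) = p"
    using r0 by (simp_all add: q_def p_def field_simps flip: power_mult_distrib)
  have 1: "\<bar>overlaps i \<alpha> \<alpha> x x' - p * V\<bar> \<le> p * E"
    using overlaps_approx[OF \<alpha> \<alpha> t] by (simp add: p_def E_def V_def)
  have scale: "\<bar>y * u - p * V\<bar> \<le> p * E" if "0 \<le> y" "\<bar>u - r * V\<bar> \<le> r * E" "y * r = p" for y u r
  proof -
    have "y * u - p * V = y * (u - r * V)"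
      using that(3) by (auto simp: right_diff_distrib)
    then have "\<bar>y * u - p * V\<bar> = y * \<bar>u - r * V\<bar>"
      using that(1) by (simp add: abs_mult)
    also have "\<dots> \<le> y * (r * E)" by (rule mult_left_mono) (use that in auto)
    finally show ?thesis using that(3) by (simp flip: mult.assoc)
  qed
  have 2: "\<bar>q * overlaps i \<alpha> \<rho> x x' - p * V\<bar> \<le> p * E"
    by (rule scale[OF q0 _ qp(1)]) (use overlaps_approx[OF \<alpha> r0 order_refl t] in \<open>simp add: E_def V_def\<close>)
  have 3: "\<bar>q * overlaps i \<rho> \<alpha> x x' - p * V\<bar> \<le> p * E"
    by (rule scale[OF q0 _ qp(2)]) (use overlaps_approx[OF r0 order_refl \<alpha> t] in \<open>simp add: E_def V_def\<close>)
  have 4: "\<bar>q * q * overlaps i \<rho> \<rho> x x' - p * V\<bar> \<le> p * E"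
    by (rule scale[OF _ _ qp(3)]) (use q0 overlaps_approx[OF r0 order_refl r0 order_refl t] in \<open>simp_all add: E_def V_def\<close>)
  show ?thesis
    using 1 2 3 4 unfolding gram_def Let_def q_def[symmetric] p_def[symmetric] E_def[symmetric] by linarith
qed

text \<open>With \<open>\<mu> = max 1 \<bar>m\<bar>\<close>, \<open>gram_eq_0\<close> leaves
  \<open>O(\<mu> ^ (d - 1))\<close> points in the layer, and each entry is
  \<open>O(\<alpha> ^ (d - 1) / \<mu> ^ d)\<close>, so a factor \<open>1 / \<mu>\<close> survives.
  The constant 408 is \<open>17 * 24\<close>, from the number of points and from the size of an
  entry.\<close>

lemma gram_slab_sum:
  fixes i :: "'n::finite" and m :: int
  assumes sp: "spaced M \<rho> P" and d: "CARD('n) \<ge> 2" and \<alpha>: "0 < \<alpha>" "\<alpha> \<le> \<rho>"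
  shows "(\<Sum>x'\<in>{x'\<in>P. \<lfloor>(x' $ i - x $ i) / \<rho>\<rfloor> = m}. \<bar>gram i \<alpha> \<rho> x x'\<bar>)
     \<le> 8 * real (CARD('n) - 1) * 408 ^ (CARD('n) - 1) * M * \<alpha> ^ (CARD('n) - 1) / max 1 \<bar>real_of_int m\<bar>"
proof -
  define d1 where "d1 = CARD('n) - 1"
  have d1: "d1 \<ge> 1" using d by (simp add: d1_def)
  have \<rho>: "0 < \<rho>" using \<alpha> by linarith
  have fin: "finite P" using sp by (simp add: spaced_def)
  define Q where "Q = {x'\<in>P. \<lfloor>(x' $ i - x $ i) / \<rho>\<rfloor> = m \<and> gram i \<alpha> \<rho> x x' \<noteq> 0}"
  define \<mu> where "\<mu> = max 1 \<bar>m\<bar>"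
  have \<mu>1: "1 \<le> real_of_int \<mu>" by (simp add: \<mu>_def)
  have m: "real_of_int m * \<rho> \<le> x' $ i - x $ i" "x' $ i - x $ i < (real_of_int m + 1) * \<rho>" if "x' \<in> Q" for x'
  proof -
    have "real_of_int m \<le> (x' $ i - x $ i) / \<rho>" "(x' $ i - x $ i) / \<rho> < real_of_int m + 1"
      using that unfolding Q_def by (auto simp: floor_eq_iff)
    then show "real_of_int m * \<rho> \<le> x' $ i - x $ i" "x' $ i - x $ i < (real_of_int m + 1) * \<rho>"
      using \<rho> by (auto simp: field_simps)
  qed
  have t: "\<bar>x $ i - x' $ i\<bar> \<le> 2 * real_of_int \<mu> * \<rho>" if "x' \<in> Q" for x'
  proof -
    have "- real_of_int \<mu> \<le> real_of_int m" "real_of_int m + 1 \<le> 2 * real_of_int \<mu>"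
      unfolding \<mu>_def by linarith+
    then have "real_of_int m * \<rho> \<ge> - real_of_int \<mu> * \<rho>" "(real_of_int m + 1) * \<rho> \<le> 2 * real_of_int \<mu> * \<rho>"
      using \<rho> by (simp_all only: mult_right_mono less_imp_le)
    moreover have "real_of_int \<mu> * \<rho> \<ge> 0" using \<mu>1 \<rho> by simp
    ultimately show ?thesis using m[OF that] by linarith
  qed
  \<comment> \<open>A non-zero entry confines the other coordinates to within
    \<open>6 * \<mu> * \<rho> + 2 * \<rho> \<le> 8 * \<mu> * \<rho>\<close> of those of
    \<open>x\<close>; the width \<open>16 * \<mu>\<close> is rounded up to \<open>17 * \<mu>\<close>
    for the half-open box.\<close>
  have card: "card Q \<le> M * nat (17 * \<mu>) ^ d1"
  proof -
    have "card Q \<le> M * (\<Prod>j\<in>UNIV. if j = i then 1 else nat (17 * \<mu>))"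
    proof (rule card_box[OF sp \<rho>, where l = "\<lambda>j. if j = i then x $ i + real_of_int m * \<rho> else x $ j - 8 * real_of_int \<mu> * \<rho>"])
      fix x' j assume x': "x' \<in> Q"
      show "(if j = i then x $ i + real_of_int m * \<rho> else x $ j - 8 * real_of_int \<mu> * \<rho>) \<le> x' $ j \<and>
        x' $ j < (if j = i then x $ i + real_of_int m * \<rho> else x $ j - 8 * real_of_int \<mu> * \<rho>)
           + real (if j = i then 1 else nat (17 * \<mu>)) * \<rho>"
      proof (cases "j = i")
        case True then show ?thesis using m[OF x'] by (auto simp: algebra_simps)
      next
        case False
        have "\<not> \<bar>x $ j - x' $ j\<bar> > 3 * \<bar>x $ i - x' $ i\<bar> + 2 * \<rho>"
          using gram_eq_0[OF \<alpha> False, of x x'] x' by (auto simp: Q_def)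
        then have "\<bar>x $ j - x' $ j\<bar> \<le> 3 * \<bar>x $ i - x' $ i\<bar> + 2 * \<rho>" by simp
        also have "\<dots> \<le> 3 * (2 * real_of_int \<mu> * \<rho>) + 2 * \<rho>"
          using t[OF x'] by (simp add: mult_ac)
        finally have "\<bar>x $ j - x' $ j\<bar> \<le> 6 * (real_of_int \<mu> * \<rho>) + 2 * \<rho>" by simp
        moreover have "\<rho> \<le> real_of_int \<mu> * \<rho>" using \<mu>1 \<rho> by simp
        ultimately have "\<bar>x $ j - x' $ j\<bar> \<le> 8 * (real_of_int \<mu> * \<rho>)" by linarith
        moreover have "real (nat (17 * \<mu>)) * \<rho> = 17 * (real_of_int \<mu> * \<rho>)" using \<mu>1 by simp
        moreover have "0 < real_of_int \<mu> * \<rho>" using \<mu>1 \<rho> by simp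
        ultimately show ?thesis using False unfolding mult.assoc by (simp only: if_False) linarith
      qed
    qed (auto simp: Q_def)
    then show ?thesis by (simp add: prod_one_direction d1_def)
  qed
  define B where "B = 8 * real d1 * (24 * \<alpha>) ^ d1 / (real_of_int \<mu> ^ d1 * real_of_int \<mu>)"
  have B: "\<bar>gram i \<alpha> \<rho> x x'\<bar> \<le> B" if x': "x' \<in> Q" for x'
  \<comment> \<open>Floors are asymmetric: both 0 and -1 allow arbitrarily close heights. Otherwise
    the heights differ by at least \<open>m * \<rho>\<close> or \<open>(- m - 1) * \<rho>\<close>,
    in either case by at least \<open>\<mu> * \<rho> / 2\<close>.\<close>
  proof (cases "m = 0 \<or> m = - 1")
    case True
    then have "\<mu> = 1" by (auto simp: \<mu>_def)
    have "\<bar>gram i \<alpha> \<rho> x x'\<bar> \<le> 4 * (12 * \<alpha>) ^ d1" unfolding d1_def by (rule gram_near[OF \<alpha>])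
    also have "\<dots> \<le> (8 * real d1) * (24 * \<alpha>) ^ d1"
      using d1 \<alpha> by (intro mult_mono power_mono) auto
    finally show ?thesis by (simp add: B_def \<open>\<mu> = 1\<close>)
  next
    case False
    define t where "t = \<bar>x $ i - x' $ i\<bar>"
    have tl: "\<rho> \<le> t \<and> real_of_int \<mu> * \<rho> \<le> 2 * t"
    proof (cases "m \<ge> 1")
      case True
      then have "\<rho> \<le> real_of_int m * \<rho>"
        using mult_right_mono[of 1 "real_of_int m" \<rho>] \<rho> by simp
      moreover have "\<mu> = m" using True by (simp add: \<mu>_def)
      moreover have "x' $ i - x $ i \<le> t" by (simp add: t_def)
      ultimately show ?thesis using m(1)[OF x'] \<rho> unfolding \<open>\<mu> = m\<close> by (intro conjI) linarith+
    next
      case 2: False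
      with False have m2: "m \<le> -2" by linarith
      then have "real_of_int \<mu> * \<rho> = - (real_of_int m * \<rho>)" by (simp add: \<mu>_def)
      moreover have "(real_of_int m + 1) * \<rho> \<le> (-1) * \<rho>" using m2 \<rho> by (intro mult_right_mono) auto
      moreover have "2 * (real_of_int m + 1) * \<rho> \<le> real_of_int m * \<rho>" using m2 \<rho> by (intro mult_right_mono) auto
      moreover have "x $ i - x' $ i \<le> t" by (simp add: t_def)
      ultimately show ?thesis using m(2)[OF x'] unfolding mult.assoc by (intro conjI) linarith+
    qed
    have t0: "0 < t" using tl \<rho> by linarith
    have rt: "\<rho> / t \<le> 2 / real_of_int \<mu>" using tl t0 \<mu>1 by (simp add: field_simps)
    have "(4 * \<alpha> * \<alpha>) * (3 / t) = 12 * \<alpha> * (\<alpha> / t)" by simp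
    also have "\<dots> \<le> 12 * \<alpha> * (2 / real_of_int \<mu>)"
    proof -
      have "\<alpha> / t \<le> \<rho> / t" using \<alpha> t0 by (simp add: divide_right_mono)
      then show ?thesis using rt \<alpha> by (intro mult_left_mono) auto
    qed
    finally have 1: "(4 * \<alpha> * \<alpha>) * (3 / t) \<le> 24 * \<alpha> / real_of_int \<mu>" by simp
    have "\<bar>gram i \<alpha> \<rho> x x'\<bar> \<le> 4 * (((4 * \<alpha> * \<alpha>) * (3 / t)) ^ d1 * (real d1 * (\<rho> / t)))"
      using gram_far[OF \<alpha> t_def] tl unfolding d1_def power_mult_distrib by (simp add: mult.assoc)
    also have "\<dots> \<le> 4 * ((24 * \<alpha> / real_of_int \<mu>) ^ d1 * (real d1 * (2 / real_of_int \<mu>)))"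
      using 1 rt \<alpha> t0 \<rho> \<mu>1 by (intro mult_left_mono mult_mono power_mono zero_le_power) auto
    also have "\<dots> = B" by (simp add: B_def power_divide)
    finally show ?thesis .
  qed
  have "(\<Sum>x'\<in>{x'\<in>P. \<lfloor>(x' $ i - x $ i) / \<rho>\<rfloor> = m}. \<bar>gram i \<alpha> \<rho> x x'\<bar>) = (\<Sum>x'\<in>Q. \<bar>gram i \<alpha> \<rho> x x'\<bar>)"
    by (rule sum.mono_neutral_right) (use fin in \<open>auto simp: Q_def\<close>)
  also have "\<dots> \<le> real (card Q) * B" using sum_bounded_above[of Q, OF B] by simp
  also have "\<dots> \<le> real (M * nat (17 * \<mu>) ^ d1) * B"
    by (rule mult_right_mono) (use card \<alpha> \<mu>1 in \<open>auto simp: B_def simp del: of_nat_mult\<close>)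
  also have "\<dots> = M * (17 * real_of_int \<mu>) ^ d1 * B" using \<mu>1 by simp
  also have "\<dots> = 8 * real d1 * (17 ^ d1 * 24 ^ d1) * M * \<alpha> ^ d1 / real_of_int \<mu>"
    using \<mu>1 by (simp add: B_def power_mult_distrib field_simps)
  also have "17 ^ d1 * 24 ^ d1 = (408 :: real) ^ d1" by (simp flip: power_mult_distrib)
  finally show ?thesis by (simp add: d1_def \<mu>_def)
qed

lemma sum_inverse_int_le:
  "(\<Sum>m = - int N..int N. 1 / max 1 \<bar>real_of_int m\<bar>) \<le> 1 + 2 * harm N"
proof (induction N)
  case 0 then show ?case by (simp add: harm_def)
next
  case (Suc N)
  have "{- int (Suc N)..int (Suc N)} = insert (int (Suc N)) (insert (- int (Suc N)) {- int N..int N})"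
    by auto
  then have "(\<Sum>m = - int (Suc N)..int (Suc N). 1 / max 1 \<bar>real_of_int m\<bar>)
     = 2 / real (Suc N) + (\<Sum>m = - int N..int N. 1 / max 1 \<bar>real_of_int m\<bar>)"
    by (simp add: max_def add_ac)
  then show ?case using Suc by (simp add: harm_Suc inverse_eq_divide)
qed

text \<open>The layers contribute like \<open>1 / \<bar>m\<bar>\<close> up to
  \<open>\<bar>m\<bar> = O(1 / \<rho>)\<close>. Their harmonic sum is the one logarithm lost in the
  energy.\<close>

lemma gram_sum:
  fixes i :: "'n::finite"
  assumes sp: "spaced M \<rho> P" and d: "CARD('n) \<ge> 2" and \<alpha>: "0 < \<alpha>" "\<alpha> \<le> \<rho>" "\<rho> \<le> 1"
    and range: "\<And>x. x \<in> P \<Longrightarrow> 0 \<le> x $ i \<and> x $ i \<le> 2" and x: "x \<in> P"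
  shows "(\<Sum>x'\<in>P. \<bar>gram i \<alpha> \<rho> x x'\<bar>)
     \<le> 8 * real (CARD('n) - 1) * 408 ^ (CARD('n) - 1) * M * \<alpha> ^ (CARD('n) - 1) * (3 + 2 * ln (3 / \<rho>))"
proof -
  define C where "C = 8 * real (CARD('n) - 1) * 408 ^ (CARD('n) - 1) * M * \<alpha> ^ (CARD('n) - 1)"
  have C: "0 \<le> C" using \<alpha> by (simp add: C_def)
  have \<rho>: "0 < \<rho>" using \<alpha> by linarith
  define N where "N = nat \<lceil>2 / \<rho>\<rceil>"
  have N0: "N > 0" using \<rho> by (simp add: N_def)
  have N: "2 / \<rho> \<le> real N" "real N \<le> 3 / \<rho>"
  proof -
    show "2 / \<rho> \<le> real N" unfolding N_def by linarith
    have "1 \<le> 1 / \<rho>" using \<rho> \<alpha> by simp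
    moreover have "0 \<le> 2 / \<rho>" using \<rho> by simp
    then have "real N \<le> 2 / \<rho> + 1" unfolding N_def by linarith
    ultimately show "real N \<le> 3 / \<rho>" by (simp add: field_simps)
  qed
  have fin: "finite P" using sp by (simp add: spaced_def)
  have "(\<Sum>x'\<in>P. \<bar>gram i \<alpha> \<rho> x x'\<bar>)
     = (\<Sum>m = - int N..int N. \<Sum>x'\<in>{x'\<in>P. \<lfloor>(x' $ i - x $ i) / \<rho>\<rfloor> = m}. \<bar>gram i \<alpha> \<rho> x x'\<bar>)"
  proof (rule sum.group[symmetric])
    show "(\<lambda>x'. \<lfloor>(x' $ i - x $ i) / \<rho>\<rfloor>) ` P \<subseteq> {- int N..int N}"
    proof clarify
      fix x' assume x': "x' \<in> P"
      have "\<bar>x' $ i - x $ i\<bar> \<le> 2" using range[OF x] range[OF x'] by linarith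
      then have "\<bar>(x' $ i - x $ i) / \<rho>\<bar> \<le> real N"
        using N(1) \<rho> by (intro order_trans[OF _ N(1)]) (simp add: abs_divide divide_right_mono)
      then have "- real N \<le> (x' $ i - x $ i) / \<rho>" "(x' $ i - x $ i) / \<rho> < real N + 1" by linarith+
      then show "\<lfloor>(x' $ i - x $ i) / \<rho>\<rfloor> \<in> {- int N..int N}" by (simp add: le_floor_iff floor_le_iff)
    qed
  qed (use fin in auto)
  also have "\<dots> \<le> (\<Sum>m = - int N..int N. C * (1 / max 1 \<bar>real_of_int m\<bar>))"
    unfolding C_def using gram_slab_sum[OF sp d \<alpha>(1,2), of i x] by (intro sum_mono) simp
  also have "\<dots> = C * (\<Sum>m = - int N..int N. 1 / max 1 \<bar>real_of_int m\<bar>)"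
    by (simp only: sum_distrib_left)
  also have "\<dots> \<le> C * (3 + 2 * ln (3 / \<rho>))"
  proof (rule mult_left_mono[OF _ C])
    \<comment> \<open>\<open>harm N - ln N\<close> decreases from its value 1 at
      \<open>N = 1\<close>, so \<open>1 + 2 * harm N \<le> 3 + 2 * ln N\<close>.\<close>
    have "ln (real N) \<le> ln (3 / \<rho>)" using N N0 \<rho> by simp
    then show "(\<Sum>m = - int N..int N. 1 / max 1 \<bar>real_of_int m\<bar>) \<le> 3 + 2 * ln (3 / \<rho>)"
      using sum_inverse_int_le[of N] euler_mascheroni_sequence_decreasing[of 1 N] N0
      by (simp add: harm_expand)
  qed
  finally show ?thesis by (simp add: C_def)
qed

lemma energy_upper:
  fixes i :: "'n::finite"
  assumes sp: "spaced M \<rho> P" and d: "CARD('n) \<ge> 2" and \<alpha>: "0 < \<alpha>" "\<alpha> \<le> \<rho>" "\<rho> \<le> 1"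
    and range: "\<And>x. x \<in> P \<Longrightarrow> 0 \<le> x $ i \<and> x $ i \<le> 2"
  shows "(\<integral>c. (\<Sum>x\<in>P. balanced i \<alpha> \<rho> x c)\<^sup>2 * weight i c \<partial>line_space i)
     \<le> 8 * real (CARD('n) - 1) * 408 ^ (CARD('n) - 1) * M * \<alpha> ^ (CARD('n) - 1) * (3 + 2 * ln (3 / \<rho>)) * card P"
proof -
  have fin: "finite P" using sp by (simp add: spaced_def)
  have "(\<Sum>x\<in>P. \<Sum>x'\<in>P. gram i \<alpha> \<rho> x x') \<le> (\<Sum>x\<in>P. \<Sum>x'\<in>P. \<bar>gram i \<alpha> \<rho> x x'\<bar>)"
    by (intro sum_mono) simp
  also have "\<dots> \<le> of_nat (card P) * (8 * real (CARD('n) - 1) * 408 ^ (CARD('n) - 1) * M * \<alpha> ^ (CARD('n) - 1) * (3 + 2 * ln (3 / \<rho>)))"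
    by (rule sum_bounded_above) (rule gram_sum[OF sp d \<alpha> range])
  finally show ?thesis unfolding integral_balanced_square(2)[OF fin] by (simp only: mult_ac)
qed

section \<open>Discretization of the space of lines\<close>

lemma near_eq: "near i \<alpha> x c = (if \<forall>j\<in>UNIV - {i}. \<bar>fst (c j) + x $ i * snd (c j) - x $ j\<bar> \<le> \<alpha> then 1 else 0)"
proof (cases "\<forall>j\<in>UNIV - {i}. \<bar>fst (c j) + x $ i * snd (c j) - x $ j\<bar> \<le> \<alpha>")
  case True then show ?thesis unfolding near_def by (subst if_P) (auto intro!: prod.neutral simp: strip_def)
next
  case False
  then show ?thesis unfolding near_def by (subst if_not_P) (auto intro!: prod_zero simp: strip_def)
qed

lemma weight_nonneg: "0 \<le> weight i c"
  unfolding weight_def by (intro prod_nonneg) (simp add: cutoff_bounds)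

text \<open>Half-open, so that the cells partition the plane and every line has exactly one cell in
  each coordinate. Intercept and slope get different widths because a slope error is multiplied by
  the height of the point, which may be small.\<close>

definition cell :: "real \<Rightarrow> real \<Rightarrow> int \<times> int \<Rightarrow> (real \<times> real) set" where
  "cell \<delta> \<eta> z = {\<delta> * of_int (fst z)..<\<delta> * of_int (fst z) + \<delta>} \<times> {\<eta> * of_int (snd z)..<\<eta> * of_int (snd z) + \<eta>}"

lemma cell_iff:
  assumes "0 < \<delta>" "0 < \<eta>"
  shows "c \<in> cell \<delta> \<eta> z \<longleftrightarrow> z = (\<lfloor>fst c / \<delta>\<rfloor>, \<lfloor>snd c / \<eta>\<rfloor>)"
proof -
  have "u \<in> {e * of_int k..<e * of_int k + e} \<longleftrightarrow> k = \<lfloor>u / e\<rfloor>" if "0 < e" for u e :: real and k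
  proof -
    have "u \<in> {e * of_int k..<e * of_int k + e} \<longleftrightarrow> of_int k \<le> u / e \<and> u / e < of_int k + 1"
      using that by (auto simp: field_simps)
    also have "\<dots> \<longleftrightarrow> \<lfloor>u / e\<rfloor> = k" by (simp add: floor_eq_iff)
    finally show ?thesis by auto
  qed
  from this[OF assms(1)] this[OF assms(2)] show ?thesis
    by (cases c; cases z) (simp add: cell_def)
qed

lemma cell_measure:
  assumes "0 < \<delta>" "0 < \<eta>"
  shows "integrable lborel (indicator (cell \<delta> \<eta> z) :: _ \<Rightarrow> real)"
    and "(\<integral>c. indicator (cell \<delta> \<eta> z) c \<partial>lborel) = \<delta> * \<eta>"
proof -
  have em: "emeasure lborel (cell \<delta> \<eta> z) = ennreal (\<delta> * \<eta>)"
    unfolding cell_def lborel_prod[symmetric]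
    by (subst lborel.emeasure_pair_measure_Times) (use assms in \<open>auto simp: ennreal_mult\<close>)
  have "cell \<delta> \<eta> z \<in> sets (lborel \<Otimes>\<^sub>M lborel)" unfolding cell_def by (intro pair_measureI) auto
  then have sets: "cell \<delta> \<eta> z \<in> sets lborel" by (simp only: lborel_prod)
  show "integrable lborel (indicator (cell \<delta> \<eta> z) :: _ \<Rightarrow> real)"
    using sets em by simp
  show "(\<integral>c. indicator (cell \<delta> \<eta> z) c \<partial>lborel) = \<delta> * \<eta>"
    using em assms by (simp add: measure_def)
qed

text \<open>The bound on \<open>n z\<close> from below makes the thick part of \<open>balanced\<close> at most half of the thin part on each
  cell, because a thick tube contains \<open>O(1 / \<rho>)\<close> points whatever its position.\<close>

lemma energy_lower:
  fixes i :: "'n::finite" and P :: "(real ^ 'n) set"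
  assumes sp: "spaced M \<rho> P" and \<rho>: "0 < \<rho>" "\<rho> \<le> 1" and \<delta>: "0 < \<delta>" and \<eta>: "0 < \<eta>"
    and range: "\<And>x. x \<in> P \<Longrightarrow> 0 \<le> x $ i \<and> x $ i \<le> 2 \<and> x $ i * \<eta> \<le> 2 * \<delta>"
    and Z: "finite Z" "Z \<subseteq> PiE (UNIV - {i}) (\<lambda>_. UNIV)"
    and Zb: "\<And>z j. z \<in> Z \<Longrightarrow> j \<noteq> i \<Longrightarrow> - 2 \<le> \<eta> * of_int (snd (z j)) \<and> \<eta> * of_int (snd (z j)) + \<eta> \<le> 2"
    and n: "\<And>z. n z = real (card {x\<in>P. \<forall>j\<in>UNIV - {i}. \<bar>\<delta> * of_int (fst (z j)) + x $ i * (\<eta> * of_int (snd (z j))) - x $ j\<bar> \<le> 6 * \<delta>})"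
    and rich: "\<And>z. z \<in> Z \<Longrightarrow> n z \<ge> 2 * (9 * \<delta> / \<rho>) ^ (CARD('n) - 1) * (3 * real M * 9 ^ (CARD('n) - 1) / \<rho>)"
  shows "(\<Sum>z\<in>Z. (n z)\<^sup>2) * (\<delta> * \<eta>) ^ (CARD('n) - 1)
     \<le> 4 * (\<integral>c. (\<Sum>x\<in>P. balanced i (9 * \<delta>) \<rho> x c)\<^sup>2 * weight i c \<partial>line_space i)"
proof -
  interpret L: product_sigma_finite "\<lambda>_ :: 'n. lborel :: (real \<times> real) measure" by standard
  define q where "q = (9 * \<delta> / \<rho>) ^ (CARD('n) - 1)"
  define S where "S = 3 * real M * 9 ^ (CARD('n) - 1) / \<rho>"
  have q0: "0 \<le> q" using \<delta> \<rho> by (simp add: q_def)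
  have fin: "finite P" using sp by (simp add: spaced_def)
  define F where "F = (\<lambda>c. \<Sum>x\<in>P. balanced i (9 * \<delta>) \<rho> x c)"
  define X where "X = (\<lambda>z c. \<Prod>j\<in>UNIV - {i}. indicator (cell \<delta> \<eta> (z j)) (c j) :: real)"
  have X01: "X z c = (if \<forall>j\<in>UNIV - {i}. c j \<in> cell \<delta> \<eta> (z j) then 1 else 0)" for z c
  proof (cases "\<forall>j\<in>UNIV - {i}. c j \<in> cell \<delta> \<eta> (z j)")
    case True then show ?thesis unfolding X_def by (subst if_P) (auto intro!: prod.neutral)
  next
    case False
    then obtain j where "j \<noteq> i" "c j \<notin> cell \<delta> \<eta> (z j)" by auto
    then show ?thesis unfolding X_def by (subst if_not_P[OF False]) (auto intro!: prod_zero bexI[of _ j])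
  qed
  have intX: "integrable (line_space i) (X z)" "(\<integral>c. X z c \<partial>line_space i) = (\<delta> * \<eta>) ^ (CARD('n) - 1)" for z
  proof -
    show "integrable (line_space i) (X z)" unfolding X_def line_space_def
      by (rule L.product_integrable_prod) (auto intro!: cell_measure \<delta> \<eta>)
    have "(\<integral>c. X z c \<partial>line_space i) = (\<Prod>j\<in>UNIV - {i}. \<integral>c. indicator (cell \<delta> \<eta> (z j)) c \<partial>lborel)"
      unfolding X_def line_space_def
      by (rule L.product_integral_prod) (auto intro!: cell_measure \<delta> \<eta>)
    then show "(\<integral>c. X z c \<partial>line_space i) = (\<delta> * \<eta>) ^ (CARD('n) - 1)"
      unfolding cell_measure(2)[OF \<delta> \<eta>] by (simp add: card_Diff_singleton)
  qed
  \<comment> \<open>At most one cell contains \<open>c\<close>, so the sum has at most one non-zero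
    term. On that cell the slopes lie in \<open>[-2, 2]\<close> and the weight is 1.\<close>
  have pointwise: "(\<Sum>z\<in>Z. (n z / 2)\<^sup>2 * X z c) \<le> (F c)\<^sup>2 * weight i c" for c
  proof (cases "\<exists>z\<in>Z. X z c \<noteq> 0")
    case False
    then have "(\<Sum>z\<in>Z. (n z / 2)\<^sup>2 * X z c) = 0" by (intro sum.neutral) auto
    then show ?thesis by (simp add: weight_nonneg)
  next
    case True
    then obtain z where z: "z \<in> Z" "X z c \<noteq> 0" by blast
    then have inz: "c j \<in> cell \<delta> \<eta> (z j)" if "j \<noteq> i" for j
      using that by (auto simp: X01 split: if_splits)
    have uniq: "z' = z" if "z' \<in> Z" "X z' c \<noteq> 0" for z'
    proof (rule PiE_ext)
      show "z' \<in> PiE (UNIV - {i}) (\<lambda>_. UNIV)" "z \<in> PiE (UNIV - {i}) (\<lambda>_. UNIV)" using Z z that by auto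
      fix j assume j: "j \<in> UNIV - {i}"
      then have "c j \<in> cell \<delta> \<eta> (z' j)" using that by (auto simp: X01 split: if_splits)
      then show "z' j = z j" using inz[of j] j by (simp add: cell_iff[OF \<delta> \<eta>])
    qed
    have "(\<Sum>z'\<in>Z. (n z' / 2)\<^sup>2 * X z' c) = (\<Sum>z'\<in>{z}. (n z' / 2)\<^sup>2 * X z' c)"
    proof (rule sum.mono_neutral_right)
      show "\<forall>z'\<in>Z - {z}. (n z' / 2)\<^sup>2 * X z' c = 0"
        using uniq by (metis DiffE insertCI mult_zero_right)
    qed (use Z z in auto)
    also have "\<dots> = (n z / 2)\<^sup>2"
    proof -
      have "X z c = 1" using z(2) X01[of z c] by presburger
      then show ?thesis by simp
    qed
    finally have lhs: "(\<Sum>z'\<in>Z. (n z' / 2)\<^sup>2 * X z' c) = (n z / 2)\<^sup>2" .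
    have b: "\<bar>snd (c j)\<bar> \<le> 2" if "j \<noteq> i" for j
      using inz[OF that] Zb[OF z(1) that] by (auto simp: cell_def)
    have w: "weight i c = 1"
      unfolding weight_def by (intro prod.neutral) (use b in \<open>auto intro!: cutoff_bounds\<close>)
    \<comment> \<open>Within a cell the intercept varies by \<open>\<delta>\<close> and the slope
      shifts the line by at most \<open>x $ i * \<eta> \<le> 2 * \<delta>\<close>. This enlarges
      \<open>6 * \<delta>\<close> to \<open>9 * \<delta>\<close>, the fine width of
      \<open>balanced\<close> here.\<close>
    have "n z \<le> real (card {x\<in>P. \<forall>j\<in>UNIV - {i}. \<bar>fst (c j) + x $ i * snd (c j) - x $ j\<bar> \<le> 9 * \<delta>})"
      unfolding n of_nat_le_iff
    proof (rule card_mono)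
      show "{x\<in>P. \<forall>j\<in>UNIV - {i}. \<bar>\<delta> * of_int (fst (z j)) + x $ i * (\<eta> * of_int (snd (z j))) - x $ j\<bar> \<le> 6 * \<delta>}
        \<subseteq> {x\<in>P. \<forall>j\<in>UNIV - {i}. \<bar>fst (c j) + x $ i * snd (c j) - x $ j\<bar> \<le> 9 * \<delta>}"
      proof (intro subsetI CollectI conjI ballI)
        fix x j
        assume x: "x \<in> {x\<in>P. \<forall>j\<in>UNIV - {i}. \<bar>\<delta> * of_int (fst (z j)) + x $ i * (\<eta> * of_int (snd (z j))) - x $ j\<bar> \<le> 6 * \<delta>}"
        then show "x \<in> P" by simp
        assume j: "j \<in> UNIV - {i}"
        have 1: "\<bar>\<delta> * of_int (fst (z j)) + x $ i * (\<eta> * of_int (snd (z j))) - x $ j\<bar> \<le> 6 * \<delta>" using x j by simp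
        have 2: "\<bar>fst (c j) - \<delta> * of_int (fst (z j))\<bar> \<le> \<delta>" "\<bar>snd (c j) - \<eta> * of_int (snd (z j))\<bar> \<le> \<eta>"
          using inz[of j] j by (auto simp: cell_def)
        have "\<bar>x $ i * (snd (c j) - \<eta> * of_int (snd (z j)))\<bar> \<le> x $ i * \<eta>"
          unfolding abs_mult using 2(2) range[of x] x by (auto intro!: mult_mono)
        also have "\<dots> \<le> 2 * \<delta>" using range[of x] x by auto
        finally have "\<bar>x $ i * snd (c j) - x $ i * (\<eta> * of_int (snd (z j)))\<bar> \<le> 2 * \<delta>"
          by (simp add: right_diff_distrib)
        then show "\<bar>fst (c j) + x $ i * snd (c j) - x $ j\<bar> \<le> 9 * \<delta>" using 1 2(1) by linarith
      qed
    qed (use fin in auto)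
    also have "\<dots> = (\<Sum>x\<in>P. near i (9 * \<delta>) x c)"
      using fin by (simp add: near_eq sum.If_cases Int_def)
    finally have hi: "n z \<le> (\<Sum>x\<in>P. near i (9 * \<delta>) x c)" .
    have "(\<Sum>x\<in>P. near i \<rho> x c) = real (card {x\<in>P. \<forall>j\<in>UNIV - {i}. \<bar>fst (c j) + x $ i * snd (c j) - x $ j\<bar> \<le> \<rho>})"
      using fin by (simp add: near_eq sum.If_cases Int_def)
    also have "\<dots> \<le> 3 * real M * (2 * real 1 + 7) ^ (CARD('n) - 1) / \<rho>"
    proof (rule card_near_line[OF sp \<rho>, where a = "\<lambda>j. fst (c j)" and b = "\<lambda>j. snd (c j)" and i = i])
      show "\<bar>snd (c j)\<bar> \<le> 3" if "j \<noteq> i" for j using b[OF that] by linarith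
    qed (use range in auto)
    finally have lo: "(\<Sum>x\<in>P. near i \<rho> x c) \<le> S" by (simp add: S_def)
    have "F c = (\<Sum>x\<in>P. near i (9 * \<delta>) x c) - q * (\<Sum>x\<in>P. near i \<rho> x c)"
      by (simp only: F_def balanced_def q_def sum_subtractf sum_distrib_left)
    then have "F c \<ge> n z - q * S" using hi mult_left_mono[OF lo q0] by linarith
    moreover have "n z \<ge> 2 * (q * S)" using rich[OF z(1)] by (simp only: q_def S_def mult.assoc)
    ultimately have "n z / 2 \<le> F c" by linarith
    then have "(n z / 2)\<^sup>2 \<le> (F c)\<^sup>2" by (intro power_mono) (simp_all add: n)
    then show ?thesis by (simp add: lhs w)
  qed
  have "(\<integral>c. (\<Sum>z\<in>Z. (n z / 2)\<^sup>2 * X z c) \<partial>line_space i) \<le> (\<integral>c. (F c)\<^sup>2 * weight i c \<partial>line_space i)"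
    by (rule integral_mono) (use pointwise integral_balanced_square(1)[OF fin] intX(1) in \<open>auto simp: F_def\<close>)
  moreover have "(\<integral>c. (\<Sum>z\<in>Z. (n z / 2)\<^sup>2 * X z c) \<partial>line_space i) = (\<Sum>z\<in>Z. (n z / 2)\<^sup>2 * (\<delta> * \<eta>) ^ (CARD('n) - 1))"
    using intX by (simp add: Bochner_Integration.integral_sum)
  moreover have "\<dots> = (\<Sum>z\<in>Z. (n z)\<^sup>2) * (\<delta> * \<eta>) ^ (CARD('n) - 1) / 4"
    by (simp add: sum_distrib_right sum_divide_distrib power_divide)
  ultimately show ?thesis by (simp add: F_def)
qed

text \<open>Both energy bounds carry \<open>\<delta> ^ (d - 1)\<close>: the lower one from the
  measure of a cell, the upper one from the fine width. After division only the slope width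
  \<open>\<eta>\<close> is left. The constant 3672 is \<open>408 * 9\<close>.\<close>

lemma cells_bound:
  fixes i :: "'n::finite" and P :: "(real ^ 'n) set"
  assumes sp: "spaced M \<rho> P" and d: "CARD('n) \<ge> 2" and \<rho>: "\<rho> \<le> 1" and \<delta>: "0 < \<delta>" "9 * \<delta> \<le> \<rho>" and \<eta>: "0 < \<eta>"
    and range: "\<And>x. x \<in> P \<Longrightarrow> 0 \<le> x $ i \<and> x $ i \<le> 2 \<and> x $ i * \<eta> \<le> 2 * \<delta>"
    and Z: "finite Z" "Z \<subseteq> PiE (UNIV - {i}) (\<lambda>_. UNIV)"
    and Zb: "\<And>z j. z \<in> Z \<Longrightarrow> j \<noteq> i \<Longrightarrow> - 2 \<le> \<eta> * of_int (snd (z j)) \<and> \<eta> * of_int (snd (z j)) + \<eta> \<le> 2"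
    and n: "\<And>z. n z = real (card {x\<in>P. \<forall>j\<in>UNIV - {i}. \<bar>\<delta> * of_int (fst (z j)) + x $ i * (\<eta> * of_int (snd (z j))) - x $ j\<bar> \<le> 6 * \<delta>})"
    and rich: "\<And>z. z \<in> Z \<Longrightarrow> n z \<ge> 2 * (9 * \<delta> / \<rho>) ^ (CARD('n) - 1) * (3 * real M * 9 ^ (CARD('n) - 1) / \<rho>)"
  shows "(\<Sum>z\<in>Z. (n z)\<^sup>2) * \<eta> ^ (CARD('n) - 1)
     \<le> 32 * real (CARD('n) - 1) * 3672 ^ (CARD('n) - 1) * M * (3 + 2 * ln (3 / \<rho>)) * card P"
proof -
  have \<rho>0: "0 < \<rho>" using \<delta> by linarith
  define Y where "Y = 8 * real (CARD('n) - 1) * M * (3 + 2 * ln (3 / \<rho>)) * card P"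
  have "(\<Sum>z\<in>Z. (n z)\<^sup>2) * (\<delta> * \<eta>) ^ (CARD('n) - 1)
     \<le> 4 * (\<integral>c. (\<Sum>x\<in>P. balanced i (9 * \<delta>) \<rho> x c)\<^sup>2 * weight i c \<partial>line_space i)"
    by (rule energy_lower[where n = n and Z = Z and P = P and M = M and i = i and \<rho> = \<rho> and \<delta> = \<delta> and \<eta> = \<eta>])
       (fact sp \<rho>0 \<rho> \<delta>(1) \<eta> range Z Zb n rich)+
  also have "\<dots> \<le> 4 * (8 * real (CARD('n) - 1) * 408 ^ (CARD('n) - 1) * M * (9 * \<delta>) ^ (CARD('n) - 1) * (3 + 2 * ln (3 / \<rho>)) * card P)"
    by (rule mult_left_mono[OF energy_upper[OF sp d _ _ \<rho>]]) (use \<delta> range in auto)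
  also have "\<dots> = 4 * (Y * (408 ^ (CARD('n) - 1) * 9 ^ (CARD('n) - 1)) * \<delta> ^ (CARD('n) - 1))"
    by (simp only: power_mult_distrib Y_def mult_ac)
  also have "408 ^ (CARD('n) - 1) * 9 ^ (CARD('n) - 1) = (3672 :: real) ^ (CARD('n) - 1)"
    by (simp flip: power_mult_distrib)
  finally have "((\<Sum>z\<in>Z. (n z)\<^sup>2) * \<eta> ^ (CARD('n) - 1)) * \<delta> ^ (CARD('n) - 1)
      \<le> (4 * (Y * 3672 ^ (CARD('n) - 1))) * \<delta> ^ (CARD('n) - 1)"
    by (simp only: power_mult_distrib mult_ac)
  then have "(\<Sum>z\<in>Z. (n z)\<^sup>2) * \<eta> ^ (CARD('n) - 1) \<le> 4 * (Y * 3672 ^ (CARD('n) - 1))"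
    using \<delta> by (simp only: mult_le_cancel_right_pos zero_less_power)
  also have "4 * (Y * 3672 ^ (CARD('n) - 1))
      = 32 * real (CARD('n) - 1) * 3672 ^ (CARD('n) - 1) * M * (3 + 2 * ln (3 / \<rho>)) * card P"
    by (simp only: Y_def mult.assoc) (simp del: of_nat_diff add: mult_ac)
  finally show ?thesis .
qed

section \<open>Tubes in coordinates\<close>

text \<open>Normal form of a line over a coordinate \<open>i\<close> in which its direction is
  largest: the parameter is then the \<open>i\<close>-th coordinate, and the slopes are at most 1,
  well inside the range where \<open>cutoff\<close> is 1.\<close>

definition chart :: "'n \<Rightarrow> real ^ 'n \<Rightarrow> real ^ 'n \<Rightarrow> (real ^ 'n) set \<Rightarrow> bool" where
  "chart i a b L \<longleftrightarrow> a $ i = 0 \<and> b $ i = 1 \<and> (\<forall>j. \<bar>b $ j\<bar> \<le> 1) \<and> L = line_through a b"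

lemma chart_exists:
  fixes L :: "(real ^ 'n::finite) set"
  assumes "tube_axis L"
  shows "\<exists>i a b. chart i a b L"
proof -
  obtain p u :: "real ^ 'n" where u: "norm u = 1" "L = line_through p u"
    using assms by (auto simp: tube_axis_def)
  have "Max (range (\<lambda>j. \<bar>u $ j\<bar>)) \<in> range (\<lambda>j. \<bar>u $ j\<bar>)" by (rule Max_in) auto
  then obtain i where i: "Max (range (\<lambda>j. \<bar>u $ j\<bar>)) = \<bar>u $ i\<bar>" by blast
  have max: "\<bar>u $ j\<bar> \<le> \<bar>u $ i\<bar>" for j unfolding i[symmetric] by (rule Max_ge) auto
  have ui: "u $ i \<noteq> 0"
  proof
    assume "u $ i = 0"
    then have "u = 0" using max by (auto simp: vec_eq_iff)
    then show False using u by simp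
  qed
  define b where "b = (1 / u $ i) *\<^sub>R u"
  define a where "a = p - (p $ i) *\<^sub>R b"
  have "line_through p u = line_through a b"
  proof -
    have 1: "p + t *\<^sub>R u = a + (p $ i + t * u $ i) *\<^sub>R b" for t
      using ui by (simp add: a_def b_def algebra_simps)
    have 2: "a + s *\<^sub>R b = p + ((s - p $ i) / u $ i) *\<^sub>R u" for s
      using ui by (simp add: a_def b_def algebra_simps diff_divide_distrib)
    show ?thesis unfolding line_through_def using 1 2 by blast
  qed
  moreover have "\<bar>b $ j\<bar> \<le> 1" for j
    using max[of j] ui by (simp add: b_def abs_divide divide_le_eq)
  ultimately have "chart i a b L" using ui u by (simp add: chart_def a_def b_def)
  then show ?thesis by blast
qed

text \<open>The centre is within \<open>\<delta> / 2\<close> of a point of the tube, which in turn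
  is nearer than \<open>\<delta>\<close> to some point \<open>q\<close> of the axis. Moving along
  the axis from the height of \<open>q\<close> to that of \<open>x\<close> costs at most
  \<open>3 / 2 * \<delta>\<close> again, since the slopes are at most 1.\<close>

lemma incident_chart:
  fixes x :: "real ^ 'n::finite"
  assumes L: "chart i a b L" and \<delta>: "0 < \<delta>" and inc: "incident (cball x (\<delta> / 2)) (tube \<delta> L)"
  shows "\<bar>a $ j + x $ i * b $ j - x $ j\<bar> \<le> 3 * \<delta>"
proof -
  obtain y where y: "dist x y \<le> \<delta> / 2" "infdist y L \<le> \<delta> / 2"
    using inc by (auto simp: incident_def tube_def)
  have ne: "L \<noteq> {}" using L by (auto simp: chart_def line_through_def)
  have "(INF q\<in>L. dist y q) < \<delta>" using y \<delta> by (simp add: infdist_notempty[OF ne])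
  then obtain q where q: "q \<in> L" "dist y q < \<delta>"
    using cINF_less_iff[of L "dist y" \<delta>] ne bdd_below.I2[of L 0 "dist y"] by auto
  have xq: "norm (q - x) \<le> 3 / 2 * \<delta>"
    using q y dist_triangle[of x q y] by (simp add: dist_norm norm_minus_commute)
  have comp: "\<bar>q $ k - x $ k\<bar> \<le> 3 / 2 * \<delta>" for k
    using component_le_norm_cart[of "q - x" k] xq by simp
  obtain t where t: "q = a + t *\<^sub>R b" using q L by (auto simp: chart_def line_through_def)
  have ti: "t = q $ i" using L by (simp add: t chart_def)
  have "\<bar>(q $ i - x $ i) * b $ j\<bar> \<le> 3 / 2 * \<delta> * 1"
    unfolding abs_mult by (rule mult_mono) (use comp L \<delta> in \<open>auto simp: chart_def\<close>)
  moreover have "q $ j = a $ j + q $ i * b $ j" by (subst t) (simp add: ti)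
  ultimately show ?thesis using comp[of j] unfolding left_diff_distrib by linarith
qed

text \<open>From \<open>cos x = 1 - 2 * (sin (x / 2))\<^sup>2\<close> and
  \<open>sin y \<ge> y / 2\<close> on \<open>[0, 1]\<close>. It turns a bound on chords into one on
  angles.\<close>

lemma cos_upper_bound:
  fixes x :: real
  assumes "0 \<le> x" "x \<le> 1"
  shows "cos x \<le> 1 - x\<^sup>2 / 8"
proof -
  define y where "y = x / 2"
  have y: "0 \<le> y" "y \<le> 1" using assms by (auto simp: y_def)
  have "\<bar>sin y - (\<Sum>m<3. sin_coeff m * y ^ m)\<bar> \<le> inverse (fact 3) * \<bar>y\<bar> ^ 3"
    by (rule Maclaurin_sin_bound)
  then have "\<bar>sin y - y\<bar> \<le> y ^ 3 / 6"
    using y by (simp add: eval_nat_numeral sin_coeff_def)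
  moreover have "y ^ 3 \<le> y" using y by (simp add: power_le_one_iff eval_nat_numeral mult_le_one mult_left_le)
  ultimately have "y / 2 \<le> sin y" using y by linarith
  then have "(y / 2)\<^sup>2 \<le> (sin y)\<^sup>2" using y by (intro power_mono) auto
  moreover have "cos x = 1 - 2 * (sin y)\<^sup>2" using cos_double_sin[of y] by (simp add: y_def)
  ultimately show ?thesis by (simp add: y_def power_divide)
qed

lemma norm_diff_normalized:
  fixes b b' :: "'a::real_normed_vector"
  assumes "norm b \<ge> 1" "norm b' \<ge> 1"
  shows "norm ((1 / norm b) *\<^sub>R b - (1 / norm b') *\<^sub>R b') \<le> 2 * norm (b - b')"
proof -
  have nz: "norm b > 0" "norm b' > 0" using assms by linarith+
  have "(1 / norm b) *\<^sub>R b - (1 / norm b') *\<^sub>R b'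
      = (1 / norm b) *\<^sub>R (b - b') + (1 / norm b - 1 / norm b') *\<^sub>R b'"
    by (simp add: algebra_simps)
  then have "norm ((1 / norm b) *\<^sub>R b - (1 / norm b') *\<^sub>R b')
      \<le> norm (b - b') / norm b + \<bar>1 / norm b - 1 / norm b'\<bar> * norm b'"
    using norm_triangle_ineq[of "(1 / norm b) *\<^sub>R (b - b')" "(1 / norm b - 1 / norm b') *\<^sub>R b'"] by simp
  also have "\<bar>1 / norm b - 1 / norm b'\<bar> * norm b' = \<bar>norm b' - norm b\<bar> / norm b"
  proof -
    have "1 / norm b - 1 / norm b' = (norm b' - norm b) / (norm b * norm b')"
      using nz by (simp add: field_simps)
    then show ?thesis using nz by (simp add: abs_mult abs_divide)
  qed
  also have "norm (b - b') / norm b + \<bar>norm b' - norm b\<bar> / norm b \<le> norm (b - b') / 1 + norm (b - b') / 1"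
    using assms norm_triangle_ineq3[of b' b]
    by (intro add_mono frac_le) (auto simp: norm_minus_commute)
  finally show ?thesis by simp
qed

text \<open>Normalization at most doubles the difference of vectors of norm at least 1, so the unit
  directions are within \<open>\<delta> / 2\<close> and their inner product is at least
  \<open>1 - \<delta>\<^sup>2 / 8 \<ge> cos \<delta>\<close>.\<close>

lemma line_angle_chart_le:
  fixes L L' :: "(real ^ 'n::finite) set"
  assumes L: "chart i a b L" "chart i' a' b' L'" and \<delta>: "0 \<le> \<delta>" "\<delta> \<le> 1"
    and close: "norm (b - b') \<le> \<delta> / 4"
  shows "line_angle L L' \<le> \<delta>"
proof -
  define u where "u = (1 / norm b) *\<^sub>R b"
  define v where "v = (1 / norm b') *\<^sub>R b'"
  have b: "norm b \<ge> 1" "norm b' \<ge> 1"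
    using component_le_norm_cart[of b i] component_le_norm_cart[of b' i'] L by (auto simp: chart_def)
  have n: "norm u = 1" "norm v = 1" using b by (auto simp: u_def v_def)
  have lt: "line_through c w = line_through c ((1 / norm w) *\<^sub>R w)" if "norm w \<ge> 1" for c w :: "real ^ 'n"
  proof -
    have 1: "c + t *\<^sub>R w = c + (t * norm w) *\<^sub>R ((1 / norm w) *\<^sub>R w)" for t using that by auto
    have 2: "c + s *\<^sub>R ((1 / norm w) *\<^sub>R w) = c + (s / norm w) *\<^sub>R w" for s by simp
    show ?thesis unfolding line_through_def using 1 2 by blast
  qed
  have angle: "line_angle L L' = arccos \<bar>u \<bullet> v\<bar>"
    using L lt[OF b(1), of a] lt[OF b(2), of a'] line_angle_line_through[OF n, of a a']
    by (simp add: chart_def u_def v_def)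
  have "norm (u - v) \<le> \<delta> / 2" using norm_diff_normalized[OF b] close by (simp add: u_def v_def)
  then have "(norm (u - v))\<^sup>2 \<le> (\<delta> / 2)\<^sup>2" by (intro power_mono) auto
  moreover have "(norm (u - v))\<^sup>2 = 2 - 2 * (u \<bullet> v)"
    using n by (simp add: power2_norm_eq_inner inner_diff inner_commute norm_eq_1)
  ultimately have "1 - \<delta>\<^sup>2 / 8 \<le> u \<bullet> v" by (simp add: power_divide)
  then have "cos \<delta> \<le> \<bar>u \<bullet> v\<bar>" using cos_upper_bound[OF \<delta>] by linarith
  moreover have "\<bar>u \<bullet> v\<bar> \<le> 1" using Cauchy_Schwarz_ineq2[of u v] n by simp
  ultimately have "arccos \<bar>u \<bullet> v\<bar> \<le> arccos (cos \<delta>)" by (intro arccos_le_arccos) auto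
  then show ?thesis using \<delta> pi_gt3 by (simp add: angle arccos_cos)
qed

text \<open>The common point of the two tubes is a point \<open>q\<close> where the axis of
  \<open>L\<close> meets the unit cube, as \<open>tube_axis\<close> demands. At the height of
  \<open>q\<close>, which lies in \<open>[0, 1]\<close> like \<open>s\<close>, the other line is off
  by at most \<open>2 * \<delta> / (4 * d)\<close> in each coordinate, in total by at most
  \<open>\<delta> / 2\<close>.\<close>

lemma distinct_chart:
  fixes L L' :: "(real ^ 'n::finite) set"
  assumes L: "chart i a b L" "chart i a' b' L'" "tube_axis L" and \<delta>: "0 < \<delta>" "\<delta> \<le> 1" and s: "0 \<le> s" "s \<le> 1"
    and close: "\<And>j. \<bar>b $ j - b' $ j\<bar> \<le> \<delta> / (4 * CARD('n))"
      "\<And>j. \<bar>(a $ j + s * b $ j) - (a' $ j + s * b' $ j)\<bar> \<le> \<delta> / (4 * CARD('n))"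
  shows "\<not> distinct_tubes \<delta> L L'"
proof -
  let ?\<kappa> = "\<delta> / (4 * CARD('n))"
  have k: "0 \<le> ?\<kappa>" using \<delta> by simp
  have "norm (b - b') \<le> (\<Sum>j\<in>UNIV. \<bar>(b - b') $ j\<bar>)" by (rule norm_le_l1_cart)
  also have "\<dots> \<le> of_nat (card (UNIV :: 'n set)) * ?\<kappa>" by (rule sum_bounded_above) (use close in simp)
  also have "\<dots> = \<delta> / 4" by simp
  finally have angle: "line_angle L L' \<le> \<delta>"
    using line_angle_chart_le[OF L(1,2)] \<delta> by simp
  obtain q where q: "q \<in> L" "q \<in> unit_cube" using L(3) by (auto simp: tube_axis_def)
  obtain t where t: "q = a + t *\<^sub>R b" using q L by (auto simp: chart_def line_through_def)
  have "t = q $ i" using L by (simp add: t chart_def)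
  then have t01: "0 \<le> t" "t \<le> 1" using q(2) by (auto simp: unit_cube_def mem_box_cart vec_def)
  define q' where "q' = a' + t *\<^sub>R b'"
  have q': "q' \<in> L'" using L by (auto simp: q'_def chart_def line_through_def)
  have "\<bar>(q - q') $ j\<bar> \<le> 2 * ?\<kappa>" for j
  proof -
    have "\<bar>(t - s) * (b $ j - b' $ j)\<bar> \<le> 1 * ?\<kappa>"
      unfolding abs_mult by (rule mult_mono) (use t01 s close k in auto)
    moreover have "(q - q') $ j = ((a $ j + s * b $ j) - (a' $ j + s * b' $ j)) + (t - s) * (b $ j - b' $ j)"
      by (simp add: t q'_def algebra_simps)
    ultimately show ?thesis using close(2)[of j] by linarith
  qed
  then have "(\<Sum>j\<in>UNIV. \<bar>(q - q') $ j\<bar>) \<le> of_nat (card (UNIV :: 'n set)) * (2 * ?\<kappa>)"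
    by (intro sum_bounded_above)
  then have "dist q q' \<le> \<delta> / 2" using norm_le_l1_cart[of "q - q'"] by (simp add: dist_norm)
  then have "q \<in> tube \<delta> L'" using q q' infdist_le[OF q', of q] by (simp add: tube_def)
  moreover have "q \<in> tube \<delta> L" using q \<delta> by (simp add: tube_def)
  ultimately show ?thesis using angle by (auto simp: distinct_tubes_def)
qed

lemma abs_floor_le: "\<bar>y\<bar> \<le> real N \<Longrightarrow> \<lfloor>y\<rfloor> \<in> {- int N..int N}"
  unfolding atLeastAtMost_iff by linarith

lemma floor_divide_eq_imp_close:
  fixes u u' e :: real
  assumes "\<lfloor>u / e\<rfloor> = \<lfloor>u' / e\<rfloor>" "0 < e"
  shows "\<bar>u - u'\<bar> \<le> e"
proof -
  have "\<bar>u / e - u' / e\<bar> \<le> 1" using assms(1) by linarith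
  then show ?thesis using assms(2) by (simp add: abs_divide flip: diff_divide_distrib)
qed

text \<open>The position at \<open>x\<close> is known up to \<open>3 * \<delta>\<close>, and the two
  points fix the slopes up to \<open>12 * \<delta> / r\<close>. On a grid of mesh
  \<open>\<delta> / (4 * d)\<close>, two tubes of one cell cannot be distinct by
  \<open>distinct_chart\<close>. Each coordinate leaves at most \<open>25 * d\<close> positions and
  \<open>99 * d / r\<close> slopes, and 2475 is \<open>25 * 99\<close>.\<close>

lemma card_tubes_through_two_points:
  fixes T :: "(real ^ 'n::finite) set set" and x x' :: "real ^ 'n"
  assumes T: "\<And>L. L \<in> T \<Longrightarrow> chart i (a L) (b L) L" "\<And>L. L \<in> T \<Longrightarrow> tube_axis L"
      "pairwise (distinct_tubes \<delta>) T"
    and \<delta>: "0 < \<delta>" "\<delta> \<le> 1" and r: "0 < r" "r \<le> 1" "r / 2 \<le> \<bar>x $ i - x' $ i\<bar>" and xi: "0 \<le> x $ i" "x $ i \<le> 1"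
    and through: "\<And>L j. L \<in> T \<Longrightarrow> \<bar>a L $ j + x $ i * b L $ j - x $ j\<bar> \<le> 3 * \<delta>"
      "\<And>L j. L \<in> T \<Longrightarrow> \<bar>a L $ j + x' $ i * b L $ j - x' $ j\<bar> \<le> 3 * \<delta>"
  shows "real (card T) \<le> (2475 * (real CARD('n))\<^sup>2 / r) ^ (CARD('n) - 1)"
proof -
  define \<kappa> where "\<kappa> = \<delta> / (4 * CARD('n))"
  have k: "0 < \<kappa>" using \<delta> by (simp add: \<kappa>_def)
  define \<beta> where "\<beta> j = (x $ j - x' $ j) / (x $ i - x' $ i)" for j
  have xx: "x $ i - x' $ i \<noteq> 0" using r by auto
  define N1 where "N1 = 12 * CARD('n)"
  define N2 where "N2 = nat \<lceil>48 * CARD('n) / r\<rceil>"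
  define g where "g L = restrict (\<lambda>j. (\<lfloor>(a L $ j + x $ i * b L $ j - x $ j) / \<kappa>\<rfloor>, \<lfloor>(b L $ j - \<beta> j) / \<kappa>\<rfloor>)) (UNIV - {i})" for L
  have "card T \<le> card (PiE (UNIV - {i}) (\<lambda>_. {- int N1..int N1} \<times> {- int N2..int N2}))"
  proof (rule card_inj_on_le[where f = g])
    show "inj_on g T"
    proof (rule inj_onI, rule ccontr)
      fix L L' assume LL: "L \<in> T" "L' \<in> T" "g L = g L'" "L \<noteq> L'"
      have c: "\<bar>b L $ j - b L' $ j\<bar> \<le> \<kappa> \<and> \<bar>(a L $ j + x $ i * b L $ j) - (a L' $ j + x $ i * b L' $ j)\<bar> \<le> \<kappa>" for j
      proof (cases "j = i")
        case True then show ?thesis using T(1)[OF LL(1)] T(1)[OF LL(2)] k by (simp add: chart_def)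
      next
        case False
        then have "g L j = g L' j" "j \<in> UNIV - {i}" using LL by auto
        then have "\<lfloor>(a L $ j + x $ i * b L $ j - x $ j) / \<kappa>\<rfloor> = \<lfloor>(a L' $ j + x $ i * b L' $ j - x $ j) / \<kappa>\<rfloor>"
          "\<lfloor>(b L $ j - \<beta> j) / \<kappa>\<rfloor> = \<lfloor>(b L' $ j - \<beta> j) / \<kappa>\<rfloor>" by (simp_all add: g_def)
        from this[THEN floor_divide_eq_imp_close, OF k] show ?thesis by simp
      qed
      have "\<not> distinct_tubes \<delta> L L'"
        by (rule distinct_chart[OF T(1)[OF LL(1)] T(1)[OF LL(2)] T(2)[OF LL(1)] \<delta> xi])
           (use c in \<open>simp_all add: \<kappa>_def\<close>)
      then show False using T(3) LL by (auto simp: pairwise_def)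
    qed
    show "g ` T \<subseteq> PiE (UNIV - {i}) (\<lambda>_. {- int N1..int N1} \<times> {- int N2..int N2})"
    proof (intro image_subsetI PiE_I)
      fix L j assume LT: "L \<in> T" and j: "j \<in> UNIV - {i}"
      have "\<bar>(a L $ j + x $ i * b L $ j - x $ j) / \<kappa>\<bar> \<le> 3 * \<delta> / \<kappa>"
        using through(1)[OF LT, of j] k by (simp add: abs_divide divide_right_mono)
      also have "\<dots> = real N1" using \<delta> by (simp add: \<kappa>_def N1_def)
      finally have 1: "\<bar>(a L $ j + x $ i * b L $ j - x $ j) / \<kappa>\<bar> \<le> real N1" .
      have eq: "b L $ j * (x $ i - x' $ i) - (x $ j - x' $ j) =
          (a L $ j + x $ i * b L $ j - x $ j) - (a L $ j + x' $ i * b L $ j - x' $ j)"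
        by (simp add: algebra_simps)
      have "\<bar>b L $ j * (x $ i - x' $ i) - (x $ j - x' $ j)\<bar> \<le> 6 * \<delta>"
        unfolding eq using through(1)[OF LT, of j] through(2)[OF LT, of j] by linarith
      moreover have "b L $ j * (x $ i - x' $ i) - (x $ j - x' $ j) = (b L $ j - \<beta> j) * (x $ i - x' $ i)"
      proof -
        have "\<beta> j * (x $ i - x' $ i) = x $ j - x' $ j" using xx by (simp add: \<beta>_def)
        then show ?thesis by (simp only: left_diff_distrib)
      qed
      ultimately have "\<bar>b L $ j - \<beta> j\<bar> * \<bar>x $ i - x' $ i\<bar> \<le> 6 * \<delta>" by (simp add: abs_mult)
      moreover have "\<bar>b L $ j - \<beta> j\<bar> * (r / 2) \<le> \<bar>b L $ j - \<beta> j\<bar> * \<bar>x $ i - x' $ i\<bar>"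
        by (rule mult_left_mono) (use r in auto)
      ultimately have "\<bar>b L $ j - \<beta> j\<bar> \<le> 12 * \<delta> / r" using r by (simp add: field_simps)
      then have "\<bar>(b L $ j - \<beta> j) / \<kappa>\<bar> \<le> (12 * \<delta> / r) / \<kappa>"
        using k by (simp only: abs_divide abs_of_pos divide_right_mono less_imp_le)
      also have "\<dots> = 48 * CARD('n) / r" using \<delta> by (simp add: \<kappa>_def)
      also have "\<dots> \<le> real N2" unfolding N2_def by linarith
      finally show "g L j \<in> {- int N1..int N1} \<times> {- int N2..int N2}"
        using abs_floor_le[OF 1] abs_floor_le[of _ N2] j by (simp add: g_def)
    qed (simp add: g_def)
  qed (auto intro!: finite_PiE)
  also have "\<dots> = ((2 * N1 + 1) * (2 * N2 + 1)) ^ (CARD('n) - 1)"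
  proof -
    have "card {- int N..int N} = 2 * N + 1" for N by simp
    then show ?thesis by (simp only: card_PiE finite card_cartesian_product prod_constant card_Diff_singleton UNIV_I)
  qed
  finally have "real (card T) \<le> real ((2 * N1 + 1) * (2 * N2 + 1)) ^ (CARD('n) - 1)"
    by (metis of_nat_le_iff of_nat_power)
  also have "\<dots> \<le> (2475 * (real CARD('n))\<^sup>2 / r) ^ (CARD('n) - 1)"
  proof (rule power_mono)
    have d: "1 \<le> real CARD('n)" by simp
    have dr: "real CARD('n) \<le> real CARD('n) / r" using r by (simp add: le_divide_eq mult_left_le)
    have "0 \<le> 48 * CARD('n) / r" using r by simp
    then have "real N2 \<le> 48 * CARD('n) / r + 1" unfolding N2_def by linarith
    then have "2 * real N2 + 1 \<le> 99 * (CARD('n) / r)" using d dr unfolding times_divide_eq_right[symmetric] by linarith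
    moreover have "2 * real N1 + 1 \<le> 25 * CARD('n)" using d by (simp add: N1_def)
    ultimately have "(2 * real N1 + 1) * (2 * real N2 + 1) \<le> (25 * CARD('n)) * (99 * (CARD('n) / r))"
      by (intro mult_mono) auto
    moreover have "real ((2 * N1 + 1) * (2 * N2 + 1)) = (2 * real N1 + 1) * (2 * real N2 + 1)"
      by (simp only: of_nat_mult of_nat_add of_nat_1 of_nat_numeral)
    ultimately show "real ((2 * N1 + 1) * (2 * N2 + 1)) \<le> 2475 * (real CARD('n))\<^sup>2 / r"
      by (simp add: power2_eq_square)
  qed simp
  finally show ?thesis .
qed

section \<open>Counting rich tubes\<close>

text \<open>What an incidence with the atom centred at \<open>x\<close> gives by
  \<open>incident_chart\<close>. In a chart the case \<open>j = i\<close> is void.\<close>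

definition passes :: "'n \<Rightarrow> real ^ 'n \<Rightarrow> real ^ 'n \<Rightarrow> real \<Rightarrow> real ^ 'n \<Rightarrow> bool" where
  "passes i a b \<delta> x \<longleftrightarrow> (\<forall>j. \<bar>a $ j + x $ i * b $ j - x $ j\<bar> \<le> 3 * \<delta>)"

text \<open>Two consecutive layers of height \<open>r\<close>: points whose heights differ by at
  most \<open>r\<close> share a slab, and each point lies in only two slabs.\<close>

definition slab :: "'n \<Rightarrow> real \<Rightarrow> int \<Rightarrow> (real ^ 'n) set" where
  "slab i r m = {x. \<lfloor>x $ i / r\<rfloor> \<in> {m, m + 1}}"

lemma slab_bounds:
  assumes "x \<in> slab i r m" "0 < r"
  shows "of_int m * r \<le> x $ i" "x $ i \<le> of_int m * r + 2 * r"
proof -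
  have "of_int m \<le> x $ i / r" "x $ i / r < of_int m + 2"
    using assms(1) unfolding slab_def by (auto simp: floor_eq_iff)
  then show "of_int m * r \<le> x $ i" "x $ i \<le> of_int m * r + 2 * r"
    using assms(2) by (auto simp: field_simps)
qed

lemma sum_card_fibers:
  assumes "finite T" "finite U"
  shows "(\<Sum>L\<in>T. card {p \<in> U. R L p}) = (\<Sum>p\<in>U. card {L \<in> T. R L p})"
proof -
  have c: "card {x \<in> X. Q x} = (\<Sum>x\<in>X. if Q x then 1 else 0)" if "finite X" for X :: "'x set" and Q
    using that by (simp add: sum.If_cases Int_def)
  have "(\<Sum>L\<in>T. card {p \<in> U. R L p}) = (\<Sum>L\<in>T. \<Sum>p\<in>U. if R L p then 1 else 0)"
    by (simp only: c[OF assms(2)])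
  also have "\<dots> = (\<Sum>p\<in>U. \<Sum>L\<in>T. if R L p then 1 else 0)" by (rule sum.swap)
  finally show ?thesis by (simp only: c[OF assms(1)])
qed

text \<open>Lines are sorted into cells of width \<open>\<delta>'\<close> in position and \<open>\<delta>' / r\<close> in slope, which look like tubes of
  thickness \<open>\<delta>'\<close> inside a slab of height \<open>2 * r\<close>. A cell with \<open>n\<close> points has at most \<open>n\<^sup>2\<close> pairs of points, and two
  points at distance \<open>r\<close> lie on \<open>O(r ^ (1 - d))\<close> distinct tubes; the powers of \<open>r\<close> cancel in the end.\<close>

lemma slab_class_bound:
  fixes T :: "(real ^ 'n::finite) set set" and P :: "(real ^ 'n) set" and \<theta> :: real
  assumes sp: "spaced M \<rho> P" and d: "CARD('n) \<ge> 2" and \<rho>: "\<rho> \<le> 1"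
    and \<delta>: "0 < \<delta>" "\<delta> \<le> \<delta>'" "9 * \<delta>' \<le> \<rho>" and r: "\<rho> \<le> r" "r \<le> 1"
    and P01: "\<And>x. x \<in> P \<Longrightarrow> 0 \<le> x $ i \<and> x $ i \<le> 1"
    and T: "finite T" "\<And>L. L \<in> T \<Longrightarrow> chart i (a L) (b L) L" "\<And>L. L \<in> T \<Longrightarrow> tube_axis L"
      "pairwise (distinct_tubes \<delta>) T"
    and \<theta>: "0 \<le> \<theta>" "2 * (9 * \<delta>' / \<rho>) ^ (CARD('n) - 1) * (3 * real M * 9 ^ (CARD('n) - 1) / \<rho>) \<le> \<theta>"
    and rich: "\<And>L. L \<in> T \<Longrightarrow> \<theta> \<le> card {x \<in> P \<inter> slab i r m. passes i (a L) (b L) \<delta> x}"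
    and pairs: "\<And>L. L \<in> T \<Longrightarrow> \<theta>\<^sup>2 \<le> card {p \<in> (P \<inter> slab i r m) \<times> (P \<inter> slab i r m).
        passes i (a L) (b L) \<delta> (fst p) \<and> passes i (a L) (b L) \<delta> (snd p) \<and> r / 2 \<le> \<bar>fst p $ i - snd p $ i\<bar>}"
  shows "card T * \<theta>\<^sup>2 \<le> (2475 * (real CARD('n))\<^sup>2 / \<delta>') ^ (CARD('n) - 1)
     * (32 * real (CARD('n) - 1) * 3672 ^ (CARD('n) - 1) * M * (3 + 2 * ln (3 / \<rho>)) * card (P \<inter> slab i r m))"
proof -
  define S where "S = P \<inter> slab i r m"
  define \<eta> where "\<eta> = \<delta>' / r"
  have pos: "0 < \<delta>'" "0 < \<rho>" "0 < r" "0 < \<eta>" "\<delta> \<le> 1" using \<delta> r \<rho> by (auto simp: \<eta>_def)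
  have \<eta>1: "\<eta> \<le> 1" using pos \<delta> r by (simp add: \<eta>_def)
  \<comment> \<open>The translation brings the bottom of the slab to height 0. Heights are then at
    most \<open>2 * r\<close>, and a slope error \<open>\<eta> = \<delta>' / r\<close> costs at most
    \<open>2 * \<delta>'\<close>.\<close>
  define v :: "real ^ 'n" where "v = axis i (of_int m * r)"
  have finS: "finite S" using sp by (simp add: S_def spaced_def)
  have spS: "spaced M \<rho> ((\<lambda>x. x - v) ` S)"
    by (rule spaced_translate[OF spaced_subset[OF sp]]) (auto simp: S_def)
  define z where "z L = restrict (\<lambda>j. (\<lfloor>(a L $ j + of_int m * r * b L $ j) / \<delta>'\<rfloor>, \<lfloor>b L $ j / \<eta>\<rfloor>)) (UNIV - {i})" for L
  define N where "N z = {x\<in>S. \<forall>j\<in>UNIV - {i}. \<bar>\<delta>' * of_int (fst (z j)) + (x $ i - of_int m * r) * (\<eta> * of_int (snd (z j))) - x $ j\<bar> \<le> 6 * \<delta>'}" for z :: "'n \<Rightarrow> int \<times> int"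
  \<comment> \<open>The \<open>6 * \<delta>'\<close> in \<open>N\<close> consist of
    \<open>3 * \<delta>'\<close> from \<open>passes\<close>, \<open>\<delta>'\<close> from rounding
    the position and \<open>2 * \<delta>'\<close> from rounding the slope.\<close>
  have N_sub: "{x \<in> S. passes i (a L) (b L) \<delta> x} \<subseteq> N (z L)" for L
    unfolding N_def
  proof (intro subsetI CollectI conjI ballI)
    fix x j assume "x \<in> {x \<in> S. passes i (a L) (b L) \<delta> x}"
    then show "x \<in> S" by simp
  next
    fix x j assume "x \<in> {x \<in> S. passes i (a L) (b L) \<delta> x}" and "j \<in> UNIV - {i}"
    then have x: "x \<in> S" "passes i (a L) (b L) \<delta> x" and j: "j \<noteq> i" by auto
    have sx: "0 \<le> x $ i - of_int m * r" "x $ i - of_int m * r \<le> 2 * r"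
      using slab_bounds[of x i r m] x(1) pos by (auto simp: S_def)
    have 1: "\<bar>a L $ j + of_int m * r * b L $ j - \<delta>' * of_int (fst (z L j))\<bar> \<le> \<delta>'"
    proof -
      have "a L $ j + of_int m * r * b L $ j \<in> {\<delta>' * of_int (fst (z L j))..<\<delta>' * of_int (fst (z L j)) + \<delta>'}"
        using cell_iff[OF pos(1,4), of "(a L $ j + of_int m * r * b L $ j, b L $ j)" "z L j"] j
        by (simp add: z_def cell_def)
      then show ?thesis by auto
    qed
    have 2: "\<bar>b L $ j - \<eta> * of_int (snd (z L j))\<bar> \<le> \<eta>"
    proof -
      have "b L $ j \<in> {\<eta> * of_int (snd (z L j))..<\<eta> * of_int (snd (z L j)) + \<eta>}"
        using cell_iff[OF pos(1,4), of "(a L $ j + of_int m * r * b L $ j, b L $ j)" "z L j"] j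
        by (simp add: z_def cell_def)
      then show ?thesis by auto
    qed
    have "\<bar>(x $ i - of_int m * r) * (b L $ j - \<eta> * of_int (snd (z L j)))\<bar> \<le> (2 * r) * \<eta>"
      unfolding abs_mult by (rule mult_mono) (use sx 2 pos in auto)
    also have "(2 * r) * \<eta> = 2 * \<delta>'" using pos by (simp add: \<eta>_def)
    finally have 3: "\<bar>(x $ i - of_int m * r) * (b L $ j - \<eta> * of_int (snd (z L j)))\<bar> \<le> 2 * \<delta>'" .
    have 4: "\<bar>a L $ j + x $ i * b L $ j - x $ j\<bar> \<le> 3 * \<delta>'"
      using x(2) \<delta>(2) unfolding passes_def by (meson mult_left_mono order_trans zero_le_numeral)
    have "\<delta>' * of_int (fst (z L j)) + (x $ i - of_int m * r) * (\<eta> * of_int (snd (z L j))) - x $ j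
       = (a L $ j + x $ i * b L $ j - x $ j) - (a L $ j + of_int m * r * b L $ j - \<delta>' * of_int (fst (z L j)))
         - (x $ i - of_int m * r) * (b L $ j - \<eta> * of_int (snd (z L j)))"
      by (simp add: algebra_simps)
    then show "\<bar>\<delta>' * of_int (fst (z L j)) + (x $ i - of_int m * r) * (\<eta> * of_int (snd (z L j))) - x $ j\<bar> \<le> 6 * \<delta>'"
      using 1 3 4 by linarith
  qed
  have finN: "finite (N w)" for w using finS by (simp add: N_def)
  define n where "n w = real (card (N w))" for w
  define D where "D = (2475 * (real CARD('n))\<^sup>2 / r) ^ (CARD('n) - 1)"
  define B where "B = 32 * real (CARD('n) - 1) * 3672 ^ (CARD('n) - 1) * M * (3 + 2 * ln (3 / \<rho>)) * card S"
  have cells: "(\<Sum>w\<in>z ` T. (n w)\<^sup>2) * \<eta> ^ (CARD('n) - 1) \<le> B"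
  proof -
    have inj: "inj_on (\<lambda>x. x - v) S" by (auto simp: inj_on_def)
    have cardv: "card ((\<lambda>x. x - v) ` S) = card S" by (rule card_image[OF inj])
    have "(\<Sum>w\<in>z ` T. (n w)\<^sup>2) * \<eta> ^ (CARD('n) - 1)
       \<le> 32 * real (CARD('n) - 1) * 3672 ^ (CARD('n) - 1) * M * (3 + 2 * ln (3 / \<rho>)) * card ((\<lambda>x. x - v) ` S)"
    proof (rule cells_bound[OF spS d \<rho> pos(1) \<delta>(3) pos(4), where i = i and n = n])
      fix x assume "x \<in> (\<lambda>x. x - v) ` S"
      then obtain y where y: "y \<in> S" "x = y - v" by blast
      have "0 \<le> x $ i" "x $ i \<le> 2 * r"
        using slab_bounds[of y i r m] y pos by (auto simp: S_def v_def)
      moreover have "x $ i * \<eta> \<le> (2 * r) * \<eta>" using calculation pos by (intro mult_right_mono) auto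
      moreover have "(2 * r) * \<eta> = 2 * \<delta>'" using pos by (simp add: \<eta>_def)
      ultimately show "0 \<le> x $ i \<and> x $ i \<le> 2 \<and> x $ i * \<eta> \<le> 2 * \<delta>'" using r by simp
    next
      fix w j assume "w \<in> z ` T" and j: "j \<noteq> i"
      then obtain L where L: "L \<in> T" "w = z L" by blast
      have "b L $ j \<in> {\<eta> * of_int (snd (w j))..<\<eta> * of_int (snd (w j)) + \<eta>}"
        using cell_iff[OF pos(1,4), of "(a L $ j + of_int m * r * b L $ j, b L $ j)" "z L j"] j L
        by (simp add: z_def cell_def)
      moreover have "\<bar>b L $ j\<bar> \<le> 1" using T(2)[OF L(1)] by (simp add: chart_def)
      ultimately show "- 2 \<le> \<eta> * of_int (snd (w j)) \<and> \<eta> * of_int (snd (w j)) + \<eta> \<le> 2"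
        using \<eta>1 by auto
    next
      fix w :: "'n \<Rightarrow> int \<times> int"
      have "{x \<in> (\<lambda>x. x - v) ` S. \<forall>j\<in>UNIV - {i}. \<bar>\<delta>' * of_int (fst (w j)) + x $ i * (\<eta> * of_int (snd (w j))) - x $ j\<bar> \<le> 6 * \<delta>'}
        = (\<lambda>x. x - v) ` N w"
      proof -
        have "v $ i = of_int m * r" "\<And>j. j \<in> UNIV - {i} \<Longrightarrow> v $ j = 0" by (auto simp: v_def axis_def)
        then have "(\<forall>j\<in>UNIV - {i}. \<bar>\<delta>' * of_int (fst (w j)) + (y - v) $ i * (\<eta> * of_int (snd (w j))) - (y - v) $ j\<bar> \<le> 6 * \<delta>') \<longleftrightarrow>
          (\<forall>j\<in>UNIV - {i}. \<bar>\<delta>' * of_int (fst (w j)) + (y $ i - of_int m * r) * (\<eta> * of_int (snd (w j))) - y $ j\<bar> \<le> 6 * \<delta>')" for y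
          by (intro ball_cong refl) simp
        then show ?thesis unfolding N_def by blast
      qed
      then show "n w = real (card {x \<in> (\<lambda>x. x - v) ` S. \<forall>j\<in>UNIV - {i}. \<bar>\<delta>' * of_int (fst (w j)) + x $ i * (\<eta> * of_int (snd (w j))) - x $ j\<bar> \<le> 6 * \<delta>'})"
        using card_image[OF inj_on_subset[OF inj], of "N w"] by (simp add: n_def N_def)
    next
      fix w assume "w \<in> z ` T"
      then obtain L where L: "L \<in> T" "w = z L" by blast
      have "\<theta> \<le> card {x \<in> S. passes i (a L) (b L) \<delta> x}" using rich[OF L(1)] by (simp add: S_def)
      also have "\<dots> \<le> n w" unfolding n_def L(2) of_nat_le_iff by (rule card_mono[OF finN N_sub])
      finally show "2 * (9 * \<delta>' / \<rho>) ^ (CARD('n) - 1) * (3 * real M * 9 ^ (CARD('n) - 1) / \<rho>) \<le> n w"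
        using \<theta> by linarith
    qed (use T in \<open>auto simp: z_def\<close>)
    then show ?thesis by (simp add: B_def cardv)
  qed
  define far where "far L p \<longleftrightarrow> passes i (a L) (b L) \<delta> (fst p) \<and> passes i (a L) (b L) \<delta> (snd p) \<and> r / 2 \<le> \<bar>fst p $ i - snd p $ i\<bar>" for L p
  \<comment> \<open>The points of the slab on a tube of the cell \<open>w\<close> belong to
    \<open>N w\<close>. The sum over tubes thus becomes a sum over pairs in \<open>N w\<close>, and
    \<open>card_tubes_through_two_points\<close> bounds the tubes for each pair.\<close>
  have in_cell: "(\<Sum>L\<in>{L\<in>T. z L = w}. real (card {p \<in> S \<times> S. far L p})) \<le> D * (n w)\<^sup>2" for w
  proof -
    define Tw where "Tw = {L\<in>T. z L = w}"
    have Tw: "finite Tw" "Tw \<subseteq> T" using T(1) by (auto simp: Tw_def)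
    have "card {p \<in> S \<times> S. far L p} = card {p \<in> N w \<times> N w. far L p}" if "L \<in> Tw" for L
    proof (rule arg_cong[where f = card])
      show "{p \<in> S \<times> S. far L p} = {p \<in> N w \<times> N w. far L p}"
        using N_sub[of L] that unfolding Tw_def far_def by (auto simp: N_def)
    qed
    then have "(\<Sum>L\<in>Tw. card {p \<in> S \<times> S. far L p}) = (\<Sum>L\<in>Tw. card {p \<in> N w \<times> N w. far L p})" by simp
    also have "\<dots> = (\<Sum>p\<in>N w \<times> N w. card {L \<in> Tw. far L p})"
      using Tw finN by (intro sum_card_fibers) auto
    finally have eq: "(\<Sum>L\<in>Tw. card {p \<in> S \<times> S. far L p}) = (\<Sum>p\<in>N w \<times> N w. card {L \<in> Tw. far L p})" .
    have "(\<Sum>p\<in>N w \<times> N w. real (card {L \<in> Tw. far L p})) \<le> real (card (N w \<times> N w)) * D"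
    proof (rule sum_bounded_above)
      fix p assume p: "p \<in> N w \<times> N w"
      show "real (card {L \<in> Tw. far L p}) \<le> D"
      proof (cases "r / 2 \<le> \<bar>fst p $ i - snd p $ i\<bar>")
        case False
        then have "{L \<in> Tw. far L p} = {}" by (auto simp: far_def)
        then have "card {L \<in> Tw. far L p} = 0" by (simp only: card.empty)
        then show ?thesis using pos by (simp add: D_def)
      next
        case True
        have "fst p \<in> P" using p by (auto simp: N_def S_def)
        show ?thesis unfolding D_def
        proof (rule card_tubes_through_two_points[where i = i and \<delta> = \<delta> and a = a and b = b and x = "fst p" and x' = "snd p"])
          show "pairwise (distinct_tubes \<delta>) {L \<in> Tw. far L p}"
            by (rule pairwise_subset[OF T(4)]) (use Tw in auto)
        qed (use Tw T(2,3) \<delta> pos r True P01[OF \<open>fst p \<in> P\<close>] in \<open>auto simp: far_def passes_def\<close>)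
      qed
    qed
    also have "\<dots> = D * (n w)\<^sup>2" by (simp add: card_cartesian_product n_def power2_eq_square)
    finally show ?thesis using eq unfolding Tw_def by (simp flip: of_nat_sum)
  qed
  have "card T * \<theta>\<^sup>2 = (\<Sum>L\<in>T. \<theta>\<^sup>2)" by simp
  also have "\<dots> \<le> (\<Sum>L\<in>T. real (card {p \<in> S \<times> S. far L p}))"
    by (rule sum_mono) (use pairs in \<open>simp add: S_def far_def\<close>)
  also have "\<dots> = (\<Sum>w\<in>z ` T. \<Sum>L\<in>{L\<in>T. z L = w}. real (card {p \<in> S \<times> S. far L p}))"
    by (rule sum.group[symmetric]) (use T in auto)
  also have "\<dots> \<le> (\<Sum>w\<in>z ` T. D * (n w)\<^sup>2)" by (rule sum_mono[OF in_cell])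
  also have "\<dots> = D * (\<Sum>w\<in>z ` T. (n w)\<^sup>2)" by (simp add: sum_distrib_left)
  also have "\<dots> \<le> D * (B / \<eta> ^ (CARD('n) - 1))"
    by (rule mult_left_mono) (use cells pos in \<open>auto simp: D_def pos_le_divide_eq\<close>)
  also have "\<dots> = (2475 * (real CARD('n))\<^sup>2 / \<delta>') ^ (CARD('n) - 1) * B"
  proof -
    have "D / \<eta> ^ (CARD('n) - 1) = (2475 * (real CARD('n))\<^sup>2 / \<delta>') ^ (CARD('n) - 1)"
      using pos by (simp add: D_def \<eta>_def flip: power_divide)
    then show ?thesis by (metis times_divide_eq_left times_divide_eq_right)
  qed
  finally show ?thesis by (simp only: B_def S_def)
qed

section \<open>Choice of a scale and a slab for each tube\<close>

lemma dyadic_scale: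
  assumes "(1 / 2) ^ J \<le> t" "t \<le> (1::real)" "1 \<le> J"
  shows "\<exists>j<J. (1 / 2) ^ j / 2 \<le> t \<and> t \<le> (1 / 2) ^ j"
  using assms(3,1)
proof (induction J rule: dec_induct)
  case base then show ?case using assms(2) by (intro exI[of _ 0]) auto
next
  case (step J)
  show ?case
  proof (cases "(1 / 2) ^ J \<le> t")
    case True
    then obtain j where "j < J" "(1 / 2) ^ j / 2 \<le> t \<and> t \<le> (1 / 2) ^ j" using step by blast
    then show ?thesis by (intro exI[of _ j]) auto
  next
    case False then show ?thesis using step by (intro exI[of _ J]) auto
  qed
qed

lemma card_slabs_le:
  assumes "finite X"
  shows "(\<Sum>m\<in>(\<lambda>x. \<lfloor>x $ i / r\<rfloor>) ` X. card (X \<inter> slab i r m)) \<le> 2 * card X"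
proof -
  define Ms where "Ms = (\<lambda>x. \<lfloor>x $ i / r\<rfloor>) ` X"
  have fin: "finite Ms" using assms by (simp add: Ms_def)
  have "(\<Sum>m\<in>Ms. card {x \<in> X. x \<in> slab i r m}) = (\<Sum>x\<in>X. card {m \<in> Ms. x \<in> slab i r m})"
    by (rule sum_card_fibers[OF fin assms])
  also have "\<dots> \<le> (\<Sum>x\<in>X. 2)"
  proof (rule sum_mono)
    fix x
    have "{m \<in> Ms. x \<in> slab i r m} \<subseteq> {\<lfloor>x $ i / r\<rfloor>, \<lfloor>x $ i / r\<rfloor> - 1}" by (auto simp: slab_def)
    then have "card {m \<in> Ms. x \<in> slab i r m} \<le> card {\<lfloor>x $ i / r\<rfloor>, \<lfloor>x $ i / r\<rfloor> - 1}"
      by (rule card_mono[rotated]) simp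
    also have "\<dots> \<le> 2" by (simp add: card_insert_if)
    finally show "card {m \<in> Ms. x \<in> slab i r m} \<le> 2" .
  qed
  finally show ?thesis by (simp add: Ms_def Int_def mult.commute)
qed

text \<open>A rich tube may have most of its points in a short segment, so a scale and a slab are chosen for each tube
  such that many pairs of its points in the slab are at distance comparable to its height.\<close>

lemma rich_slab_exists:
  fixes X :: "(real ^ 'n) set"
  assumes X: "finite X" "X \<noteq> {}" "\<And>x. x \<in> X \<Longrightarrow> 0 \<le> x $ i \<and> x $ i \<le> 1"
    and \<rho>: "0 < \<rho>" "(1 / 2) ^ J \<le> \<rho>" "1 \<le> J" and c: "0 < c"
    and far: "c * (real (card X))\<^sup>2 \<le> card {p \<in> X \<times> X. \<rho> \<le> \<bar>fst p $ i - snd p $ i\<bar>}"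
  shows "\<exists>j<J. \<exists>m\<in>(\<lambda>x. \<lfloor>x $ i / (1 / 2) ^ j\<rfloor>) ` X. \<rho> \<le> (1 / 2) ^ j \<and>
      c * card X / (2 * J) \<le> card (X \<inter> slab i ((1 / 2) ^ j) m) \<and>
      (c * card X / (2 * J))\<^sup>2 \<le> card {p \<in> (X \<inter> slab i ((1 / 2) ^ j) m) \<times> (X \<inter> slab i ((1 / 2) ^ j) m).
         (1 / 2) ^ j / 2 \<le> \<bar>fst p $ i - snd p $ i\<bar>}"
proof -
  define n where "n = card X"
  have n: "0 < n" using X by (simp add: n_def card_gt_0_iff)
  define t where "t p = \<bar>fst p $ i - snd p $ i\<bar>" for p :: "(real ^ 'n) \<times> (real ^ 'n)"
  define F where "F = {p \<in> X \<times> X. \<rho> \<le> t p}"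
  \<comment> \<open>The condition \<open>\<rho> \<le> t p\<close> is kept so that a non-empty
    \<open>G j\<close> certifies \<open>\<rho> \<le> (1 / 2) ^ j\<close>.\<close>
  define G where "G j = {p \<in> X \<times> X. \<rho> \<le> t p \<and> (1 / 2) ^ j / 2 \<le> t p \<and> t p \<le> (1 / 2) ^ j}" for j :: nat
  have finG: "finite (G j)" for j using X by (simp add: G_def)
  have J: "0 < real J" using \<rho> by simp
  have "F \<subseteq> (\<Union>j\<in>{..<J}. G j)"
  proof
    fix p assume p: "p \<in> F"
    then have "(1 / 2) ^ J \<le> t p" "t p \<le> 1" using \<rho> X(3)[of "fst p"] X(3)[of "snd p"] by (auto simp: F_def t_def)
    from dyadic_scale[OF this \<rho>(3)] show "p \<in> (\<Union>j\<in>{..<J}. G j)" using p by (auto simp: F_def G_def)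
  qed
  then have "card F \<le> card (\<Union>j\<in>{..<J}. G j)" by (intro card_mono) (auto simp: finG)
  also have "\<dots> \<le> (\<Sum>j<J. card (G j))" by (rule card_UN_le) simp
  finally have sumG: "c * (real n)\<^sup>2 \<le> (\<Sum>j<J. real (card (G j)))"
    using far by (simp add: F_def t_def n_def flip: of_nat_sum)
  have "\<exists>j<J. c * (real n)\<^sup>2 / J \<le> card (G j)"
  proof (rule ccontr)
    assume "\<not> ?thesis"
    then have "(\<Sum>j<J. real (card (G j))) < (\<Sum>j<J. c * (real n)\<^sup>2 / J)"
      using \<rho>(3) by (intro sum_strict_mono) (auto simp: not_le lessThan_empty_iff)
    also have "\<dots> = c * (real n)\<^sup>2" using J by simp
    finally show False using sumG by simp
  qed
  then obtain j where j: "j < J" "c * (real n)\<^sup>2 / J \<le> card (G j)" by blast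
  define r where "r = (1 / 2 :: real) ^ j"
  have r: "0 < r" by (simp add: r_def)
  have "0 < c * (real n)\<^sup>2 / J" using c n J by simp
  then have "0 < card (G j)" using j by linarith
  then obtain p0 where p0: "p0 \<in> G j" by (auto simp: card_gt_0_iff)
  then have \<rho>r: "\<rho> \<le> r" by (auto simp: G_def r_def)
  define Ms where "Ms = (\<lambda>x. \<lfloor>x $ i / r\<rfloor>) ` X"
  have Ms: "finite Ms" "Ms \<noteq> {}" using X by (auto simp: Ms_def)
  define H where "H m = {p \<in> (X \<inter> slab i r m) \<times> (X \<inter> slab i r m). r / 2 \<le> t p}" for m
  have finH: "finite (H m)" for m using X by (simp add: H_def)
  have "G j \<subseteq> (\<Union>m\<in>Ms. H m)"
  proof
    fix p assume p: "p \<in> G j"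
    have floors: "\<lfloor>x' $ i / r\<rfloor> = \<lfloor>x $ i / r\<rfloor> \<or> \<lfloor>x' $ i / r\<rfloor> = \<lfloor>x $ i / r\<rfloor> + 1"
      if "x $ i \<le> x' $ i" "x' $ i - x $ i \<le> r" for x x' :: "real ^ 'n"
    proof -
      have "x $ i / r \<le> x' $ i / r" "x' $ i / r \<le> x $ i / r + 1"
        using that r by (auto simp: field_simps)
      then have "\<lfloor>x $ i / r\<rfloor> \<le> \<lfloor>x' $ i / r\<rfloor>" "\<lfloor>x' $ i / r\<rfloor> \<le> \<lfloor>x $ i / r\<rfloor> + 1" by linarith+
      then show ?thesis by linarith
    qed
    show "p \<in> (\<Union>m\<in>Ms. H m)"
    proof (cases "fst p $ i \<le> snd p $ i")
      case True
      then have "p \<in> H \<lfloor>fst p $ i / r\<rfloor>"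
        using p floors[OF True] by (auto simp: G_def H_def r_def[symmetric] slab_def t_def)
      then show ?thesis using p by (auto simp: G_def Ms_def)
    next
      case False
      then have "p \<in> H \<lfloor>snd p $ i / r\<rfloor>"
        using p floors[of "snd p" "fst p"] by (auto simp: G_def H_def r_def[symmetric] slab_def t_def)
      then show ?thesis using p by (auto simp: G_def Ms_def)
    qed
  qed
  then have "card (G j) \<le> card (\<Union>m\<in>Ms. H m)" by (intro card_mono) (auto simp: finH Ms)
  also have "\<dots> \<le> (\<Sum>m\<in>Ms. card (H m))" by (rule card_UN_le[OF Ms(1)])
  finally have sumH: "c * (real n)\<^sup>2 / J \<le> (\<Sum>m\<in>Ms. real (card (H m)))"
    using j(2) by (simp flip: of_nat_sum)
  define \<theta> where "\<theta> = c * n / (2 * J)"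
  have \<theta>: "0 < \<theta>" using c n J by (simp add: \<theta>_def)
  \<comment> \<open>The average is weighted by the points in the slabs, which add up to at most
    \<open>2 * n\<close>. Averaging over the slabs alone would lose a factor equal to their
    number.\<close>
  have "\<exists>m\<in>Ms. \<theta> * card (X \<inter> slab i r m) \<le> card (H m)"
  proof (rule ccontr)
    assume "\<not> ?thesis"
    then have "(\<Sum>m\<in>Ms. real (card (H m))) < (\<Sum>m\<in>Ms. \<theta> * card (X \<inter> slab i r m))"
      using Ms by (intro sum_strict_mono) (auto simp: not_le)
    also have "\<dots> = \<theta> * real (\<Sum>m\<in>Ms. card (X \<inter> slab i r m))" by (simp add: sum_distrib_left)
    also have "\<dots> \<le> \<theta> * real (2 * n)"
      using card_slabs_le[OF X(1), of i r] \<theta> by (intro mult_left_mono) (simp_all add: Ms_def n_def flip: of_nat_sum)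
    also have "\<dots> = c * (real n)\<^sup>2 / J" using J by (simp add: \<theta>_def power2_eq_square)
    finally show False using sumH by simp
  qed
  then obtain m where m: "m \<in> Ms" "\<theta> * card (X \<inter> slab i r m) \<le> card (H m)" by blast
  define N where "N = card (X \<inter> slab i r m)"
  have N: "0 < N"
    using m(1) X(1) by (auto simp: N_def Ms_def card_gt_0_iff slab_def)
  have "card (H m) \<le> card ((X \<inter> slab i r m) \<times> (X \<inter> slab i r m))"
    by (rule card_mono) (use X in \<open>auto simp: H_def\<close>)
  also have "\<dots> = N * N" by (simp add: card_cartesian_product N_def)
  finally have "real (card (H m)) \<le> real N * real N" by (metis of_nat_le_iff of_nat_mult)
  \<comment> \<open>One inequality yields both demands: it gives \<open>\<theta> \<le> N\<close>,
    hence \<open>\<theta>\<^sup>2 \<le> \<theta> * N\<close>, which by \<open>m(2)\<close> is at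
    most the number of pairs.\<close>
  then have "\<theta> * real N \<le> real N * real N" using m(2) by (simp add: N_def)
  then have \<theta>N: "\<theta> \<le> real N" using N by simp
  then have "\<theta>\<^sup>2 \<le> \<theta> * real N" using \<theta> by (simp add: power2_eq_square)
  then have "\<theta>\<^sup>2 \<le> card (H m)" using m(2) by (simp add: N_def)
  then show ?thesis
    using j(1) m(1) \<theta>N \<rho>r
    by (intro exI[of _ j] conjI bexI[of _ m]) (simp_all add: \<theta>_def n_def N_def H_def r_def t_def Ms_def)
qed

text \<open>Each tube is charged to its chart index, a scale and a slab. As
  \<open>slab_class_bound\<close> is linear in the number of points of the slab and a point lies in
  at most two slabs, all slabs of one scale together cost \<open>2 * card P\<close>, whatever their
  number. The \<open>d\<close> indices and the \<open>J\<close> scales remain as factors.\<close>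

lemma tubes_bound:
  fixes T :: "(real ^ 'n::finite) set set" and P :: "(real ^ 'n) set" and c :: real and k J :: nat
  assumes sp: "spaced M \<rho> P" and d: "CARD('n) \<ge> 2" and \<rho>: "0 < \<rho>" "\<rho> \<le> 1"
    and \<delta>: "0 < \<delta>" "\<delta> \<le> \<delta>'" "9 * \<delta>' \<le> \<rho>" and J: "(1 / 2) ^ J \<le> \<rho>" "1 \<le> J"
    and P01: "\<And>x i. x \<in> P \<Longrightarrow> 0 \<le> x $ i \<and> x $ i \<le> 1"
    and T: "finite T" "\<And>L. L \<in> T \<Longrightarrow> chart (f L) (a L) (b L) L" "\<And>L. L \<in> T \<Longrightarrow> tube_axis L"
      "pairwise (distinct_tubes \<delta>) T"
    and c: "0 < c" and k: "0 < k"
    and \<theta>: "2 * (9 * \<delta>' / \<rho>) ^ (CARD('n) - 1) * (3 * real M * 9 ^ (CARD('n) - 1) / \<rho>) \<le> c * k / (2 * J)"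
    and rich: "\<And>L. L \<in> T \<Longrightarrow> k \<le> card {x \<in> P. passes (f L) (a L) (b L) \<delta> x}"
    and far: "\<And>L X. L \<in> T \<Longrightarrow> X = {x \<in> P. passes (f L) (a L) (b L) \<delta> x} \<Longrightarrow>
       c * (real (card X))\<^sup>2 \<le> card {p \<in> X \<times> X. \<rho> \<le> \<bar>fst p $ f L - snd p $ f L\<bar>}"
  shows "card T * (c * k / (2 * J))\<^sup>2 \<le> CARD('n) * J * 2 * card P * ((2475 * (real CARD('n))\<^sup>2 / \<delta>') ^ (CARD('n) - 1)
     * (32 * real (CARD('n) - 1) * 3672 ^ (CARD('n) - 1) * M * (3 + 2 * ln (3 / \<rho>))))"
proof -
  define \<theta> where "\<theta> = c * k / (2 * J)"
  have Jpos: "0 < real J" using J by simp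
  have \<theta>0: "0 < \<theta>" using c k Jpos by (simp add: \<theta>_def)
  define E where "E = (2475 * (real CARD('n))\<^sup>2 / \<delta>') ^ (CARD('n) - 1)
     * (32 * real (CARD('n) - 1) * 3672 ^ (CARD('n) - 1) * M * (3 + 2 * ln (3 / \<rho>)))"
  have finP: "finite P" using sp by (simp add: spaced_def)
  have E0: "0 \<le> E"
  proof -
    have "0 \<le> ln (3 / \<rho>)" using \<rho> by simp
    then show ?thesis using \<delta> by (simp add: E_def)
  qed
  define R where "R L = {x \<in> P. passes (f L) (a L) (b L) \<delta> x}" for L
  define Ms where "Ms i j = (\<lambda>x. \<lfloor>x $ i / (1 / 2) ^ j\<rfloor>) ` P" for i and j :: nat
  define good where "good L i j m \<longleftrightarrow> f L = i \<and> \<rho> \<le> (1 / 2) ^ j \<and> \<theta> \<le> card (R L \<inter> slab i ((1 / 2) ^ j) m) \<and>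
     \<theta>\<^sup>2 \<le> card {p \<in> (R L \<inter> slab i ((1 / 2) ^ j) m) \<times> (R L \<inter> slab i ((1 / 2) ^ j) m).
         (1 / 2) ^ j / 2 \<le> \<bar>fst p $ i - snd p $ i\<bar>}" for L i and j :: nat and m
  have ex: "\<exists>j<J. \<exists>m\<in>Ms (f L) j. good L (f L) j m" if L: "L \<in> T" for L
  proof -
    have fin: "finite (R L)" "R L \<subseteq> P" using finP by (auto simp: R_def)
    have kR: "k \<le> card (R L)" using rich[OF L] by (simp add: R_def)
    then have ne: "R L \<noteq> {}" using k by auto
    have "0 \<le> x $ f L \<and> x $ f L \<le> 1" if "x \<in> R L" for x using P01 that by (auto simp: R_def)
    from rich_slab_exists[OF fin(1) ne this \<rho>(1) J c far[OF L R_def]]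
    obtain j m where jm: "j < J" "m \<in> (\<lambda>x. \<lfloor>x $ f L / (1 / 2) ^ j\<rfloor>) ` R L" "\<rho> \<le> (1 / 2) ^ j"
      "c * card (R L) / (2 * J) \<le> card (R L \<inter> slab (f L) ((1 / 2) ^ j) m)"
      "(c * card (R L) / (2 * J))\<^sup>2 \<le> card {p \<in> (R L \<inter> slab (f L) ((1 / 2) ^ j) m) \<times> (R L \<inter> slab (f L) ((1 / 2) ^ j) m).
         (1 / 2) ^ j / 2 \<le> \<bar>fst p $ f L - snd p $ f L\<bar>}"
      by blast
    have le: "\<theta> \<le> c * card (R L) / (2 * J)"
      unfolding \<theta>_def using kR c Jpos by (intro divide_right_mono mult_left_mono) auto
    then have "\<theta>\<^sup>2 \<le> (c * card (R L) / (2 * J))\<^sup>2" using \<theta>0 by (intro power_mono) auto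
    then have "good L (f L) j m" unfolding good_def
      by (intro conjI refl jm(3) order_trans[OF le jm(4)] order_trans[OF _ jm(5)])
    moreover have "m \<in> Ms (f L) j" using jm(2) fin(2) by (auto simp: Ms_def)
    ultimately show ?thesis using jm(1) by blast
  qed
  define U where "U = {(i, j, m) | i j m. i \<in> UNIV \<and> j < J \<and> m \<in> Ms i j}"
  have U: "U = Sigma UNIV (\<lambda>i. Sigma {..<J} (Ms i))" by (auto simp: U_def)
  have finMs: "finite (Ms i j)" for i j using finP by (simp add: Ms_def)
  define cls where "cls = (\<lambda>(i, j, m). {L \<in> T. good L i j m})"
  have "T \<subseteq> (\<Union>q\<in>U. cls q)"
  proof
    fix L assume "L \<in> T"
    with ex[OF this] obtain j m where "j < J" "m \<in> Ms (f L) j" "good L (f L) j m" by blast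
    then show "L \<in> (\<Union>q\<in>U. cls q)" using \<open>L \<in> T\<close> by (intro UN_I[of "(f L, j, m)"]) (auto simp: U_def cls_def)
  qed
  moreover have finU: "finite U" unfolding U using finMs by auto
  ultimately have "card T \<le> card (\<Union>q\<in>U. cls q)" by (intro card_mono) (auto simp: cls_def T(1))
  also have "\<dots> \<le> (\<Sum>q\<in>U. card (cls q))" by (rule card_UN_le[OF finU])
  finally have "card T * \<theta>\<^sup>2 \<le> (\<Sum>q\<in>U. real (card (cls q))) * \<theta>\<^sup>2"
    by (intro mult_right_mono) (simp_all flip: of_nat_sum)
  also have "\<dots> = (\<Sum>q\<in>U. card (cls q) * \<theta>\<^sup>2)" by (simp add: sum_distrib_right)
  also have "\<dots> \<le> (\<Sum>(i, j, m)\<in>U. E * card (P \<inter> slab i ((1 / 2) ^ j) m))"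
  proof (rule sum_mono, clarify)
    fix i and j :: nat and m assume "(i, j, m) \<in> U"
    define r :: real where "r = (1 / 2) ^ j"
    define Tc where "Tc = cls (i, j, m)"
    show "card (cls (i, j, m)) * \<theta>\<^sup>2 \<le> E * card (P \<inter> slab i ((1 / 2) ^ j) m)"
    proof (cases "Tc = {}")
      case True then show ?thesis using E0 by (simp add: Tc_def)
    next
      case False
      have sub: "Tc \<subseteq> T" by (auto simp: Tc_def cls_def)
      have r: "\<rho> \<le> r" using False by (auto simp: Tc_def cls_def good_def r_def)
      have r1: "r \<le> 1" by (simp add: r_def power_le_one)
      have RS: "R L \<inter> slab i r m = {x \<in> P \<inter> slab i r m. passes i (a L) (b L) \<delta> x}" if "L \<in> Tc" for L
        using that by (auto simp: R_def Tc_def cls_def good_def)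
      have "card Tc * \<theta>\<^sup>2 \<le> (2475 * (real CARD('n))\<^sup>2 / \<delta>') ^ (CARD('n) - 1)
         * (32 * real (CARD('n) - 1) * 3672 ^ (CARD('n) - 1) * M * (3 + 2 * ln (3 / \<rho>)) * card (P \<inter> slab i r m))"
      proof (rule slab_class_bound[where a = a and b = b, OF sp d \<rho>(2) \<delta> r r1])
        show "finite Tc" using T(1) sub finite_subset by blast
        show "pairwise (distinct_tubes \<delta>) Tc" using T(4) sub by (rule pairwise_subset)
        fix L assume L: "L \<in> Tc"
        show "chart i (a L) (b L) L" using T(2)[of L] L by (auto simp: Tc_def cls_def good_def)
        show "tube_axis L" using T(3)[of L] sub L by blast
        show "\<theta> \<le> card {x \<in> P \<inter> slab i r m. passes i (a L) (b L) \<delta> x}"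
          using L RS[OF L] by (auto simp: Tc_def cls_def good_def r_def)
        have "{p \<in> (R L \<inter> slab i r m) \<times> (R L \<inter> slab i r m). r / 2 \<le> \<bar>fst p $ i - snd p $ i\<bar>}
          = {p \<in> (P \<inter> slab i r m) \<times> (P \<inter> slab i r m).
             passes i (a L) (b L) \<delta> (fst p) \<and> passes i (a L) (b L) \<delta> (snd p) \<and> r / 2 \<le> \<bar>fst p $ i - snd p $ i\<bar>}"
          unfolding RS[OF L] by auto
        moreover have "\<theta>\<^sup>2 \<le> card {p \<in> (R L \<inter> slab i r m) \<times> (R L \<inter> slab i r m). r / 2 \<le> \<bar>fst p $ i - snd p $ i\<bar>}"
          using L by (auto simp: Tc_def cls_def good_def r_def)
        ultimately show "\<theta>\<^sup>2 \<le> card {p \<in> (P \<inter> slab i r m) \<times> (P \<inter> slab i r m).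
             passes i (a L) (b L) \<delta> (fst p) \<and> passes i (a L) (b L) \<delta> (snd p) \<and> r / 2 \<le> \<bar>fst p $ i - snd p $ i\<bar>}"
          by simp
      qed (use P01 \<theta>0 \<theta> in \<open>auto simp: \<theta>_def\<close>)
      then show ?thesis by (simp add: E_def Tc_def r_def mult.assoc)
    qed
  qed
  also have "\<dots> = (\<Sum>i\<in>UNIV. \<Sum>j<J. \<Sum>m\<in>Ms i j. E * card (P \<inter> slab i ((1 / 2) ^ j) m))"
    unfolding U by (simp add: sum.Sigma finMs)
  also have "\<dots> \<le> (\<Sum>i\<in>(UNIV :: 'n set). \<Sum>j<J. E * (2 * card P))"
  proof (intro sum_mono)
    fix i j
    have "(\<Sum>m\<in>Ms i j. E * card (P \<inter> slab i ((1 / 2) ^ j) m)) = E * real (\<Sum>m\<in>Ms i j. card (P \<inter> slab i ((1 / 2) ^ j) m))"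
      by (simp add: sum_distrib_left)
    also have "\<dots> \<le> E * real (2 * card P)"
      by (rule mult_left_mono[OF _ E0]) (use card_slabs_le[OF finP, of i "(1 / 2) ^ j"] in \<open>simp only: Ms_def of_nat_le_iff\<close>)
    finally show "(\<Sum>m\<in>Ms i j. E * card (P \<inter> slab i ((1 / 2) ^ j) m)) \<le> E * (2 * card P)" by simp
  qed
  also have "\<dots> = CARD('n) * J * 2 * card P * E" by simp
  finally show ?thesis by (simp only: \<theta>_def E_def)
qed

section \<open>Logarithms against powers of \<open>\<delta>\<close>\<close>

lemma log_power_bound:
  fixes \<epsilon> B :: real and p :: nat
  assumes "\<epsilon> > 0" "B \<ge> 1" "p > 0"
  shows "\<exists>C>0. \<forall>\<delta>. 0 < \<delta> \<longrightarrow> \<delta> < 1 \<longrightarrow> (3 + 2 * ln (B / \<delta>)) ^ p \<le> C * \<delta> powr (- \<epsilon>)"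
proof -
  \<comment> \<open>Each of the \<open>p\<close> factors may cost the power
    \<open>\<delta> powr (- \<epsilon> / p)\<close>.\<close>
  define s where "s = \<epsilon> / p"
  have s: "0 < s" using assms by (simp add: s_def)
  define C where "C = 3 + 2 * (B powr s / s)"
  have C: "0 < C" using s by (simp add: C_def add_pos_nonneg)
  have "(3 + 2 * ln (B / \<delta>)) ^ p \<le> C ^ p * \<delta> powr (- \<epsilon>)" if \<delta>: "0 < \<delta>" "\<delta> < 1" for \<delta>
  proof -
    have B1: "1 \<le> B / \<delta>" using assms \<delta> by simp
    have "ln (B / \<delta>) \<le> (B / \<delta>) powr s / s" by (rule ln_powr_bound[OF B1 s])
    also have "(B / \<delta>) powr s = B powr s * \<delta> powr (- s)"
      using \<delta> assms by (simp add: powr_divide powr_minus_divide)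
    finally have "ln (B / \<delta>) \<le> B powr s / s * \<delta> powr (- s)" by simp
    moreover have "1 \<le> \<delta> powr (- s)"
      using powr_mono'[of "-s" 0 \<delta>] s \<delta> by simp
    ultimately have "3 + 2 * ln (B / \<delta>) \<le> C * \<delta> powr (- s)"
      by (simp add: C_def distrib_right)
    moreover have "0 \<le> ln (B / \<delta>)" using B1 by simp
    ultimately have "(3 + 2 * ln (B / \<delta>)) ^ p \<le> (C * \<delta> powr (- s)) ^ p" by (intro power_mono) auto
    also have "\<dots> = C ^ p * \<delta> powr (- \<epsilon>)"
      using assms \<delta> by (simp add: power_mult_distrib s_def powr_powr flip: powr_realpow)
    finally show ?thesis .
  qed
  then show ?thesis using C by (intro exI[of _ "C ^ p"]) auto
qed

text \<open>\<open>J\<close> is majorized by the very expression in which \<open>gram_sum\<close>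
  states its logarithm, so one quantity controls all losses.\<close>

lemma dyadic_exponent:
  assumes "0 < \<rho>" "\<rho> \<le> (1::real)"
  shows "\<exists>J::nat. 1 \<le> J \<and> (1 / 2) ^ J \<le> \<rho> \<and> real J \<le> 3 + 2 * ln (3 / \<rho>)"
proof -
  define y where "y = log 2 (1 / \<rho>)"
  define J where "J = nat \<lceil>y\<rceil> + 1"
  have y0: "0 \<le> y" using assms by (simp add: y_def)
  have "1 / \<rho> = 2 powr y" using assms by (simp add: y_def)
  also have "\<dots> \<le> 2 powr (real J)" by (intro powr_mono) (auto simp: J_def, linarith)
  finally have "1 / \<rho> \<le> 2 ^ J" by (simp add: powr_realpow)
  then have "(1 / 2) ^ J \<le> \<rho>" using assms by (simp add: field_simps power_divide)
  moreover have "real J \<le> 3 + 2 * ln (3 / \<rho>)"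
  proof -
    have "y = ln (1 / \<rho>) / ln 2" by (simp add: y_def log_def)
    also have "\<dots> \<le> ln (1 / \<rho>) / (1 / 2)"
      using assms ln_ge_zero[of "1 / \<rho>"] ln2_ge_two_thirds by (intro divide_left_mono) auto
    finally have "y \<le> 2 * ln (1 / \<rho>)" by simp
    moreover have "ln (1 / \<rho>) \<le> ln (3 / \<rho>)" using assms by (simp add: divide_right_mono)
    moreover have "real J \<le> y + 2" using y0 unfolding J_def by linarith
    ultimately show ?thesis by linarith
  qed
  ultimately show ?thesis by (intro exI[of _ J]) (simp add: J_def)
qed

section \<open>From atoms to their centres\<close>

definition centre :: "real \<Rightarrow> (real ^ 'n) set \<Rightarrow> real ^ 'n" where
  "centre \<delta> B = (SOME c. B = cball c (\<delta> / 2))"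

lemma centre: "is_atom \<delta> B \<Longrightarrow> B = cball (centre \<delta> B) (\<delta> / 2)"
  unfolding is_atom_def centre_def by (metis (mono_tags, lifting) someI_ex)

lemma coord_cball:
  fixes x y :: "real ^ 'n::finite"
  assumes "x \<in> cball y e"
  shows "\<bar>x $ j - y $ j\<bar> \<le> e"
  using component_le_norm_cart[of "x - y" j] assms by (simp add: dist_norm norm_minus_commute)

lemma centre_unit:
  assumes "is_atom \<delta> B" "0 < \<delta>"
  shows "0 \<le> centre \<delta> B $ j \<and> centre \<delta> B $ j \<le> 1"
proof -
  have "centre \<delta> B \<in> cball (centre \<delta> B) (\<delta> / 2)" using assms by simp
  then have "centre \<delta> B \<in> unit_cube" using centre[OF assms(1)] assms(1) by (auto simp: is_atom_def)
  then show ?thesis by (simp add: unit_cube_def mem_box_cart vec_def)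
qed

text \<open>Otherwise the midpoint of the two centres would lie in both atoms.\<close>

lemma dist_centres:
  fixes A :: "(real ^ 'n::finite) set set"
  assumes "pairwise disjnt A" "\<forall>B\<in>A. is_atom \<delta> B" "B \<in> A" "B' \<in> A" "B \<noteq> B'" "0 < \<delta>"
  shows "\<delta> < dist (centre \<delta> B) (centre \<delta> B')"
proof (rule ccontr)
  assume "\<not> ?thesis"
  then have le: "dist (centre \<delta> B) (centre \<delta> B') \<le> \<delta>" by simp
  define p where "p = midpoint (centre \<delta> B) (centre \<delta> B')"
  have "p \<in> cball (centre \<delta> B) (\<delta> / 2)" "p \<in> cball (centre \<delta> B') (\<delta> / 2)"
    using le by (simp_all add: p_def dist_midpoint dist_commute)
  then have "p \<in> B" "p \<in> B'" using centre[of \<delta> B] centre[of \<delta> B'] assms by auto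
  moreover have "disjnt B B'" using assms by (auto simp: pairwise_def)
  ultimately show False by (auto simp: disjnt_def)
qed

text \<open>\<open>well_spaced\<close> counts only atoms contained in a cube, hence the margin
  \<open>\<delta> / 2\<close> on every side of the box of centres.\<close>

lemma atoms_in_small_cube:
  fixes A :: "(real ^ 'n::finite) set set"
  assumes A: "finite A" "\<forall>B\<in>A. is_atom \<delta> B" "\<forall>a. card {B \<in> A. B \<subseteq> small_cube s a} \<le> M"
    and inj: "inj_on (centre \<delta>) A" and Q: "Q \<subseteq> centre \<delta> ` A"
    and box: "\<And>x j. x \<in> Q \<Longrightarrow> l j + \<delta> / 2 \<le> x $ j \<and> x $ j + \<delta> / 2 \<le> l j + s"
  shows "card Q \<le> M"
proof -
  have "Q \<subseteq> centre \<delta> ` {B \<in> A. B \<subseteq> small_cube s (\<chi> j. l j)}"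
  proof
    fix x assume x: "x \<in> Q"
    then obtain B where B: "B \<in> A" "x = centre \<delta> B" using Q by auto
    have "B \<subseteq> small_cube s (\<chi> j. l j)"
    proof
      fix y assume "y \<in> B"
      then have "y \<in> cball x (\<delta> / 2)" using centre[of \<delta> B] A B by auto
      then have "\<bar>y $ j - x $ j\<bar> \<le> \<delta> / 2" for j by (rule coord_cball)
      then have "l j \<le> y $ j \<and> y $ j \<le> l j + s" for j
        using box[OF x, of j] by (metis abs_diff_le_iff add_le_cancel_right diff_le_eq order_trans add.commute le_diff_eq)
      then show "y \<in> small_cube s (\<chi> j. l j)" by (simp add: small_cube_def mem_box_cart vec_def)
    qed
    then show "x \<in> centre \<delta> ` {B \<in> A. B \<subseteq> small_cube s (\<chi> j. l j)}" using B by auto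
  qed
  then have "card Q \<le> card (centre \<delta> ` {B \<in> A. B \<subseteq> small_cube s (\<chi> j. l j)})"
    by (rule card_mono[rotated]) (use A in auto)
  also have "\<dots> \<le> card {B \<in> A. B \<subseteq> small_cube s (\<chi> j. l j)}" by (rule card_image_le) (use A in auto)
  finally show ?thesis using A(3) by (meson le_trans)
qed

text \<open>If \<open>\<delta> \<le> 1 / (2 * W)\<close>, the small box enlarged by the radius of an
  atom fits into a cube of side \<open>1 / W\<close> and holds at most \<open>M\<close> centres. For
  larger \<open>\<delta>\<close> the atoms need not fit, but the box has diameter below
  \<open>\<delta>\<close>, and disjointness leaves at most one centre; \<open>M + 1\<close> covers
  both cases. The factor \<open>d\<close> in the side bounds the sum of the \<open>d\<close>
  coordinate differences by \<open>1 / (8 * W)\<close>.\<close>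

lemma spaced_centres:
  fixes A :: "(real ^ 'n::finite) set set" and W :: real
  assumes ws: "well_spaced K M \<delta> W A" and W: "0 < W" and \<delta>: "0 < \<delta>"
  shows "inj_on (centre \<delta>) A" "spaced (M + 1) (1 / (8 * real CARD('n) * W)) (centre \<delta> ` A)"
proof -
  let ?\<rho> = "1 / (8 * real CARD('n) * W)"
  have A: "finite A" "\<forall>B\<in>A. is_atom \<delta> B" "pairwise disjnt A" "\<forall>a. card {B \<in> A. B \<subseteq> small_cube (1 / W) a} \<le> M"
    using ws by (auto simp: well_spaced_def)
  show inj: "inj_on (centre \<delta>) A" by (rule inj_onI) (metis A(2) centre)
  have "card {x \<in> centre \<delta> ` A. \<forall>j. a j \<le> x $ j \<and> x $ j \<le> a j + ?\<rho>} \<le> M + 1" for a :: "'n \<Rightarrow> real"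
  proof -
    define Q where "Q = {x \<in> centre \<delta> ` A. \<forall>j. a j \<le> x $ j \<and> x $ j \<le> a j + ?\<rho>}"
    have \<rho>le: "?\<rho> \<le> 1 / (8 * W)" using W by (intro divide_left_mono) (auto simp: mult_le_cancel_right1)
    show ?thesis
    proof (cases "\<delta> \<le> 1 / (2 * W)")
      case True
      have "card Q \<le> M"
      proof (rule atoms_in_small_cube[OF A(1,2,4) inj, where l = "\<lambda>j. a j - \<delta> / 2"])
        have "1 / (8 * W) + 1 / (2 * W) \<le> 1 / W" using W by (simp add: field_simps)
        then show "a j - \<delta> / 2 + \<delta> / 2 \<le> x $ j \<and> x $ j + \<delta> / 2 \<le> a j - \<delta> / 2 + 1 / W" if "x \<in> Q" for x j
        proof -
          assume e: "1 / (8 * W) + 1 / (2 * W) \<le> 1 / W"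
          have "a j \<le> x $ j" "x $ j \<le> a j + ?\<rho>" using that by (auto simp: Q_def)
          then show ?thesis using \<rho>le True e by linarith
        qed
      qed (auto simp: Q_def)
      then show ?thesis by (simp add: Q_def)
    next
      case False
      have "card Q \<le> 1"
      proof (rule ccontr)
        assume "\<not> card Q \<le> 1"
        moreover have "finite Q" using A(1) by (simp add: Q_def)
        ultimately obtain x y where xy: "x \<in> Q" "y \<in> Q" "x \<noteq> y"
          using card_le_Suc0_iff_eq[of Q] by auto
        then obtain B B' where B: "B \<in> A" "x = centre \<delta> B" "B' \<in> A" "y = centre \<delta> B'" "B \<noteq> B'"
          by (auto simp: Q_def)
        have "\<bar>(x - y) $ j\<bar> \<le> ?\<rho>" for j
        proof -
          have "a j \<le> x $ j" "x $ j \<le> a j + ?\<rho>" "a j \<le> y $ j" "y $ j \<le> a j + ?\<rho>" using xy by (auto simp: Q_def)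
          then show ?thesis unfolding vector_minus_component by linarith
        qed
        then have "(\<Sum>j\<in>UNIV. \<bar>(x - y) $ j\<bar>) \<le> of_nat (card (UNIV :: 'n set)) * ?\<rho>"
          by (intro sum_bounded_above)
        also have "\<dots> = 1 / (8 * W)" using W by simp
        also have "\<dots> \<le> 1 / (2 * W)" using W by (simp add: field_simps)
        finally have "dist x y \<le> \<delta>" using norm_le_l1_cart[of "x - y"] False by (simp add: dist_norm)
        moreover have "\<delta> < dist x y" unfolding B(2,4) by (rule dist_centres[OF A(3,2) B(1,3,5) \<delta>])
        ultimately show False by simp
      qed
      then show ?thesis by (simp add: Q_def)
    qed
  qed
  then show "spaced (M + 1) ?\<rho> (centre \<delta> ` A)" using A(1) by (simp add: spaced_def)
qed

lemma card_passes_ge: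
  fixes A :: "(real ^ 'n::finite) set set"
  assumes A: "finite A" "\<forall>B\<in>A. is_atom \<delta> B" and inj: "inj_on (centre \<delta>) A" and \<delta>: "0 < \<delta>"
    and L: "chart i a b L" "rich \<delta> k A L"
  shows "k \<le> card {x \<in> centre \<delta> ` A. passes i a b \<delta> x}"
proof -
  have "k \<le> card {B \<in> A. incident B (tube \<delta> L)}" using L by (simp add: rich_def)
  also have "\<dots> = card (centre \<delta> ` {B \<in> A. incident B (tube \<delta> L)})"
    by (rule card_image[symmetric]) (rule inj_on_subset[OF inj], auto)
  also have "\<dots> \<le> card {x \<in> centre \<delta> ` A. passes i a b \<delta> x}"
  proof (rule card_mono)
    show "centre \<delta> ` {B \<in> A. incident B (tube \<delta> L)} \<subseteq> {x \<in> centre \<delta> ` A. passes i a b \<delta> x}"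
    proof clarify
      fix B assume B: "B \<in> A" "incident B (tube \<delta> L)"
      have "incident (cball (centre \<delta> B) (\<delta> / 2)) (tube \<delta> L)" using centre[of \<delta> B] A B by auto
      then have "passes i a b \<delta> (centre \<delta> B)" unfolding passes_def by (blast intro: incident_chart[OF L(1) \<delta>])
      then show "centre \<delta> B \<in> centre \<delta> ` A \<and> passes i a b \<delta> (centre \<delta> B)" using B by blast
    qed
  qed (use A in auto)
  finally show ?thesis .
qed

lemma passes_coord_close:
  assumes L: "chart i a b L" and "passes i a b \<delta> x" "passes i a b \<delta> x'"
  shows "\<bar>x $ j - x' $ j\<bar> \<le> \<bar>x $ i - x' $ i\<bar> + 6 * \<delta>"
proof -
  have "\<bar>(x $ i - x' $ i) * b $ j\<bar> \<le> \<bar>x $ i - x' $ i\<bar> * 1"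
    unfolding abs_mult by (rule mult_left_mono) (use L in \<open>auto simp: chart_def\<close>)
  then have "\<bar>x $ i * b $ j - x' $ i * b $ j\<bar> \<le> \<bar>x $ i - x' $ i\<bar>" by (simp add: left_diff_distrib)
  moreover have "\<bar>a $ j + x $ i * b $ j - x $ j\<bar> \<le> 3 * \<delta>" "\<bar>a $ j + x' $ i * b $ j - x' $ j\<bar> \<le> 3 * \<delta>"
    using assms(2,3) by (auto simp: passes_def)
  ultimately show ?thesis by linarith
qed

text \<open>At most \<open>N\<close> points of a tube lie within height \<open>\<rho>\<close> of a
  given one, since they fill a box of side \<open>4 * \<rho>\<close>, rounded up to 5 cubes. With
  \<open>2 * N\<close> points or more, at least half of all pairs are therefore far apart. With
  fewer, a single far pair suffices, as the left side is at most 1; without one, all points would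
  lie in one cube of side \<open>1 / W\<close>, which \<open>M < card X\<close> forbids. Here
  richness above \<open>M\<close> is essential.\<close>

lemma far_pairs:
  fixes A :: "(real ^ 'n::finite) set set" and W :: real
  assumes ws: "well_spaced K M \<delta> W A" and W: "0 < W" and \<delta>: "0 < \<delta>" and \<rho>: "\<rho> = 1 / (8 * real CARD('n) * W)" "6 * \<delta> \<le> \<rho>"
    and L: "chart i a b L" and X: "X = {x \<in> centre \<delta> ` A. passes i a b \<delta> x}" and k: "M < card X"
  shows "(real (card X))\<^sup>2 / (4 * (real ((M + 1) * 5 ^ CARD('n)))\<^sup>2) \<le> card {p \<in> X \<times> X. \<rho> \<le> \<bar>fst p $ i - snd p $ i\<bar>}"
proof -
  have A: "finite A" "\<forall>B\<in>A. is_atom \<delta> B" "\<forall>a. card {B \<in> A. B \<subseteq> small_cube (1 / W) a} \<le> M"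
    using ws by (auto simp: well_spaced_def)
  note sc = spaced_centres[OF ws W \<delta>]
  have sp: "spaced (M + 1) \<rho> (centre \<delta> ` A)" using sc(2) by (simp add: \<rho>)
  have \<rho>0: "0 < \<rho>" using \<delta> \<rho> by linarith
  have finX: "finite X" using A X by simp
  have close: "\<bar>x $ j - x' $ j\<bar> \<le> 2 * \<rho>" if "x \<in> X" "x' \<in> X" "\<bar>x $ i - x' $ i\<bar> < \<rho>" for x x' j
  proof -
    have "\<bar>x $ j - x' $ j\<bar> \<le> \<bar>x $ i - x' $ i\<bar> + 6 * \<delta>"
      by (rule passes_coord_close[OF L]) (use that X in auto)
    then show ?thesis using that(3) \<rho>(2) by linarith
  qed
  define N where "N = (M + 1) * 5 ^ CARD('n)"
  define n where "n = card X"
  define F where "F = {p \<in> X \<times> X. \<rho> \<le> \<bar>fst p $ i - snd p $ i\<bar>}"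
  have finF: "finite F" using finX by (simp add: F_def)
  have N1: "1 \<le> N" unfolding One_nat_def Suc_le_eq by (simp add: N_def)
  have few: "card {x' \<in> X. \<bar>x $ i - x' $ i\<bar> < \<rho>} \<le> N" if x: "x \<in> X" for x
  proof -
    have "card {x' \<in> X. \<bar>x $ i - x' $ i\<bar> < \<rho>} \<le> (M + 1) * (\<Prod>j\<in>(UNIV :: 'n set). 5)"
    proof (rule card_box[OF sp \<rho>0, where l = "\<lambda>j. x $ j - 2 * \<rho>"])
      fix x' j assume "x' \<in> {x' \<in> X. \<bar>x $ i - x' $ i\<bar> < \<rho>}"
      then have "\<bar>x $ j - x' $ j\<bar> \<le> 2 * \<rho>" using close[OF x, of x' j] by auto
      then show "x $ j - 2 * \<rho> \<le> x' $ j \<and> x' $ j < x $ j - 2 * \<rho> + real 5 * \<rho>" using \<rho>0 by auto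
    qed (auto simp: X)
    then show ?thesis by (simp add: N_def)
  qed
  have "(real n)\<^sup>2 / (4 * (real N)\<^sup>2) \<le> card F"
  proof (cases "2 * N \<le> n")
    case True
    have "n * (n - N) = (\<Sum>x\<in>X. n - N)" by (simp add: n_def)
    also have "\<dots> \<le> (\<Sum>x\<in>X. card {x' \<in> X. \<rho> \<le> \<bar>x $ i - x' $ i\<bar>})"
    proof (rule sum_mono)
      fix x assume x: "x \<in> X"
      have "X = {x' \<in> X. \<rho> \<le> \<bar>x $ i - x' $ i\<bar>} \<union> {x' \<in> X. \<bar>x $ i - x' $ i\<bar> < \<rho>}" by auto
      then have "n \<le> card {x' \<in> X. \<rho> \<le> \<bar>x $ i - x' $ i\<bar>} + card {x' \<in> X. \<bar>x $ i - x' $ i\<bar> < \<rho>}"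
        unfolding n_def using card_Un_le[of "{x' \<in> X. \<rho> \<le> \<bar>x $ i - x' $ i\<bar>}" "{x' \<in> X. \<bar>x $ i - x' $ i\<bar> < \<rho>}"]
        by (simp only:)
      then show "n - N \<le> card {x' \<in> X. \<rho> \<le> \<bar>x $ i - x' $ i\<bar>}" using few[OF x] by linarith
    qed
    also have "\<dots> = card (Sigma X (\<lambda>x. {x' \<in> X. \<rho> \<le> \<bar>x $ i - x' $ i\<bar>}))"
      using finX by (subst card_SigmaI) auto
    also have "Sigma X (\<lambda>x. {x' \<in> X. \<rho> \<le> \<bar>x $ i - x' $ i\<bar>}) = F" by (auto simp: F_def)
    finally have "real (n * (n - N)) \<le> card F" by (simp only: of_nat_le_iff)
    moreover have "(real n)\<^sup>2 / (4 * (real N)\<^sup>2) \<le> real (n * (n - N))"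
    proof -
      have "(real n)\<^sup>2 / (4 * (real N)\<^sup>2) \<le> (real n)\<^sup>2 / 4"
        using N1 by (intro divide_left_mono) auto
      also have "\<dots> = real n * (real n / 4)" by (simp add: power2_eq_square)
      also have "\<dots> \<le> real n * real (n - N)" by (rule mult_left_mono) (use True in auto)
      finally show ?thesis by simp
    qed
    ultimately show ?thesis by linarith
  next
    case False
    have "X \<noteq> {}" using k by auto
    then obtain x where x: "x \<in> X" by blast
    have "\<exists>x'\<in>X. \<rho> \<le> \<bar>x $ i - x' $ i\<bar>"
    proof (rule ccontr)
      assume "\<not> ?thesis"
      then have *: "\<bar>x $ j - x' $ j\<bar> \<le> 2 * \<rho>" if "x' \<in> X" for x' j using close[OF x] that by auto
      have W8: "8 * \<rho> \<le> 1 / W"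
      proof -
        have "\<rho> \<le> 1 / (8 * W)" unfolding \<rho>(1) using W by (intro divide_left_mono) (auto simp: mult_le_cancel_right1)
        then show ?thesis by (simp add: field_simps)
      qed
      have "card X \<le> M"
      proof (rule atoms_in_small_cube[OF A sc(1), where l = "\<lambda>j. x $ j - 3 * \<rho>"])
        fix x' j assume "x' \<in> X"
        then show "x $ j - 3 * \<rho> + \<delta> / 2 \<le> x' $ j \<and> x' $ j + \<delta> / 2 \<le> x $ j - 3 * \<rho> + 1 / W"
          using *[of x' j] W8 \<rho>(2) \<delta> by linarith
      qed (auto simp: X)
      then show False using k by simp
    qed
    then obtain x' where "x' \<in> X" "\<rho> \<le> \<bar>x $ i - x' $ i\<bar>" by blast
    then have "(x, x') \<in> F" using x by (simp add: F_def)
    then have "1 \<le> card F" using finF by (metis One_nat_def Suc_leI card_gt_0_iff empty_iff)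
    moreover have "(real n)\<^sup>2 / (4 * (real N)\<^sup>2) \<le> 1"
    proof -
      have "(real n)\<^sup>2 \<le> (2 * real N)\<^sup>2" by (rule power_mono) (use False in auto)
      then show ?thesis using N1 by (simp add: power_mult_distrib divide_le_eq)
    qed
    ultimately show ?thesis by linarith
  qed
  then show ?thesis by (simp only: n_def N_def F_def)
qed

text \<open>The auxiliary thickness is \<open>\<delta>'\<close> with \<open>\<delta>' ^ (d - 1) \<sim> k * \<rho> ^ d / J\<close>: the largest one for which \<open>k\<close> still beats the
  number of points in a random \<open>\<delta>'\<close>-tube. The hypothesis on \<open>k\<close> ensures \<open>\<delta> \<le> \<delta>'\<close>.\<close>

lemma rich_tubes_count:
  fixes K \<epsilon> \<delta> W C\<^sub>L :: real and M k :: nat and A :: "(real ^ 'n::finite) set set"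
  defines "d \<equiv> CARD('n)"
  defines "N \<equiv> real ((M + 1) * 5 ^ d)"
  defines "c \<equiv> 1 / (4 * N\<^sup>2)"
  defines "B \<equiv> 3 * real (M + 1) * (48 * real d + 7) ^ (d - 1)"
  defines "G \<equiv> 6 * real (M + 1) * 81 ^ (d - 1) + 9 ^ (d - 1) * B"
  defines "Z \<equiv> 2 * real d * (2475 * (real d)\<^sup>2) ^ (d - 1) * G * (8 * real d) ^ d * K
    * (32 * real (d - 1) * 3672 ^ (d - 1) * real (M + 1))"
  assumes d2: "d \<ge> 2" and K: "K \<ge> 1"
    and CL: "\<And>\<delta>. 0 < \<delta> \<Longrightarrow> \<delta> < 1 \<Longrightarrow> (3 + 2 * ln (24 * real d / \<delta>)) ^ 5 \<le> C\<^sub>L * \<delta> powr (- \<epsilon>)"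
    and \<delta>: "0 < \<delta>" and W: "1 < W" "W < 1 / \<delta>" and ws: "well_spaced K M \<delta> W A" and k: "M < k"
    and krich: "real k \<ge> (2 * C\<^sub>L * (8 * real d) ^ d * K * G / c) * \<delta> powr (- \<epsilon>) * (\<delta> ^ (d - 1) * real (card A))"
    and T: "distinct_rich_tubes \<delta> k A T" "finite T"
  shows "real (card T) \<le> (C\<^sub>L * (8 * Z / c ^ 3)) * \<delta> powr (- \<epsilon>) * ((real (card A))\<^sup>2 / real k ^ 3)"
proof -
  have \<delta>1: "\<delta> < 1"
  proof -
    have "1 < 1 / \<delta>" using W by linarith
    then show ?thesis using \<delta> by simp
  qed
  define \<rho> where "\<rho> = 1 / (8 * real d * W)"
  have dpos: "0 < real d" "1 \<le> real d" using d2 by auto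
  have \<rho>: "0 < \<rho>" "\<rho> \<le> 1"
  proof -
    have "1 \<le> real d * W" using dpos(2) W mult_mono[of 1 "real d" 1 W] by simp
    then have "1 \<le> 8 * real d * W" by simp
    moreover have "0 < 8 * real d * W" using calculation by linarith
    ultimately show "0 < \<rho>" "\<rho> \<le> 1"
      unfolding \<rho>_def zero_less_divide_1_iff divide_le_eq_1 by linarith+
  qed
  have A: "finite A" "\<forall>B\<in>A. is_atom \<delta> B" "W ^ d \<le> K * real (card A)"
    using ws K unfolding well_spaced_def d_def by (auto simp: divide_le_eq mult.commute)
  have W0: "0 < W" using W by linarith
  define P where "P = centre \<delta> ` A"
  note sc = spaced_centres[OF ws W0 \<delta>]
  have inj: "inj_on (centre \<delta>) A" by (rule sc(1))
  have sp: "spaced (M + 1) \<rho> P" using sc(2) by (simp add: \<rho>_def P_def d_def)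
  have cardP: "card P = card A" unfolding P_def by (rule card_image[OF inj])
  have P01: "0 \<le> x $ j \<and> x $ j \<le> 1" if "x \<in> P" for x j
    using that A \<delta> centre_unit unfolding P_def by blast
  have N1: "1 \<le> N"
  proof -
    have "1 \<le> (M + 1) * 5 ^ d" unfolding One_nat_def Suc_le_eq by simp
    then have "real 1 \<le> real ((M + 1) * 5 ^ d)" by (simp only: of_nat_le_iff)
    then show ?thesis by (simp only: N_def of_nat_1)
  qed
  have c: "0 < c" "c \<le> 1"
  proof -
    have "1 \<le> N\<^sup>2" using N1 by (simp add: one_le_power)
    then have "1 \<le> 4 * N\<^sup>2" "0 < 4 * N\<^sup>2" by linarith+
    then show "0 < c" "c \<le> 1" unfolding c_def zero_less_divide_1_iff divide_le_eq_1 by linarith+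
  qed
  have B0: "0 < B" using dpos by (simp add: B_def)
  have G0: "0 < G" using B0 by (simp add: G_def add_pos_pos)
  have k0: "0 < k" using k by simp
  \<comment> \<open>Majorizes both \<open>J\<close> and the logarithm of the energy bound; the final
    loss is \<open>J ^ 4 * Y\<close>, hence the fifth power.\<close>
  define Y where "Y = 3 + 2 * ln (3 / \<rho>)"
  obtain J :: nat where J: "1 \<le> J" "(1 / 2) ^ J \<le> \<rho>" "real J \<le> Y"
    using dyadic_exponent[OF \<rho>] unfolding Y_def by blast
  have Jpos: "0 < real J" "1 \<le> real J" using J by auto
  have Y1: "1 \<le> Y" using J Jpos by linarith
  have Y5: "Y ^ 5 \<le> C\<^sub>L * \<delta> powr (- \<epsilon>)"
  proof -
    have "3 / \<rho> = 24 * real d * W" by (simp add: \<rho>_def)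
    also have "\<dots> \<le> 24 * real d * (1 / \<delta>)" using W dpos by (intro mult_left_mono) auto
    finally have "3 / \<rho> \<le> 24 * real d / \<delta>" by simp
    then have "ln (3 / \<rho>) \<le> ln (24 * real d / \<delta>)" using \<rho> by (intro ln_mono) auto
    then have "Y ^ 5 \<le> (3 + 2 * ln (24 * real d / \<delta>)) ^ 5"
      using Y1 by (intro power_mono) (auto simp: Y_def)
    then show ?thesis using CL[OF \<delta> \<delta>1] by linarith
  qed
  have JCL: "real J \<le> C\<^sub>L * \<delta> powr (- \<epsilon>)"
    using J(3) Y5 self_le_power[OF Y1, of 5] by linarith
  define RHS where "RHS = (C\<^sub>L * (8 * Z / c ^ 3)) * \<delta> powr (- \<epsilon>) * ((real (card A))\<^sup>2 / real k ^ 3)"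
  have Z0: "0 \<le> Z" using G0 K by (simp add: Z_def)
  have RHS: "(8 * Z / c ^ 3) * Y ^ 5 * ((real (card A))\<^sup>2 / real k ^ 3) \<le> RHS"
  proof -
    have "(8 * Z / c ^ 3 * ((real (card A))\<^sup>2 / real k ^ 3)) * Y ^ 5
       \<le> (8 * Z / c ^ 3 * ((real (card A))\<^sup>2 / real k ^ 3)) * (C\<^sub>L * \<delta> powr (- \<epsilon>))"
      using Y5 Z0 c by (intro mult_left_mono) auto
    then show ?thesis by (simp only: RHS_def mult_ac)
  qed
  show ?thesis
  \<comment> \<open>The upper bound for \<open>k\<close> below is read off from one rich
    tube.\<close>
  proof (cases "T = {}")
    case True
    have "0 \<le> (8 * Z / c ^ 3) * Y ^ 5 * ((real (card A))\<^sup>2 / real k ^ 3)" using Z0 c Y1 by simp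
    then show ?thesis using RHS True by (simp add: RHS_def)
  next
    case False
    have "\<exists>i a b. chart i a b L" if "L \<in> T" for L
      by (rule chart_exists) (use T that in \<open>auto simp: distinct_rich_tubes_def\<close>)
    then obtain f a b where ch: "\<And>L. L \<in> T \<Longrightarrow> chart (f L) (a L) (b L) L" by metis
    have richL: "k \<le> card {x \<in> P. passes (f L) (a L) (b L) \<delta> x}" if "L \<in> T" for L
      unfolding P_def by (rule card_passes_ge[OF A(1,2) inj \<delta> ch[OF that]])
        (use T that in \<open>auto simp: distinct_rich_tubes_def\<close>)
    \<comment> \<open>Since \<open>\<delta> < 1 / W = 8 * d * \<rho>\<close>, passing within
      \<open>3 * \<delta>\<close> implies passing within \<open>24 * d * \<rho>\<close>, whence the
      \<open>48 * d + 7\<close> in \<open>B\<close>. This bound keeps \<open>\<delta>'\<close> below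
      \<open>\<rho> / 9\<close>.\<close>
    have k\<rho>: "real k * \<rho> \<le> B"
    proof -
      obtain L where L: "L \<in> T" using False by blast
      define X where "X = {x \<in> P. passes (f L) (a L) (b L) \<delta> x}"
      have "real (card X) \<le> 3 * real (M + 1) * (2 * real (24 * d) + 7) ^ (CARD('n) - 1) / \<rho>"
      proof (rule card_near_line[OF sp \<rho>, where i = "f L" and a = "\<lambda>j. a L $ j" and b = "\<lambda>j. b L $ j"])
        fix x j assume x: "x \<in> X"
        then show "0 \<le> x $ f L \<and> x $ f L \<le> 2" using P01[of x "f L"] by (auto simp: X_def)
        have "\<delta> \<le> 1 / W" using W \<delta> W0 by (simp add: field_simps)
        also have "1 / W = 8 * real d * \<rho>" using dpos by (simp add: \<rho>_def)
        finally have "\<delta> \<le> 8 * real d * \<rho>" .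
        moreover have "real (24 * d) * \<rho> = 3 * (8 * real d * \<rho>)" by simp
        ultimately have "3 * \<delta> \<le> real (24 * d) * \<rho>" by linarith
        then show "\<bar>a L $ j + x $ f L * b L $ j - x $ j\<bar> \<le> real (24 * d) * \<rho>"
          using x unfolding X_def passes_def by (blast intro: order_trans)
      next
        show "\<bar>b L $ j\<bar> \<le> 3" for j
          using ch[OF L] unfolding chart_def by (meson one_le_numeral order_trans)
      qed (auto simp: X_def)
      then have "real (card X) \<le> B / \<rho>" by (simp add: B_def d_def)
      moreover have "real k \<le> real (card X)" using richL[OF L] by (simp add: X_def)
      ultimately have "real k \<le> B / \<rho>" by linarith
      then show ?thesis by (simp only: pos_le_divide_eq[OF \<rho>(1)])
    qed
    define \<theta> where "\<theta> = c * k / (2 * J)"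
    have \<theta>0: "0 < \<theta>" using c k0 Jpos by (simp add: \<theta>_def)
    have \<theta>k: "\<theta> \<le> real k"
    proof -
      have "c * real k \<le> (2 * real J) * real k" using c Jpos by (intro mult_right_mono) auto
      then show ?thesis using Jpos by (simp add: \<theta>_def divide_le_eq mult_ac)
    qed
    have d1: "0 < d - 1" using d2 by simp
    have dS: "x ^ d = x ^ (d - 1) * x" for x :: real using d2 by (simp add: power_eq_if)
    \<comment> \<open>\<open>G\<close> adds up the constants of two requirements: the first summand
      puts the threshold of \<open>tubes_bound\<close> below \<open>\<theta>\<close>, the second
      gives \<open>9 * \<delta>' \<le> \<rho>\<close>.\<close>
    define \<delta>' where "\<delta>' = root (d - 1) (\<theta> * \<rho> ^ d / G)"
    have pow: "\<delta>' ^ (d - 1) = \<theta> * \<rho> ^ d / G"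
      unfolding \<delta>'_def using d1 \<theta>0 \<rho> G0 by (intro real_root_pow_pos2) auto
    have \<delta>'0: "0 < \<delta>'" unfolding \<delta>'_def using d1 \<theta>0 \<rho> G0 by simp
    have \<rho>d: "\<rho> ^ d = 1 / ((8 * real d) ^ d * W ^ d)" by (simp add: \<rho>_def power_divide power_mult_distrib)
    have \<delta>\<delta>': "\<delta> \<le> \<delta>'"
    proof -
      \<comment> \<open>\<open>\<theta>\<close> carries a factor \<open>1 / J\<close>, and the power
        \<open>\<delta> powr (- \<epsilon>)\<close> in the hypothesis on \<open>k\<close> pays for
        it.\<close>
      have "G * \<delta> ^ (d - 1) \<le> \<theta> * \<rho> ^ d"
      proof -
        have "G * \<delta> ^ (d - 1) * (real J * ((8 * real d) ^ d * W ^ d))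
           = (G * \<delta> ^ (d - 1) * (8 * real d) ^ d) * (real J * W ^ d)" by (simp only: mult_ac)
        also have "\<dots> \<le> (G * \<delta> ^ (d - 1) * (8 * real d) ^ d) * ((C\<^sub>L * \<delta> powr (- \<epsilon>)) * (K * real (card A)))"
          using JCL A(3) G0 \<delta> W0 Jpos by (intro mult_left_mono mult_mono) auto
        also have "\<dots> = (c / 2) * ((2 * C\<^sub>L * (8 * real d) ^ d * K * G / c) * \<delta> powr (- \<epsilon>) * (\<delta> ^ (d - 1) * real (card A)))"
          using c by simp
        also have "\<dots> \<le> (c / 2) * real k" using krich c by (intro mult_left_mono) auto
        finally have "G * \<delta> ^ (d - 1) * (real J * ((8 * real d) ^ d * W ^ d)) \<le> (c / 2) * real k" .
        then have "G * \<delta> ^ (d - 1) \<le> (c / 2) * real k / (real J * ((8 * real d) ^ d * W ^ d))"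
          using Jpos dpos W0 by (subst pos_le_divide_eq) auto
        then show ?thesis by (simp add: \<theta>_def \<rho>d)
      qed
      then have "\<delta> ^ (d - 1) \<le> \<delta>' ^ (d - 1)" unfolding pow using G0 by (simp add: pos_le_divide_eq mult.commute)
      then show ?thesis using power_mono_iff[of \<delta> \<delta>' "d - 1"] \<delta> \<delta>'0 d1 by simp
    qed
    have \<delta>'\<rho>: "9 * \<delta>' \<le> \<rho>"
    proof -
      have "\<theta> * \<rho> \<le> B" using mult_right_mono[OF \<theta>k, of \<rho>] k\<rho> \<rho> by linarith
      then have "9 ^ (d - 1) * (\<theta> * \<rho>) \<le> 9 ^ (d - 1) * B" by (intro mult_left_mono) auto
      also have "\<dots> \<le> G" by (simp add: G_def)
      finally have "9 ^ (d - 1) * (\<theta> * \<rho>) / G \<le> 1" using G0 by (simp add: divide_le_eq)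
      then have "\<rho> ^ (d - 1) * (9 ^ (d - 1) * (\<theta> * \<rho>) / G) \<le> \<rho> ^ (d - 1) * 1"
        using \<rho> by (intro mult_left_mono) auto
      moreover have "(9 * \<delta>') ^ (d - 1) = \<rho> ^ (d - 1) * (9 ^ (d - 1) * (\<theta> * \<rho>) / G)"
        unfolding power_mult_distrib pow dS[of \<rho>] by simp
      ultimately have "(9 * \<delta>') ^ (d - 1) \<le> \<rho> ^ (d - 1)" by simp
      then show ?thesis using power_mono_iff[of "9 * \<delta>'" \<rho> "d - 1"] \<delta>'0 \<rho> d1 by simp
    qed
    have thr: "2 * (9 * \<delta>' / \<rho>) ^ (d - 1) * (3 * real (M + 1) * 9 ^ (d - 1) / \<rho>) \<le> \<theta>"
    proof -
      have "2 * (9 * \<delta>' / \<rho>) ^ (d - 1) * (3 * real (M + 1) * 9 ^ (d - 1) / \<rho>)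
        = 6 * real (M + 1) * (9 ^ (d - 1) * 9 ^ (d - 1)) * (\<delta>' ^ (d - 1) / \<rho> ^ d)"
        by (simp add: power_divide power_mult_distrib dS[of \<rho>])
      also have "9 ^ (d - 1) * 9 ^ (d - 1) = (81 :: real) ^ (d - 1)" by (simp flip: power_mult_distrib)
      also have "\<delta>' ^ (d - 1) / \<rho> ^ d = \<theta> / G" unfolding pow using \<rho> by simp
      also have "6 * real (M + 1) * 81 ^ (d - 1) * (\<theta> / G) \<le> G * (\<theta> / G)"
        using B0 \<theta>0 G0 by (intro mult_right_mono) (auto simp: G_def)
      also have "\<dots> = \<theta>" using G0 by simp
      finally show ?thesis .
    qed
    have "6 * \<delta> \<le> \<rho>" using \<delta>\<delta>' \<delta>'\<rho> \<delta> by linarith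
    have "card T * \<theta>\<^sup>2 \<le> CARD('n) * J * 2 * card P * ((2475 * (real CARD('n))\<^sup>2 / \<delta>') ^ (CARD('n) - 1)
       * (32 * real (CARD('n) - 1) * 3672 ^ (CARD('n) - 1) * real (M + 1) * (3 + 2 * ln (3 / \<rho>))))"
      unfolding \<theta>_def
    proof (rule tubes_bound[OF sp _ \<rho> \<delta> \<delta>\<delta>' \<delta>'\<rho> J(2,1) P01 T(2) ch _ _ c(1) k0 _ richL])
      show "CARD('n) \<ge> 2" using d2 by (simp add: d_def)
      show "tube_axis L" if "L \<in> T" for L using T that by (auto simp: distinct_rich_tubes_def)
      show "pairwise (distinct_tubes \<delta>) T" using T by (auto simp: distinct_rich_tubes_def)
      show "2 * (9 * \<delta>' / \<rho>) ^ (CARD('n) - 1) * (3 * real (M + 1) * 9 ^ (CARD('n) - 1) / \<rho>) \<le> c * k / (2 * J)"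
        using thr by (simp only: d_def \<theta>_def)
      fix L X assume L: "L \<in> T" and X: "X = {x \<in> P. passes (f L) (a L) (b L) \<delta> x}"
      have "M < card X" using richL[OF L] k by (simp add: X)
      from far_pairs[OF ws W0 \<delta> \<rho>_def[unfolded d_def] \<open>6 * \<delta> \<le> \<rho>\<close> ch[OF L] X[unfolded P_def] this]
      show "c * (real (card X))\<^sup>2 \<le> card {p \<in> X \<times> X. \<rho> \<le> \<bar>fst p $ f L - snd p $ f L\<bar>}"
        by (simp add: c_def N_def d_def)
    qed
    also have "\<dots> = 2 * real d * J * card A * ((2475 * (real d)\<^sup>2) ^ (d - 1) / \<delta>' ^ (d - 1)
       * (32 * real (d - 1) * 3672 ^ (d - 1) * real (M + 1) * Y))"
      by (simp only: d_def Y_def cardP power_divide of_nat_mult of_nat_numeral mult_ac)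
    \<comment> \<open>\<open>1 / \<delta>' ^ (d - 1)\<close> is at most a constant times
      \<open>card A / \<theta>\<close>; this supplies the second factor \<open>card A\<close> and
      the third factor \<open>\<theta>\<close>.\<close>
    also have "\<dots> \<le> 2 * real d * J * card A * ((2475 * (real d)\<^sup>2) ^ (d - 1) * (G * (8 * real d) ^ d * (K * card A) / \<theta>)
       * (32 * real (d - 1) * 3672 ^ (d - 1) * real (M + 1) * Y))"
    proof -
      have "1 / \<delta>' ^ (d - 1) = G * (8 * real d) ^ d * W ^ d / \<theta>" unfolding pow \<rho>d by simp
      also have "\<dots> \<le> G * (8 * real d) ^ d * (K * card A) / \<theta>"
        using A(3) G0 \<theta>0 by (intro divide_right_mono mult_left_mono) auto
      finally have "(2475 * (real d)\<^sup>2) ^ (d - 1) * (1 / \<delta>' ^ (d - 1))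
         \<le> (2475 * (real d)\<^sup>2) ^ (d - 1) * (G * (8 * real d) ^ d * (K * card A) / \<theta>)"
        by (intro mult_left_mono) auto
      then show ?thesis using Y1 by (intro mult_left_mono mult_right_mono) auto
    qed
    also have "\<dots> = Z * J * Y * (real (card A))\<^sup>2 / \<theta>"
      by (simp add: Z_def power2_eq_square)
    finally have "card T * \<theta>\<^sup>2 \<le> Z * J * Y * (real (card A))\<^sup>2 / \<theta>" .
    then have "card T * \<theta> ^ 3 \<le> Z * J * Y * (real (card A))\<^sup>2"
      using \<theta>0 by (simp add: pos_le_divide_eq power3_eq_cube power2_eq_square mult_ac)
    then have "card T \<le> Z * J * Y * (real (card A))\<^sup>2 / \<theta> ^ 3" using \<theta>0 by (simp add: pos_le_divide_eq)
    \<comment> \<open>Of the four factors \<open>J\<close>, one counts the scales, two come from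
      \<open>\<theta>\<^sup>2\<close> and one from \<open>\<delta>' ^ (d - 1)\<close>, which is
      proportional to \<open>\<theta>\<close>.\<close>
    also have "\<dots> = (8 * Z / c ^ 3) * (real J ^ 4 * Y) * ((real (card A))\<^sup>2 / real k ^ 3)"
      using c k0 Jpos by (simp add: \<theta>_def power_divide power_mult_distrib field_simps eval_nat_numeral)
    also have "\<dots> \<le> (8 * Z / c ^ 3) * Y ^ 5 * ((real (card A))\<^sup>2 / real k ^ 3)"
    proof -
      have "real J ^ 4 * Y \<le> Y ^ 4 * Y" using J(3) Y1 by (intro mult_right_mono power_mono) auto
      also have "\<dots> = Y ^ 5" by (simp add: eval_nat_numeral)
      finally show ?thesis using Z0 c by (intro mult_right_mono mult_left_mono) auto
    qed
    also have "\<dots> \<le> RHS" by (rule RHS)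
    finally show ?thesis by (simp only: RHS_def)
  qed
qed

theorem theorem1:
  fixes K \<epsilon> :: real and M :: nat
  assumes "CARD('n::finite) \<ge> 2" and "K \<ge> 1" and "\<epsilon> > 0"
  shows "\<exists>C\<^sub>1 > 0. \<exists>C\<^sub>2 > 0. \<forall>(\<delta>::real) (W::real) (A::(real ^ 'n) set set) (k::nat) T.
           0 < \<delta> \<longrightarrow> 1 < W \<longrightarrow> W < 1 / \<delta> \<longrightarrow> well_spaced K M \<delta> W A \<longrightarrow>
           2 \<le> k \<longrightarrow> M < k \<longrightarrow>
           real k \<ge> C\<^sub>1 * \<delta> powr (- \<epsilon>) * (\<delta> ^ (CARD('n) - 1) * real (card A)) \<longrightarrow>
           distinct_rich_tubes \<delta> k A T \<longrightarrow>
           finite T \<and>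
           real (card T) \<le> C\<^sub>2 * \<delta> powr (- \<epsilon>) * ((real (card A))\<^sup>2 / real k ^ 3)"
proof -
  define d where "d = CARD('n)"
  have d: "d \<ge> 2" using assms by (simp add: d_def)
  define N where "N = real ((M + 1) * 5 ^ d)"
  define c where "c = 1 / (4 * N\<^sup>2)"
  define B where "B = 3 * real (M + 1) * (48 * real d + 7) ^ (d - 1)"
  define G where "G = 6 * real (M + 1) * 81 ^ (d - 1) + 9 ^ (d - 1) * B"
  define Z where "Z = 2 * real d * (2475 * (real d)\<^sup>2) ^ (d - 1) * G * (8 * real d) ^ d * K
    * (32 * real (d - 1) * 3672 ^ (d - 1) * real (M + 1))"
  obtain C\<^sub>L where CL: "C\<^sub>L > 0" "\<And>\<delta>. 0 < \<delta> \<Longrightarrow> \<delta> < 1 \<Longrightarrow> (3 + 2 * ln (24 * real d / \<delta>)) ^ 5 \<le> C\<^sub>L * \<delta> powr (- \<epsilon>)"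
    using log_power_bound[OF assms(3), of "24 * real d" 5] d by auto
  have N0: "0 < N" unfolding N_def by (simp only: of_nat_0_less_iff) simp
  have pos: "0 < c" "0 < B" "0 < G" "0 < Z"
  proof -
    show "0 < c" using N0 by (simp add: c_def)
    show "0 < B" using d by (simp add: B_def)
    then show "0 < G" by (simp add: G_def add_pos_pos)
    then show "0 < Z" using d assms(2) by (simp add: Z_def)
  qed
  define C1 where "C1 = 2 * C\<^sub>L * (8 * real d) ^ d * K * G / c"
  define C2 where "C2 = C\<^sub>L * (8 * Z / c ^ 3)"
  have C: "0 < C1" "0 < C2" using pos CL(1) d assms(2) by (simp_all add: C1_def C2_def)
  have main: "finite T \<and> real (card T) \<le> C2 * \<delta> powr (- \<epsilon>) * ((real (card A))\<^sup>2 / real k ^ 3)"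
    if h: "0 < \<delta>" "1 < W" "W < 1 / \<delta>" "well_spaced K M \<delta> W A" "M < k"
      "real k \<ge> C1 * \<delta> powr (- \<epsilon>) * (\<delta> ^ (CARD('n) - 1) * real (card A))" "distinct_rich_tubes \<delta> k A T"
    for \<delta> W :: real and A :: "(real ^ 'n) set set" and k T
  proof -
    define R where "R = C2 * \<delta> powr (- \<epsilon>) * ((real (card A))\<^sup>2 / real k ^ 3)"
    \<comment> \<open>Finiteness of \<open>T\<close> is part of the claim: the bound is uniform over
      the finite subfamilies, which are again distinct and rich, and this forces \<open>T\<close> to
      be finite.\<close>
    have sub: "real (card F) \<le> R" if F: "F \<subseteq> T" "finite F" for F
    proof -
      have "distinct_rich_tubes \<delta> k A F"
        using h(7) F(1) pairwise_subset unfolding distinct_rich_tubes_def by blast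
      then show ?thesis
        unfolding R_def C2_def Z_def G_def B_def c_def N_def d_def
        by (intro rich_tubes_count[OF assms(1,2) CL(2)[unfolded d_def] h(1-5)
            h(6)[unfolded C1_def G_def B_def c_def N_def d_def] _ F(2)])
    qed
    have "finite T \<and> card T \<le> nat \<lfloor>R\<rfloor>"
    proof (rule finite_if_finite_subsets_card_bdd)
      fix F assume "F \<subseteq> T" "finite F"
      from sub[OF this] show "card F \<le> nat \<lfloor>R\<rfloor>" by (simp add: le_nat_floor)
    qed
    then show ?thesis using sub[of T] by (simp add: R_def)
  qed
  show ?thesis
    by (rule exI[of _ C1], rule conjI[OF C(1)], rule exI[of _ C2], rule conjI[OF C(2)])
       (use main in blast)
qed

end
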